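(* Fix an o-minimal structure. Let $D \colon \mathbb{R}^p \rightrightarrows \mathbb{R}^p$ be a definable conservative field with a definable potential $f$, and let $x \colon \mathbb{R}_+ \to \mathbb{R}^p$ be a solution of the differential inclusion $\dot{x}(t) \in - \mathrm{conv}(D(x(t)))$ (i.e. $x$ absolutely continuous and the inclusion holds for almost every $t$). If $x$ is bounded, then $\int_0^{+\infty} \|\dot{x}(t)\|\,dt < + \infty$, and in particular $x(t)$ converges as $t\to\infty$.
   Context: A set valued map $D\colon\mathbb{R}^p\rightrightarrows\mathbb{R}^p$ is a conservative field if its graph is closed, its values are nonempty and compact, and for every absolutely continuous loop $\gamma\colon[0,1]\to\mathbb{R}^p$, $\int_0^1 \max_{v\in D(\gamma(t))}\langle\dot\gamma(t),v\rangle\,dt=0$; $f$ is a potential of $D$ if $f(x)=f(0)+\int_0^1\max_{v\in D(\gamma(t))}\langle\dot\gamma(t),v\rangle\,dt$ for every absolutely continuous $\gamma$ from $0$ to $x$. Definable means belonging (via graph, for maps) to a fixed o-minimal structure on $(\mathbb{R},+,\cdot)$ (e.g. semialgebraic sets): a family of Boolean algebras of subsets of $\mathbb{R}^p$ containing algebraic sets, stable under products with $\mathbb{R}$ and coordinate projections, whose subsets of $\mathbb{R}$ are exactly finite unions of intervals and points. *)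

theory Defs
  imports "HOL-Analysis.Analysis"
begin

datatype mpoly = PVar nat | PConst real | PAdd mpoly mpoly | PMul mpoly mpoly

fun mpoly_eval :: "mpoly \<Rightarrow> real list \<Rightarrow> real" where
  "mpoly_eval (PVar i) xs = (if i < length xs then xs ! i else 0)"
| "mpoly_eval (PConst c) xs = c"
| "mpoly_eval (PAdd p q) xs = mpoly_eval p xs + mpoly_eval q xs"
| "mpoly_eval (PMul p q) xs = mpoly_eval p xs * mpoly_eval q xs"

definition Rn :: "nat \<Rightarrow> real list set" where
  "Rn n = {xs. length xs = n}"

definition algebraic_set :: "nat \<Rightarrow> real list set \<Rightarrow> bool" where
  "algebraic_set n A \<longleftrightarrow> (\<exists>P. A = {xs \<in> Rn n. mpoly_eval P xs = 0})"

definition o_minimal :: "(nat \<Rightarrow> real list set set) \<Rightarrow> bool" where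
  "o_minimal S \<longleftrightarrow>
     (\<forall>n. (\<forall>A\<in>S n. A \<subseteq> Rn n) \<and> {} \<in> S n
        \<and> (\<forall>A\<in>S n. \<forall>B\<in>S n. A \<union> B \<in> S n)
        \<and> (\<forall>A\<in>S n. Rn n - A \<in> S n)
        \<and> (\<forall>A. algebraic_set n A \<longrightarrow> A \<in> S n)
        \<and> (\<forall>A\<in>S n. {xs @ [r] | xs r. xs \<in> A} \<in> S (Suc n)
                   \<and> {r # xs | xs r. xs \<in> A} \<in> S (Suc n))
        \<and> (\<forall>A\<in>S (Suc n). butlast ` A \<in> S n))
   \<and> S 1 = {(\<lambda>r. [r]) ` \<Union>F | F. finite F \<and> (\<forall>I\<in>F. is_interval I)}"

definition coord_order :: "'p::finite list" where
  "coord_order = (SOME l. distinct l \<and> set l = UNIV)"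

definition coords :: "real ^ 'p::finite \<Rightarrow> real list" where
  "coords x = map (\<lambda>i. x $ i) coord_order"

definition definable_setvalued ::
  "(nat \<Rightarrow> real list set set) \<Rightarrow> (real ^ 'p::finite \<Rightarrow> (real ^ 'p) set) \<Rightarrow> bool" where
  "definable_setvalued S D \<longleftrightarrow>
     {coords x @ coords v | x v. v \<in> D x} \<in> S (2 * CARD('p))"

definition definable_fun ::
  "(nat \<Rightarrow> real list set set) \<Rightarrow> (real ^ 'p::finite \<Rightarrow> real) \<Rightarrow> bool" where
  "definable_fun S f \<longleftrightarrow> {coords x @ [f x] | x. True} \<in> S (Suc CARD('p))"

definition abs_continuous_on :: "real set \<Rightarrow> (real \<Rightarrow> 'a::real_normed_vector) \<Rightarrow> bool" where
  "abs_continuous_on I g \<longleftrightarrow>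
     (\<forall>\<epsilon>>0. \<exists>\<delta>>0. \<forall>(n::nat) (a::nat \<Rightarrow> real) b.
        (\<forall>k<n. a k \<le> b k \<and> {a k..b k} \<subseteq> I)
        \<and> (\<forall>j<n. \<forall>k<n. j \<noteq> k \<longrightarrow> {a j<..<b j} \<inter> {a k<..<b k} = {})
        \<and> (\<Sum>k<n. b k - a k) < \<delta>
        \<longrightarrow> (\<Sum>k<n. norm (g (b k) - g (a k))) < \<epsilon>)"

definition support_integrand ::
  "(real ^ 'p::finite \<Rightarrow> (real ^ 'p) set) \<Rightarrow> (real \<Rightarrow> real ^ 'p) \<Rightarrow> real \<Rightarrow> real" where
  "support_integrand D \<gamma> t = (SUP v\<in>D (\<gamma> t). vector_derivative \<gamma> (at t) \<bullet> v)"

definition conservative_field :: "(real ^ 'p::finite \<Rightarrow> (real ^ 'p) set) \<Rightarrow> bool" where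
  "conservative_field D \<longleftrightarrow>
     closed {(x, v). v \<in> D x}
     \<and> (\<forall>x. D x \<noteq> {} \<and> compact (D x))
     \<and> (\<forall>\<gamma>. abs_continuous_on {0..1} \<gamma> \<and> \<gamma> 0 = \<gamma> 1
            \<longrightarrow> (support_integrand D \<gamma> has_integral 0) {0..1})"

definition potential_of ::
  "(real ^ 'p::finite \<Rightarrow> real) \<Rightarrow> (real ^ 'p \<Rightarrow> (real ^ 'p) set) \<Rightarrow> bool" where
  "potential_of f D \<longleftrightarrow>
     (\<forall>\<gamma> x. abs_continuous_on {0..1} \<gamma> \<and> \<gamma> 0 = 0 \<and> \<gamma> 1 = x
            \<longrightarrow> (support_integrand D \<gamma> has_integral (f x - f 0)) {0..1})"

end

theory Submission
  imports Defs "HOL-Real_Asymp.Real_Asymp"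
begin

text \<open>Along any absolutely continuous path that is differentiable almost everywhere, the potential
  formula applied to the path and to its reversal shows that \<open>f\<close> has derivative \<open>\<langle>y', v\<rangle>\<close> for every
  \<open>v \<in> D y\<close>. Along the trajectory this gives \<open>(f \<circ> x)' = - \<parallel>x'\<parallel>\<^sup>2\<close>. Now follow Kurdyka: definable choice
  selects in each level \<open>f = r\<close> of a ball a point \<open>\<theta> r\<close> at which the distance from the origin to the convex
  hull of \<open>D\<close> is minimal up to a factor \<open>2\<close>. By o-minimality the bounded curve \<open>\<theta>\<close> is piecewise \<open>C\<^sup>1\<close> with
  monotone coordinates, hence of finite length, and the derivative of \<open>f (\<theta> r) = r\<close> yields
  \<open>1 \<le> 2 \<parallel>x'\<parallel> \<parallel>\<theta>' (f x)\<parallel>\<close>. So \<open>\<parallel>x'\<parallel>\<close> is at most \<open>2 \<parallel>\<theta>' (f x)\<parallel> \<parallel>x'\<parallel>\<^sup>2\<close>, and the length of \<open>x\<close> is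
  controlled by that of \<open>\<theta>\<close>.\<close>

section \<open>Definable predicates and terms\<close>

text \<open>The factor 2 spares any argument that the infimal slope on a level is attained: a point
  within that factor of the infimum exists whenever the infimum is positive. Levels whose infimum is
  zero and not attained remain; they are finite in number, by a second use of the same level curve
  for another selection of points. All finiteness statements rest on one observation: a definable
  property of a real variable holds throughout, or fails throughout, some interval to the right of
  each point. This gives continuity and one-sided derivatives off a finite set. Boundedness of x
  confines the level curves to one ball, which bounds the length of \<theta> by a constant L.
  Substituting \<open>r = f (x t)\<close> in the integral of the speed of \<theta> would be
  delicate, as f along x is only nonincreasing. The length of x is instead compared with a primitive
  of that speed on short intervals, and the comparisons are added. The levels at which \<theta>
  fails to be smooth are finite in number; since f decreases along x, they cut the trajectory into
  finitely many pieces, each of length at most \<open>2 * L\<close>.\<close>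

definition prod_coords :: "('a \<Rightarrow> real) list \<Rightarrow> ('b \<Rightarrow> real) list \<Rightarrow> ('a \<times> 'b \<Rightarrow> real) list" (infixr "\<otimes>" 70) where
  "cs \<otimes> ds = map (\<lambda>c p. c (fst p)) cs @ map (\<lambda>d p. d (snd p)) ds"

definition real_coords :: "(real \<Rightarrow> real) list" where "real_coords = [\<lambda>x. x]"

definition vec_coords :: "(real ^ 'p::finite \<Rightarrow> real) list" where
  "vec_coords = map (\<lambda>i v. v $ i) coord_order"

lemma length_prod_coords [simp]: "length (cs \<otimes> ds) = length cs + length ds"
  by (simp add: prod_coords_def)

lemma length_real_coords [simp]: "length real_coords = 1"
  by (simp add: real_coords_def)

lemma map_prod_coords: "map (\<lambda>c. c (e, d)) (cs \<otimes> ds) = map (\<lambda>c. c e) cs @ map (\<lambda>c. c d) ds"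
  by (simp add: prod_coords_def)

lemma map_real_coords [simp]: "map (\<lambda>c. c x) real_coords = [x]"
  by (simp add: real_coords_def)

lemma coord_order: "distinct (coord_order :: 'p::finite list)" "set (coord_order :: 'p list) = UNIV"
proof -
  have "\<exists>l :: 'p list. distinct l \<and> set l = UNIV"
    using finite_distinct_list[of "UNIV :: 'p set"] by auto
  from someI_ex[OF this] show "distinct (coord_order :: 'p list)" "set (coord_order :: 'p list) = UNIV"
    by (simp_all add: coord_order_def)
qed

lemma length_coord_order [simp]: "length (coord_order :: 'p::finite list) = CARD('p)"
  using coord_order[where 'p='p] distinct_card by metis

lemma length_vec_coords [simp]: "length (vec_coords :: (real^'p::finite \<Rightarrow> real) list) = CARD('p)"
  by (simp add: vec_coords_def)

lemma map_vec_coords [simp]: "map (\<lambda>c. c x) vec_coords = coords x"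
  by (simp add: vec_coords_def coords_def)

lemma length_coords [simp]: "length (coords (x :: real^'p::finite)) = CARD('p)"
  by (simp add: coords_def)

lemma coords_surj:
  assumes "length ys = CARD('p::finite)"
  shows "\<exists>x :: real^'p. coords x = ys"
proof -
  define ix :: "'p \<Rightarrow> nat" where "ix i = (THE k. k < CARD('p) \<and> coord_order ! k = i)" for i
  have ix: "ix (coord_order ! k) = k" if "k < CARD('p)" for k
    unfolding ix_def using that coord_order[where 'p='p]
    by (intro the_equality) (auto simp: nth_eq_iff_index_eq)
  have "coords (\<chi> i. ys ! ix i) = ys"
    by (rule nth_equalityI) (simp_all add: coords_def assms ix)
  then show ?thesis by blast
qed

lemma coords_inj: "coords x = coords y \<longleftrightarrow> x = y"
  using coord_order(2) by (auto simp: coords_def vec_eq_iff)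

section \<open>Closure properties of an o-minimal structure, on coordinate lists\<close>

locale ominimal =
  fixes S :: "nat \<Rightarrow> real list set set"
  assumes o_minimal: "o_minimal S"
begin

lemma S_sub: "A \<in> S n \<Longrightarrow> A \<subseteq> Rn n"
  and S_empty: "{} \<in> S n"
  and S_Un: "A \<in> S n \<Longrightarrow> B \<in> S n \<Longrightarrow> A \<union> B \<in> S n"
  and S_compl: "A \<in> S n \<Longrightarrow> Rn n - A \<in> S n"
  and S_alg: "algebraic_set n A \<Longrightarrow> A \<in> S n"
  and S_cons: "A \<in> S n \<Longrightarrow> {r # xs | xs r. xs \<in> A} \<in> S (Suc n)"
  and S_butlast: "A \<in> S (Suc n) \<Longrightarrow> butlast ` A \<in> S n"
  using o_minimal[unfolded o_minimal_def, THEN conjunct1, THEN spec[of _ n]] by simp_all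

lemma S_one: "S 1 = {(\<lambda>r. [r]) ` \<Union>F | F. finite F \<and> (\<forall>I\<in>F. is_interval I)}"
  using o_minimal[unfolded o_minimal_def] by (rule conjunct2)

lemma S_Rn: "Rn n \<in> S n"
  using S_compl[OF S_empty[of n]] by simp

lemma S_Int: "A \<in> S n \<Longrightarrow> B \<in> S n \<Longrightarrow> A \<inter> B \<in> S n"
proof -
  assume a: "A \<in> S n" "B \<in> S n"
  have "A \<inter> B = Rn n - ((Rn n - A) \<union> (Rn n - B))"
    using S_sub[OF a(1)] by blast
  then show ?thesis using a by (simp add: S_compl S_Un)
qed

lemma S_ball_lt:
  fixes m :: nat
  shows "(\<And>j. j < m \<Longrightarrow> {xs \<in> Rn n. P j xs} \<in> S n) \<Longrightarrow> {xs \<in> Rn n. \<forall>j<m. P j xs} \<in> S n"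
proof (induction m)
  case 0
  then show ?case using S_Rn by simp
next
  case (Suc m)
  have "{xs \<in> Rn n. \<forall>j<Suc m. P j xs} = {xs \<in> Rn n. \<forall>j<m. P j xs} \<inter> {xs \<in> Rn n. P m xs}"
    by (auto simp: less_Suc_eq)
  then show ?case using Suc by (simp add: S_Int)
qed

lemma S_prefix: "A \<in> S m \<Longrightarrow> {xs \<in> Rn (n + m). drop n xs \<in> A} \<in> S (n + m)"
proof (induction n)
  case 0
  have "{xs \<in> Rn m. xs \<in> A} = A" using S_sub[OF 0] by blast
  then show ?case using 0 by simp
next
  case (Suc n)
  let ?B = "{xs \<in> Rn (n + m). drop n xs \<in> A}"
  have "{xs \<in> Rn (Suc n + m). drop (Suc n) xs \<in> A} = {r # xs | xs r. xs \<in> ?B}"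
    by (auto simp: Rn_def length_Suc_conv)
  then show ?case using S_cons[OF Suc.IH[OF Suc.prems]] by simp
qed

lemma S_project: "A \<in> S (n + m) \<Longrightarrow> take n ` A \<in> S n"
proof (induction m arbitrary: A)
  case 0
  have "take n ` A = A" using S_sub[OF 0] by (force simp: Rn_def)
  then show ?case using 0 by simp
next
  case (Suc m)
  have "butlast ` A \<in> S (n + m)" using Suc.prems S_butlast by simp
  moreover have "take n ` butlast ` A = take n ` A"
    using S_sub[OF Suc.prems] unfolding image_image
    by (intro image_cong) (auto simp: Rn_def butlast_conv_take)
  ultimately show ?case using Suc.IH[of "butlast ` A"] by simp
qed

lemma S_poly: "{xs \<in> Rn n. mpoly_eval P xs = 0} \<in> S n"
  by (rule S_alg) (auto simp: algebraic_set_def)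

lemma S_eq: "i < n \<Longrightarrow> j < n \<Longrightarrow> {xs \<in> Rn n. xs ! i = xs ! j} \<in> S n"
proof -
  assume "i < n" "j < n"
  then have "{xs \<in> Rn n. xs ! i = xs ! j}
     = {xs \<in> Rn n. mpoly_eval (PAdd (PVar i) (PMul (PConst (-1)) (PVar j))) xs = 0}"
    by (auto simp: Rn_def)
  then show ?thesis using S_poly by metis
qed

text \<open>The axioms only add and drop coordinates at the ends of a list. Selection, repetition
  and permutation are obtained by appending the selected values as new coordinates, tied to the old
  ones by polynomial equations, and projecting them away.\<close>

lemma S_vars:
  assumes "A \<in> S (length js)" and "\<And>j. j \<in> set js \<Longrightarrow> j < n"
  shows "{xs \<in> Rn n. map ((!) xs) js \<in> A} \<in> S n"
proof -
  let ?m = "length js"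
  let ?C = "{ws \<in> Rn (n + ?m). drop n ws \<in> A} \<inter> {ws \<in> Rn (n + ?m). \<forall>j<?m. ws ! (n + j) = ws ! (js ! j)}"
  have "?C \<in> S (n + ?m)"
    using assms by (intro S_Int S_prefix S_ball_lt S_eq) (auto simp: trans_less_add1)
  moreover have "take n ` ?C = {xs \<in> Rn n. map ((!) xs) js \<in> A}"
  proof (intro equalityI subsetI)
    fix xs assume "xs \<in> take n ` ?C"
    then obtain ws where ws: "ws \<in> ?C" "xs = take n ws" by blast
    have "map ((!) xs) js = drop n ws"
      using ws assms(2) by (intro nth_equalityI) (auto simp: Rn_def)
    then show "xs \<in> {xs \<in> Rn n. map ((!) xs) js \<in> A}" using ws by (auto simp: Rn_def)
  next
    fix xs assume xs: "xs \<in> {xs \<in> Rn n. map ((!) xs) js \<in> A}"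
    have "xs @ map ((!) xs) js \<in> ?C"
      using xs assms(2) by (auto simp: Rn_def nth_append)
    moreover have "xs = take n (xs @ map ((!) xs) js)" using xs by (simp add: Rn_def)
    ultimately show "xs \<in> take n ` ?C" by blast
  qed
  ultimately show ?thesis using S_project[of ?C n ?m] by simp
qed

text \<open>The environment type \<open>'e\<close> is arbitrary, typically a nested product of \<^typ>\<open>real\<close> and vector types;
  \<open>cs\<close> lists its coordinate functions, and a quantifier extends \<open>'e\<close> by one factor. This avoids variable
  indices.\<close>

definition definable :: "('e \<Rightarrow> real) list \<Rightarrow> ('e \<Rightarrow> bool) \<Rightarrow> bool" where
  "definable cs P \<longleftrightarrow> (\<exists>A\<in>S (length cs). \<forall>e. P e \<longleftrightarrow> map (\<lambda>c. c e) cs \<in> A)"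

definition definable_term :: "('e \<Rightarrow> real) list \<Rightarrow> ('e \<Rightarrow> real) \<Rightarrow> bool" where
  "definable_term cs t \<longleftrightarrow> definable (cs \<otimes> real_coords) (\<lambda>p. snd p = t (fst p))"

lemma definable_not:
  assumes "definable cs P" shows "definable cs (\<lambda>e. \<not> P e)"
proof -
  obtain A where A: "A \<in> S (length cs)" "\<forall>e. P e \<longleftrightarrow> map (\<lambda>c. c e) cs \<in> A"
    using assms unfolding definable_def by blast
  show ?thesis unfolding definable_def
    using S_compl[OF A(1)] A(2) by (intro bexI[of _ "Rn (length cs) - A"]) (auto simp: Rn_def)
qed

lemma definable_conj:
  assumes "definable cs P" "definable cs Q" shows "definable cs (\<lambda>e. P e \<and> Q e)"
proof -
  obtain A where A: "A \<in> S (length cs)" "\<forall>e. P e \<longleftrightarrow> map (\<lambda>c. c e) cs \<in> A"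
    using assms unfolding definable_def by blast
  obtain B where B: "B \<in> S (length cs)" "\<forall>e. Q e \<longleftrightarrow> map (\<lambda>c. c e) cs \<in> B"
    using assms unfolding definable_def by blast
  show ?thesis unfolding definable_def
    using S_Int[OF A(1) B(1)] A(2) B(2) by (intro bexI[of _ "A \<inter> B"]) auto
qed

lemma definable_disj: "definable cs P \<Longrightarrow> definable cs Q \<Longrightarrow> definable cs (\<lambda>e. P e \<or> Q e)"
  using definable_not[OF definable_conj[OF definable_not definable_not], of cs P Q] by simp

lemma definable_imp: "definable cs P \<Longrightarrow> definable cs Q \<Longrightarrow> definable cs (\<lambda>e. P e \<longrightarrow> Q e)"
  unfolding imp_conv_disj by (intro definable_disj definable_not)

lemma definable_const: "definable cs (\<lambda>e. b)"
  unfolding definable_def using S_empty S_Rn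
  by (cases b) (simp_all add: Rn_def bexI[of _ "Rn (length cs)"] bexI[of _ "{}"])

text \<open>Existential quantification is projection; \<open>surj\<close> ensures that a point above
  the projected one comes from an actual value d.\<close>

lemma definable_ex_gen:
  assumes Q: "definable (cs \<otimes> ds) (\<lambda>p. Q (fst p) (snd p))"
    and surj: "\<And>ys. length ys = length ds \<Longrightarrow> \<exists>d. map (\<lambda>c. c d) ds = ys"
  shows "definable cs (\<lambda>e. \<exists>d. Q e d)"
proof -
  obtain A where A: "A \<in> S (length cs + length ds)"
    and QA: "\<And>e d. Q e d \<longleftrightarrow> map (\<lambda>c. c e) cs @ map (\<lambda>c. c d) ds \<in> A"
    using Q unfolding definable_def by (auto simp: map_prod_coords)
  have "(\<exists>d. Q e d) \<longleftrightarrow> map (\<lambda>c. c e) cs \<in> take (length cs) ` A" (is "_ \<longleftrightarrow> ?xs \<in> _") for e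
  proof
    assume "\<exists>d. Q e d"
    then show "?xs \<in> take (length cs) ` A" using QA by (force simp: image_iff)
  next
    assume "?xs \<in> take (length cs) ` A"
    then obtain ws where ws: "ws \<in> A" "?xs = take (length cs) ws" by blast
    have "length ws = length cs + length ds" using ws S_sub[OF A] by (auto simp: Rn_def)
    then obtain d where "map (\<lambda>c. c d) ds = drop (length cs) ws"
      using surj[of "drop (length cs) ws"] by auto
    then have "?xs @ map (\<lambda>c. c d) ds = ws" using ws by simp
    then show "\<exists>d. Q e d" using QA ws by metis
  qed
  then show ?thesis unfolding definable_def using S_project[OF A] by (intro bexI) auto
qed

lemma definable_ex:
  assumes "definable (cs \<otimes> real_coords) (\<lambda>p. Q (fst p) (snd p))"
  shows "definable cs (\<lambda>e. \<exists>d. Q e d)"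
proof (rule definable_ex_gen[OF assms])
  fix ys :: "real list" assume "length ys = length real_coords"
  then obtain d where "ys = [d]" by (auto simp: length_Suc_conv)
  then show "\<exists>d. map (\<lambda>c. c d) real_coords = ys" by auto
qed

lemma definable_ex_vec:
  fixes Q :: "'e \<Rightarrow> real^'p::finite \<Rightarrow> bool"
  assumes "definable (cs \<otimes> vec_coords) (\<lambda>p. Q (fst p) (snd p))"
  shows "definable cs (\<lambda>e. \<exists>d. Q e d)"
  using coords_surj by (intro definable_ex_gen[OF assms]) auto

lemma definable_all:
  assumes "definable (cs \<otimes> real_coords) (\<lambda>p. Q (fst p) (snd p))"
  shows "definable cs (\<lambda>e. \<forall>d. Q e d)"
  using definable_not[OF definable_ex[OF definable_not[OF assms]]] by simp

lemma definable_all_vec: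
  fixes Q :: "'e \<Rightarrow> real^'p::finite \<Rightarrow> bool"
  assumes "definable (cs \<otimes> vec_coords) (\<lambda>p. Q (fst p) (snd p))"
  shows "definable cs (\<lambda>e. \<forall>d. Q e d)"
  using definable_not[OF definable_ex_vec[OF definable_not[OF assms]]] by simp

lemma definable_term_iff:
  "definable_term cs t \<longleftrightarrow>
     (\<exists>G\<in>S (Suc (length cs)). \<forall>e r. r = t e \<longleftrightarrow> map (\<lambda>c. c e) cs @ [r] \<in> G)"
  unfolding definable_term_def definable_def by (simp add: map_prod_coords split_paired_all)

text \<open>The values of the coordinates of \<open>h e\<close> are introduced as extra coordinates,
  each confined to the graph of its defining term, and then projected away.\<close>

lemma definable_subst:
  assumes P: "definable ds P" and T: "\<And>d. d \<in> set ds \<Longrightarrow> definable_term cs (\<lambda>e. d (h e))"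
  shows "definable cs (\<lambda>e. P (h e))"
proof -
  let ?n = "length cs" and ?m = "length ds"
  obtain A where A: "A \<in> S ?m" "\<And>e. P e \<longleftrightarrow> map (\<lambda>c. c e) ds \<in> A"
    using P unfolding definable_def by blast
  have "\<forall>j<?m. \<exists>G\<in>S (Suc ?n). \<forall>e r. r = (ds ! j) (h e) \<longleftrightarrow> map (\<lambda>c. c e) cs @ [r] \<in> G"
    using T by (simp add: definable_term_iff)
  then obtain G where G: "\<And>j. j < ?m \<Longrightarrow> G j \<in> S (Suc ?n)"
    and GG: "\<And>j e r. j < ?m \<Longrightarrow> r = (ds ! j) (h e) \<longleftrightarrow> map (\<lambda>c. c e) cs @ [r] \<in> G j"
    by metis
  let ?C = "{ws \<in> Rn (?n + ?m). drop ?n ws \<in> A}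
     \<inter> {ws \<in> Rn (?n + ?m). \<forall>j<?m. map ((!) ws) ([0..<?n] @ [?n + j]) \<in> G j}"
  have C: "?C \<in> S (?n + ?m)"
    using A G by (intro S_Int S_prefix S_ball_lt S_vars) auto
  \<comment> \<open>The index list picks the environment together with the j-th extra coordinate,
    which is the shape of a point in the graph \<open>G j\<close>.\<close>
  have m: "map ((!) ws) ([0..<?n] @ [?n + j]) = take ?n ws @ [ws ! (?n + j)]" if "ws \<in> Rn (?n + ?m)" for ws j
    using that by (auto simp: Rn_def intro!: nth_equalityI simp: nth_append)
  have "P (h e) \<longleftrightarrow> map (\<lambda>c. c e) cs \<in> take ?n ` ?C" (is "_ \<longleftrightarrow> ?xs \<in> _") for e
  proof
    assume "P (h e)"
    let ?ws = "?xs @ map (\<lambda>c. c (h e)) ds"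
    have w: "?ws \<in> Rn (?n + ?m)" by (simp add: Rn_def)
    have "?ws \<in> ?C" unfolding Int_iff mem_Collect_eq
      using w \<open>P (h e)\<close> A(2) GG m[OF w] by (auto simp: nth_append)
    moreover have "?xs = take ?n ?ws" by simp
    ultimately show "?xs \<in> take ?n ` ?C" by blast
  next
    assume "?xs \<in> take ?n ` ?C"
    then obtain ws where ws: "ws \<in> ?C" "?xs = take ?n ws" by blast
    have w: "ws \<in> Rn (?n + ?m)" using ws by blast
    have "ws ! (?n + j) = (ds ! j) (h e)" if "j < ?m" for j
      using ws that GG[OF that] m[OF w, of j] by force
    then have "drop ?n ws = map (\<lambda>c. c (h e)) ds"
      using w by (intro nth_equalityI) (auto simp: Rn_def)
    then show "P (h e)" using ws A(2) by auto
  qed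
  then show ?thesis unfolding definable_def by (intro bexI[OF _ S_project[OF C]] allI)
qed

lemma definable_poly: "definable cs (\<lambda>e. mpoly_eval P (map (\<lambda>c. c e) cs) = 0)"
  unfolding definable_def
  by (rule bexI[of _ "{xs \<in> Rn (length cs). mpoly_eval P xs = 0}"])
    (auto simp: S_poly, simp add: Rn_def)

section \<open>Terms and atomic formulas\<close>

lemma term_var:
  assumes "c \<in> set cs" shows "definable_term cs c"
proof -
  obtain i where i: "i < length cs" "cs ! i = c" using assms by (auto simp: in_set_conv_nth)
  have "definable (cs \<otimes> real_coords) (\<lambda>e. mpoly_eval (PAdd (PVar i) (PMul (PConst (-1)) (PVar (length cs))))
      (map (\<lambda>c. c e) (cs \<otimes> real_coords)) = 0)"
    by (rule definable_poly)
  also have "(\<lambda>e. mpoly_eval (PAdd (PVar i) (PMul (PConst (-1)) (PVar (length cs))))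
      (map (\<lambda>c. c e) (cs \<otimes> real_coords)) = 0) = (\<lambda>p. snd p = c (fst p))"
    using i by (auto simp: fun_eq_iff prod_coords_def real_coords_def nth_append)
  finally show ?thesis unfolding definable_term_def .
qed

lemma term_const: "definable_term cs (\<lambda>e. r)"
proof -
  have "definable (cs \<otimes> real_coords) (\<lambda>e. mpoly_eval (PAdd (PConst (-r)) (PVar (length cs)))
      (map (\<lambda>c. c e) (cs \<otimes> real_coords)) = 0)"
    by (rule definable_poly)
  also have "(\<lambda>e. mpoly_eval (PAdd (PConst (-r)) (PVar (length cs)))
      (map (\<lambda>c. c e) (cs \<otimes> real_coords)) = 0) = (\<lambda>p. snd p = r)"
    by (auto simp: fun_eq_iff prod_coords_def real_coords_def nth_append)
  finally show ?thesis unfolding definable_term_def .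
qed

text \<open>Substitution that merely renames coordinates. It has to come before
  \<open>term_subst\<close>, whose proof already moves terms into an extended environment by
  \<open>term_fst\<close>.\<close>

lemma term_subst_fst:
  assumes t: "definable_term ds t" and T: "\<And>d. d \<in> set ds \<Longrightarrow> \<exists>c\<in>set cs. (\<lambda>e. d (h e)) = c"
  shows "definable_term cs (\<lambda>e. t (h e))"
proof -
  have "definable (cs \<otimes> real_coords) (\<lambda>p. (\<lambda>q. snd q = t (fst q)) (h (fst p), snd p))"
  proof (rule definable_subst[OF t[unfolded definable_term_def]])
    fix d assume "d \<in> set (ds \<otimes> real_coords)"
    then consider d' where "d' \<in> set ds" "d = (\<lambda>p. d' (fst p))" | "d = snd"
      by (auto simp: prod_coords_def real_coords_def)
    then show "definable_term (cs \<otimes> real_coords) (\<lambda>e. d (h (fst e), snd e))"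
    proof cases
      case 1
      with T obtain c where "c \<in> set cs" "(\<lambda>e. d' (h e)) = c" by blast
      with 1 show ?thesis by (intro term_var) (auto simp: prod_coords_def)
    next
      case 2
      then show ?thesis by (intro term_var) (auto simp: prod_coords_def real_coords_def)
    qed
  qed
  then show ?thesis by (simp add: definable_term_def)
qed

lemma term_fst: "definable_term cs t \<Longrightarrow> definable_term (cs \<otimes> ds) (\<lambda>p. t (fst p))"
  by (erule term_subst_fst) (auto simp: prod_coords_def)

lemma term_snd: "definable_term ds t \<Longrightarrow> definable_term (cs \<otimes> ds) (\<lambda>p. t (snd p))"
  by (erule term_subst_fst) (auto simp: prod_coords_def)

lemma term_real: "definable_term real_coords (\<lambda>x. x)"
  by (rule term_var) (simp add: real_coords_def)

lemma term_vec: "definable_term vec_coords (\<lambda>x. x $ i)"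
  by (rule term_var) (simp add: vec_coords_def coord_order)

lemma term_subst:
  assumes t: "definable_term ds t" and T: "\<And>d. d \<in> set ds \<Longrightarrow> definable_term cs (\<lambda>e. d (h e))"
  shows "definable_term cs (\<lambda>e. t (h e))"
proof -
  have "definable (cs \<otimes> real_coords) (\<lambda>p. (\<lambda>q. snd q = t (fst q)) (h (fst p), snd p))"
  proof (rule definable_subst[OF t[unfolded definable_term_def]])
    fix d assume "d \<in> set (ds \<otimes> real_coords)"
    then consider d' where "d' \<in> set ds" "d = (\<lambda>p. d' (fst p))" | "d = snd"
      by (auto simp: prod_coords_def real_coords_def)
    then show "definable_term (cs \<otimes> real_coords) (\<lambda>e. d (h (fst e), snd e))"
    proof cases
      case 1
      then show ?thesis using term_fst[OF T[OF 1(1)]] by simp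
    next
      case 2
      then show ?thesis by (intro term_var) (auto simp: prod_coords_def real_coords_def)
    qed
  qed
  then show ?thesis by (simp add: definable_term_def)
qed

lemma term_add:
  assumes "definable_term cs t" "definable_term cs u"
  shows "definable_term cs (\<lambda>e. t e + u e)"
proof -
  have "definable ([fst, snd] \<otimes> real_coords) (\<lambda>e. mpoly_eval (PAdd (PAdd (PVar 0) (PVar 1)) (PMul (PConst (-1)) (PVar 2)))
      (map (\<lambda>c. c e) ([fst, snd] \<otimes> real_coords)) = 0)"
    by (rule definable_poly)
  also have "(\<lambda>e. mpoly_eval (PAdd (PAdd (PVar 0) (PVar 1)) (PMul (PConst (-1)) (PVar 2)))
      (map (\<lambda>c. c e) ([fst, snd] \<otimes> real_coords)) = 0) = (\<lambda>p. snd p = fst (fst p) + snd (fst p))"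
    by (auto simp: fun_eq_iff prod_coords_def real_coords_def nth_append numeral_eq_Suc)
  finally have "definable_term [fst, snd] (\<lambda>p. fst p + snd p)" unfolding definable_term_def .
  then have "definable_term cs (\<lambda>e. (\<lambda>p. fst p + snd p) (t e, u e))"
    by (rule term_subst) (use assms in auto)
  then show ?thesis by simp
qed

lemma term_mult:
  assumes "definable_term cs t" "definable_term cs u"
  shows "definable_term cs (\<lambda>e. t e * u e)"
proof -
  have "definable ([fst, snd] \<otimes> real_coords) (\<lambda>e. mpoly_eval (PAdd (PMul (PVar 0) (PVar 1)) (PMul (PConst (-1)) (PVar 2)))
      (map (\<lambda>c. c e) ([fst, snd] \<otimes> real_coords)) = 0)"
    by (rule definable_poly)
  also have "(\<lambda>e. mpoly_eval (PAdd (PMul (PVar 0) (PVar 1)) (PMul (PConst (-1)) (PVar 2)))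
      (map (\<lambda>c. c e) ([fst, snd] \<otimes> real_coords)) = 0) = (\<lambda>p. snd p = fst (fst p) * snd (fst p))"
    by (auto simp: fun_eq_iff prod_coords_def real_coords_def nth_append numeral_eq_Suc)
  finally have "definable_term [fst, snd] (\<lambda>p. fst p * snd p)" unfolding definable_term_def .
  then have "definable_term cs (\<lambda>e. (\<lambda>p. fst p * snd p) (t e, u e))"
    by (rule term_subst) (use assms in auto)
  then show ?thesis by simp
qed

lemma term_uminus: "definable_term cs t \<Longrightarrow> definable_term cs (\<lambda>e. - t e)"
  using term_mult[OF term_const[of cs "-1"]] by simp

lemma term_diff: "definable_term cs t \<Longrightarrow> definable_term cs u \<Longrightarrow> definable_term cs (\<lambda>e. t e - u e)"
  using term_add[OF _ term_uminus, of cs t u] by simp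

lemma term_sum:
  "finite I \<Longrightarrow> (\<And>i. i \<in> I \<Longrightarrow> definable_term cs (t i)) \<Longrightarrow> definable_term cs (\<lambda>e. \<Sum>i\<in>I. t i e)"
  by (induction rule: finite_induct) (auto intro: term_const term_add)

lemma term_inner:
  fixes u v :: "'e \<Rightarrow> real^'p::finite"
  assumes "\<And>i. definable_term cs (\<lambda>e. u e $ i)" "\<And>i. definable_term cs (\<lambda>e. v e $ i)"
  shows "definable_term cs (\<lambda>e. u e \<bullet> v e)"
  unfolding inner_vec_def inner_real_def using assms by (intro term_sum term_mult) auto

lemma definable_eq:
  assumes "definable_term cs t" "definable_term cs u"
  shows "definable cs (\<lambda>e. t e = u e)"
proof -
  have "definable [fst, snd] (\<lambda>e. mpoly_eval (PAdd (PVar 0) (PMul (PConst (-1)) (PVar 1)))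
      (map (\<lambda>c. c e) [fst, snd]) = 0)"
    by (rule definable_poly)
  also have "(\<lambda>e. mpoly_eval (PAdd (PVar 0) (PMul (PConst (-1)) (PVar 1)))
      (map (\<lambda>c. c e) [fst, snd]) = 0) = (\<lambda>p. fst p = snd p)"
    by (auto simp: fun_eq_iff)
  finally have "definable cs (\<lambda>e. (\<lambda>p. fst p = snd p) (t e, u e))"
    by (rule definable_subst) (use assms in auto)
  then show ?thesis by simp
qed

text \<open>The order is not among the algebraic primitives; it is recovered from the fact that the
  positive reals are the squares of nonzero reals.\<close>

lemma definable_less:
  assumes "definable_term cs t" "definable_term cs u"
  shows "definable cs (\<lambda>e. t e < u e)"
proof -
  have eq: "(\<lambda>e. t e < u e) = (\<lambda>e. \<exists>z. \<not> z = 0 \<and> u e - t e = z * z)"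
  proof (intro ext iffI)
    fix e assume "t e < u e"
    then show "\<exists>z. \<not> z = 0 \<and> u e - t e = z * z" by (intro exI[of _ "sqrt (u e - t e)"]) auto
  next
    fix e assume "\<exists>z. \<not> z = 0 \<and> u e - t e = z * z"
    then obtain z where "z \<noteq> 0" "u e - t e = z * z" by blast
    moreover from this have "z * z > 0" using not_real_square_gt_zero by blast
    ultimately show "t e < u e" by linarith
  qed
  show ?thesis unfolding eq
    by (intro definable_ex definable_conj definable_not definable_eq term_const term_snd term_real
        term_diff term_mult term_fst assms)
qed

lemma definable_le:
  assumes "definable_term cs t" "definable_term cs u"
  shows "definable cs (\<lambda>e. t e \<le> u e)"
  using definable_not[OF definable_less[OF assms(2,1)]] by (simp add: not_less)

lemma definable_fst: "definable cs P \<Longrightarrow> definable (cs \<otimes> ds) (\<lambda>p. P (fst p))"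
  by (erule definable_subst) (auto intro!: term_var simp: prod_coords_def)

lemma term_if:
  assumes P: "definable cs P" "definable_term cs t" "definable_term cs u"
  shows "definable_term cs (\<lambda>e. if P e then t e else u e)"
proof -
  have "definable (cs \<otimes> real_coords) (\<lambda>p. P (fst p))"
    by (rule definable_fst[OF P(1)])
  then have "definable (cs \<otimes> real_coords) (\<lambda>p. P (fst p) \<and> snd p = t (fst p) \<or> \<not> P (fst p) \<and> snd p = u (fst p))"
    by (intro definable_disj definable_conj definable_not definable_eq term_snd term_real term_fst assms)
  also have "(\<lambda>p. P (fst p) \<and> snd p = t (fst p) \<or> \<not> P (fst p) \<and> snd p = u (fst p))
      = (\<lambda>p. snd p = (if P (fst p) then t (fst p) else u (fst p)))" by auto
  finally show ?thesis unfolding definable_term_def .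
qed

lemma definable_real_subst:
  assumes "definable real_coords P" "definable_term cs t" shows "definable cs (\<lambda>e. P (t e))"
  by (rule definable_subst[OF assms(1)]) (use assms(2) in \<open>auto simp: real_coords_def\<close>)

lemma term_real_subst:
  assumes "definable_term real_coords g" "definable_term cs t" shows "definable_term cs (\<lambda>e. g (t e))"
  by (rule term_subst[OF assms(1)]) (use assms(2) in \<open>auto simp: real_coords_def\<close>)

lemma definable_prod_subst:
  assumes "definable (cs \<otimes> ds) (\<lambda>p. P (fst p) (snd p))"
    and "\<And>c. c \<in> set cs \<Longrightarrow> definable_term bs (\<lambda>e. c (h e))"
    and "\<And>d. d \<in> set ds \<Longrightarrow> definable_term bs (\<lambda>e. d (k e))"
  shows "definable bs (\<lambda>e. P (h e) (k e))"
proof -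
  have "definable bs (\<lambda>e. (\<lambda>p. P (fst p) (snd p)) (h e, k e))"
    by (rule definable_subst[OF assms(1)]) (use assms(2,3) in \<open>auto simp: prod_coords_def\<close>)
  then show ?thesis by simp
qed

lemma vec_coords_terms:
  assumes "\<And>i. definable_term cs (\<lambda>e. u e $ i)" and "d \<in> set vec_coords"
  shows "definable_term cs (\<lambda>e. d (u e))"
  using assms by (auto simp: vec_coords_def)

lemma real_coords_terms:
  assumes "definable_term cs t" and "d \<in> set real_coords"
  shows "definable_term cs (\<lambda>e. d (t e))"
  using assms by (auto simp: real_coords_def)

text \<open>The single point at which the axiom on subsets of the line enters.\<close>

lemma definable_intervals:
  assumes "definable real_coords P"
  obtains F where "finite F" "\<And>I. I \<in> F \<Longrightarrow> is_interval I" "{x. P x} = \<Union>F"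
proof -
  obtain A where A: "A \<in> S 1" "\<And>x. P x \<longleftrightarrow> [x] \<in> A"
    using assms unfolding definable_def by auto
  then obtain F where F: "finite F" "\<forall>I\<in>F. is_interval I" "A = (\<lambda>r. [r]) ` \<Union>F"
    unfolding S_one by blast
  have "{x. P x} = \<Union>F" using A(2) F(3) by auto
  with F show ?thesis using that by blast
qed

end

section \<open>Definable functions of one variable\<close>

lemma nondecreasing_if_right_nondecreasing:
  fixes k :: "real \<Rightarrow> real"
  assumes cont: "continuous_on {c..d} k" and "c \<le> d"
    and ev: "\<And>x. c \<le> x \<Longrightarrow> x < d \<Longrightarrow> \<forall>\<^sub>F y in at_right x. k x \<le> k y"
  shows "k c \<le> k d"
proof -
  let ?A = "{x \<in> {c..d}. k c \<le> k x}"
  have "closed ?A" by (intro continuous_on_closed_Collect_le cont continuous_on_const) auto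
  then have "compact ?A" using compact_Int_closed[of "{c..d}" ?A] by (simp add: Int_absorb1 subset_iff)
  moreover have "c \<in> ?A" using \<open>c \<le> d\<close> by simp
  ultimately obtain m where m: "m \<in> ?A" "\<And>y. y \<in> ?A \<Longrightarrow> y \<le> m"
    using compact_attains_sup[of ?A] by blast
  \<comment> \<open>m is the last point of the interval whose value is at least \<open>k c\<close>;
    if it came before d, growth to the right of m would produce a later one.\<close>
  have "m = d"
  proof (rule ccontr)
    assume "m \<noteq> d"
    with m have "m < d" by auto
    then have "\<forall>\<^sub>F y in at_right m. k m \<le> k y \<and> y \<le> d \<and> m < y"
      using ev[of m] m eventually_at_right_less[of m]
      by (intro eventually_conj) (auto simp: eventually_at_right_field intro!: exI[of _ d])
    then obtain y where "k m \<le> k y" "y \<le> d" "m < y"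
      using eventually_happens'[OF trivial_limit_at_right_real] by blast
    then show False using m(2)[of y] m(1) by auto
  qed
  then show ?thesis using m by blast
qed

lemma right_derivative_bound:
  fixes k :: "real \<Rightarrow> real"
  assumes "(k has_real_derivative l) (at_right x)" "e > 0"
  shows "\<forall>\<^sub>F y in at_right x. \<bar>k y - k x - l * (y - x)\<bar> \<le> e * (y - x)"
proof -
  have "((\<lambda>y. (k y - k x) / (y - x)) \<longlongrightarrow> l) (at_right x)"
    using assms(1) by (simp add: has_field_derivative_iff)
  then have "\<forall>\<^sub>F y in at_right x. dist ((k y - k x) / (y - x)) l < e"
    using assms(2) by (rule tendstoD)
  then show ?thesis using eventually_at_right_less[of x]
  proof eventually_elim
    case (elim y)
    then have "\<bar>(k y - k x) / (y - x) - l\<bar> * (y - x) \<le> e * (y - x)"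
      by (intro mult_right_mono) (auto simp: dist_real_def)
    moreover have "\<bar>(k y - k x) / (y - x) - l\<bar> * (y - x) = \<bar>k y - k x - l * (y - x)\<bar>"
    proof -
      have "\<bar>(k y - k x) / (y - x) - l\<bar> * (y - x) = \<bar>((k y - k x) / (y - x) - l) * (y - x)\<bar>"
        using elim by (simp add: abs_mult)
      moreover have "((k y - k x) / (y - x) - l) * (y - x) = k y - k x - l * (y - x)"
        using elim by (simp add: left_diff_distrib[of "(k y - k x) / (y - x)"])
      ultimately show ?thesis by simp
    qed
    ultimately show ?case by simp
  qed
qed

text \<open>For every e > 0 both \<open>e * x + k x\<close> and \<open>e * x - k x\<close> grow to
  the right of each point, so k changes by at most \<open>e * (d - c)\<close>.\<close>

lemma right_derivative_zero_imp_eq: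
  fixes k :: "real \<Rightarrow> real"
  assumes cont: "continuous_on {c..d} k" and "c \<le> d"
    and der: "\<And>x. c \<le> x \<Longrightarrow> x < d \<Longrightarrow> (k has_real_derivative 0) (at_right x)"
  shows "k c = k d"
proof -
  have "\<bar>k d - k c\<bar> \<le> e * (d - c)" if "e > 0" for e
  proof -
    have "(\<lambda>x. e * x + k x) c \<le> (\<lambda>x. e * x + k x) d"
    proof (rule nondecreasing_if_right_nondecreasing[where k = "\<lambda>x. e * x + k x"])
      show "\<forall>\<^sub>F y in at_right x. e * x + k x \<le> e * y + k y" if "c \<le> x" "x < d" for x
        using right_derivative_bound[OF der[OF that] \<open>e > 0\<close>]
        by eventually_elim (simp add: abs_le_iff algebra_simps)
    qed (use assms in \<open>auto intro!: continuous_intros\<close>)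
    moreover have "(\<lambda>x. e * x - k x) c \<le> (\<lambda>x. e * x - k x) d"
    proof (rule nondecreasing_if_right_nondecreasing[where k = "\<lambda>x. e * x - k x"])
      show "\<forall>\<^sub>F y in at_right x. e * x - k x \<le> e * y - k y" if "c \<le> x" "x < d" for x
        using right_derivative_bound[OF der[OF that] \<open>e > 0\<close>]
        by eventually_elim (simp add: abs_le_iff algebra_simps)
    qed (use assms in \<open>auto intro!: continuous_intros\<close>)
    ultimately show ?thesis by (simp add: abs_le_iff algebra_simps)
  qed
  then have "\<bar>k d - k c\<bar> \<le> 0 + e" if "e > 0" for e
    using that \<open>c \<le> d\<close>
  proof -
    \<comment> \<open>The divisor \<open>d - c + 1\<close> stays positive even when c = d.\<close>
    have "\<bar>k d - k c\<bar> \<le> e / (d - c + 1) * (d - c)" using that \<open>c \<le> d\<close>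
      by (intro \<open>\<And>e. e > 0 \<Longrightarrow> \<bar>k d - k c\<bar> \<le> e * (d - c)\<close>) auto
    also have "\<dots> \<le> e" using that \<open>c \<le> d\<close> by (simp add: divide_simps)
    finally show ?thesis by simp
  qed
  then have "\<bar>k d - k c\<bar> \<le> 0" by (rule field_le_epsilon)
  then show ?thesis by simp
qed

text \<open>The primitive P of the continuous function R is differentiable from both sides. The
  difference of g and P has right derivative zero, hence is constant, and g inherits
  differentiability.\<close>

lemma derivative_if_right_derivative:
  fixes g R :: "real \<Rightarrow> real"
  assumes g: "continuous_on {c<..<d} g" and R: "continuous_on {c<..<d} R"
    and der: "\<And>x. c < x \<Longrightarrow> x < d \<Longrightarrow> (g has_real_derivative R x) (at_right x)"
    and x: "c < x" "x < d"
  shows "(g has_real_derivative R x) (at x)"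
proof -
  obtain c' where c': "c < c'" "c' < x" using x dense by blast
  obtain d' where d': "x < d'" "d' < d" using x dense by blast
  define P where "P t = integral {c'..t} R" for t
  have P: "(P has_real_derivative R t) (at t)" if "c' < t" "t < d'" for t
  proof -
    have "(P has_real_derivative R t) (at t within {c'..d'})"
      unfolding P_def using c' d' that
      by (intro integral_has_real_derivative continuous_on_subset[OF R]) auto
    moreover have "at t within {c'..d'} = at t"
      using that by (intro at_within_interior) auto
    ultimately show ?thesis by simp
  qed
  have eq: "g s - P s = g t - P t" if "c' < s" "s \<le> t" "t < d'" for s t
  proof (rule right_derivative_zero_imp_eq[of s t "\<lambda>u. g u - P u"])
    show "continuous_on {s..t} (\<lambda>u. g u - P u)"
    proof (intro continuous_intros)
      show "continuous_on {s..t} g" using that c' d' by (intro continuous_on_subset[OF g]) auto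
      show "continuous_on {s..t} P"
        using that by (intro continuous_at_imp_continuous_on ballI) (meson DERIV_isCont P atLeastAtMost_iff less_le_trans le_less_trans)
    qed
    fix u assume u: "s \<le> u" "u < t"
    have "((\<lambda>u. g u - P u) has_real_derivative (R u - R u)) (at_right u)"
      using u that c' d'
      by (intro DERIV_diff der has_field_derivative_at_within[OF P]) auto
    then show "((\<lambda>u. g u - P u) has_real_derivative 0) (at_right u)" by simp
  qed (use that in auto)
  have "((\<lambda>u. P u + (g x - P x)) has_real_derivative R x + 0) (at x)"
    using c' d' by (intro DERIV_add P DERIV_const) auto
  then have "((\<lambda>u. P u + (g x - P x)) has_real_derivative R x) (at x)" by simp
  then show ?thesis
  proof (rule has_field_derivative_transform_within_open[where S = "{c'<..<d'}"])
    fix u assume u: "u \<in> {c'<..<d'}"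
    have "g u - P u = g x - P x"
    proof (cases "u \<le> x")
      case True
      then show ?thesis using u d' by (intro eq) auto
    next
      case False
      then show ?thesis using u c' by (intro eq[symmetric]) auto
    qed
    then show "P u + (g x - P x) = g u" by linarith
  qed (use c' d' in auto)
qed

section \<open>Right germs and the finiteness of discontinuities\<close>

context ominimal begin

text \<open>The form in which o-minimality is mostly used: to show that a definable set is finite,
  refute that the property holds on a whole open interval.\<close>

lemma definable_finite_or_interval:
  assumes "definable real_coords P"
  shows "finite {x. P x} \<or> (\<exists>a b. a < b \<and> (\<forall>x. a < x \<and> x < b \<longrightarrow> P x))"
proof -
  obtain F where F: "finite F" "\<And>I. I \<in> F \<Longrightarrow> is_interval I" "{x. P x} = \<Union>F"
    using definable_intervals[OF assms] by blast
  show ?thesis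
  proof (cases "\<forall>I\<in>F. finite I")
    case True
    then show ?thesis using F by auto
  next
    case False
    then obtain I where I: "I \<in> F" "infinite I" by blast
    then obtain a where a: "a \<in> I" by fastforce
    obtain b where b: "b \<in> I" "b \<noteq> a" using I(2) finite_subset[of I "{a}"] by blast
    define c d where "c = min a b" and "d = max a b"
    have cd: "c < d" "c \<in> I" "d \<in> I" using a b by (auto simp: c_def d_def min_def max_def)
    have "P x" if "c < x" "x < d" for x
    proof -
      have "x \<in> I" by (rule mem_is_interval_1_I[OF F(2)[OF I(1)] cd(2,3)]) (use that in auto)
      then have "x \<in> {x. P x}" unfolding F(3) using I(1) by blast
      then show ?thesis by simp
    qed
    with cd(1) show ?thesis by blast
  qed
qed

lemma definable_cofinite:
  assumes "definable real_coords P" and "\<And>a b. a < b \<Longrightarrow> \<exists>x. a < x \<and> x < b \<and> P x"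
  shows "finite {x. \<not> P x}"
  using definable_finite_or_interval[OF definable_not[OF assms(1)]] assms(2) by metis

text \<open>An interval with points arbitrarily close to x on the right contains, by convexity, a
  right neighbourhood of x; otherwise it misses one. Finite unions inherit this dichotomy.\<close>

lemma germ_right:
  assumes "definable real_coords P"
  shows "(\<forall>\<^sub>F y in at_right x. P y) \<or> (\<forall>\<^sub>F y in at_right x. \<not> P y)"
proof -
  obtain F where F: "finite F" "\<And>I. I \<in> F \<Longrightarrow> is_interval I" "{x. P x} = \<Union>F"
    using definable_intervals[OF assms] by blast
  have one: "(\<forall>\<^sub>F y in at_right x. y \<in> I) \<or> (\<forall>\<^sub>F y in at_right x. y \<notin> I)" if I: "is_interval I" for I
  proof (rule disjCI)
    assume "\<not> (\<forall>\<^sub>F y in at_right x. y \<notin> I)"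
    then have n: "\<exists>y>x. y < b \<and> y \<in> I" if "b > x" for b
      using that by (auto simp: eventually_at_right_field)
    obtain b where b: "b > x" "b \<in> I" using n[of "x + 1"] by auto
    have "y \<in> I" if "x < y" "y < b" for y
      using n[OF that(1)] that b I unfolding is_interval_1 by (meson less_imp_le)
    then show "\<forall>\<^sub>F y in at_right x. y \<in> I" using b by (auto simp: eventually_at_right_field)
  qed
  have "(\<forall>\<^sub>F y in at_right x. y \<in> \<Union>F) \<or> (\<forall>\<^sub>F y in at_right x. y \<notin> \<Union>F)"
    using F(1,2)
  proof (induction rule: finite_induct)
    case empty
    then show ?case by simp
  next
    case (insert I F)
    have "(\<forall>\<^sub>F y in at_right x. y \<in> \<Union>F) \<or> (\<forall>\<^sub>F y in at_right x. y \<notin> \<Union>F)" using insert by blast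
    moreover have "(\<forall>\<^sub>F y in at_right x. y \<in> I) \<or> (\<forall>\<^sub>F y in at_right x. y \<notin> I)"
      using one insert by blast
    ultimately consider "\<forall>\<^sub>F y in at_right x. y \<in> \<Union>F" | "\<forall>\<^sub>F y in at_right x. y \<in> I"
      | "\<forall>\<^sub>F y in at_right x. y \<notin> I \<and> y \<notin> \<Union>F"
      using eventually_conj by blast
    then show ?case
    proof cases
      case 1
      then have "\<forall>\<^sub>F y in at_right x. y \<in> \<Union>(insert I F)" by (rule eventually_mono) blast
      then show ?thesis ..
    next
      case 2
      then have "\<forall>\<^sub>F y in at_right x. y \<in> \<Union>(insert I F)" by (rule eventually_mono) blast
      then show ?thesis ..
    next
      case 3
      then have "\<forall>\<^sub>F y in at_right x. y \<notin> \<Union>(insert I F)" by (rule eventually_mono) blast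
      then show ?thesis ..
    qed
  qed
  moreover have "P = (\<lambda>x. x \<in> \<Union>F)" unfolding F(3)[symmetric] by simp
  ultimately show ?thesis by simp
qed

lemma definable_section: "definable (cs \<otimes> real_coords) (\<lambda>p. Q (fst p) (snd p)) \<Longrightarrow> definable real_coords (Q e)"
  by (rule definable_prod_subst) (auto intro: term_const term_real real_coords_terms)

text \<open>Right germs are first-order: there is a bound beyond the point below which the property
  holds. This lets limits and derivatives occur in definable formulas.\<close>

lemma definable_eventually_right:
  assumes Q: "definable (cs \<otimes> real_coords) (\<lambda>p. Q (fst p) (snd p))" and t: "definable_term cs t"
  shows "definable cs (\<lambda>e. \<forall>\<^sub>F y in at_right (t e). Q e y)"
proof -
  have "definable ((cs \<otimes> real_coords) \<otimes> real_coords) (\<lambda>p. Q (fst (fst p)) (snd p))"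
    by (rule definable_prod_subst[OF Q])
      (auto intro!: term_fst term_var real_coords_terms term_snd term_real simp: prod_coords_def real_coords_def)
  then show ?thesis unfolding eventually_at_right_field
    by (intro definable_ex definable_all definable_conj definable_imp definable_less
        term_fst term_snd term_real t)
qed

lemma term_The:
  assumes "definable (cs \<otimes> real_coords) (\<lambda>p. G (fst p) (snd p))" and "\<And>e. \<exists>!q. G e q"
  shows "definable_term cs (\<lambda>e. THE q. G e q)"
proof -
  have "(\<lambda>p. snd p = (THE q. G (fst p) q)) = (\<lambda>p. G (fst p) (snd p))"
    using assms(2) by (metis the_equality)
  then show ?thesis unfolding definable_term_def using assms(1) by simp
qed

lemma definable_isCont_right:
  assumes g: "definable_term real_coords g"
  shows "definable real_coords (\<lambda>x. (g \<longlongrightarrow> g x) (at_right x))"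
  unfolding tendsto_iff dist_real_def abs_less_iff
  by (intro definable_all definable_imp definable_eventually_right definable_conj definable_less
      term_const term_diff term_uminus term_real_subst[OF g] term_fst term_snd term_real)

text \<open>On an interval of such points, g would lie below p everywhere and yet above p just to
  the right of each point.\<close>

lemma finite_right_jump:
  assumes g: "definable_term real_coords g"
  shows "finite {x. g x < p \<and> (\<forall>\<^sub>F y in at_right x. p < g y)}" (is "finite ?A")
proof (rule ccontr)
  assume "infinite ?A"
  moreover have "definable real_coords (\<lambda>x. g x < p \<and> (\<forall>\<^sub>F y in at_right x. p < g y))"
    by (intro definable_conj definable_less definable_eventually_right
        term_const term_real_subst[OF g] term_fst term_snd term_real)
  ultimately obtain a b where ab: "a < b" "\<And>x. a < x \<Longrightarrow> x < b \<Longrightarrow> x \<in> ?A"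
    using definable_finite_or_interval by blast
  then obtain x where x: "a < x" "x < b" using dense by blast
  have "\<forall>\<^sub>F y in at_right x. p < g y" using ab(2)[OF x] by simp
  moreover have "\<forall>\<^sub>F y in at_right x. g y < p"
    using ab(2) x by (auto simp: eventually_at_right_field intro!: exI[of _ b])
  ultimately have "\<forall>\<^sub>F y in at_right x. False" by eventually_elim simp
  then show False by simp
qed

text \<open>By definability it suffices that good points are dense. At a bad point
  \<open>germ_right\<close> yields a jump of g or of -g across some rational p, so the bad points
  lie in a countable union of finite sets, which contains no interval.\<close>

lemma finite_not_isCont_right:
  assumes g: "definable_term real_coords g"
  shows "finite {x. \<not> (g \<longlongrightarrow> g x) (at_right x)}"
proof (rule definable_cofinite[OF definable_isCont_right[OF g]])
  let ?A = "\<lambda>g p. {x. g x < p \<and> (\<forall>\<^sub>F y in at_right x. p < g y)} :: real set"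
  let ?U = "(\<Union>p\<in>\<rat>. ?A g p) \<union> (\<Union>p\<in>\<rat>. ?A (\<lambda>x. - g x) p)"
  have "countable ?U"
    using finite_right_jump[OF g] finite_right_jump[OF term_uminus[OF g]]
    by (intro countable_Un countable_UN countable_rat) (auto intro: countable_finite)
  have jump: "\<exists>p\<in>\<rat>. x \<in> ?A h p"
    if h: "definable_term real_coords h" and e: "e > 0" and ev: "\<forall>\<^sub>F y in at_right x. h y \<ge> h x + e" for h x e
  proof -
    obtain p where p: "p \<in> \<rat>" "h x < p" "p < h x + e" using Rats_dense_in_real[of "h x" "h x + e"] e by auto
    have "\<forall>\<^sub>F y in at_right x. p < h y" using ev p(3) by (auto elim: eventually_mono)
    then show ?thesis using p by blast
  qed
  have sub: "(g \<longlongrightarrow> g x) (at_right x)" if x: "x \<notin> ?U" for x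
  proof (rule tendstoI)
    fix e :: real assume e: "e > 0"
    have ev: "\<forall>\<^sub>F y in at_right x. h y < h x + e" if h: "definable_term real_coords h" and hx: "\<And>p. p \<in> \<rat> \<Longrightarrow> x \<notin> ?A h p" for h
    proof -
      have "definable real_coords (\<lambda>y. h y < h x + e)"
        by (intro definable_less term_const h)
      from germ_right[OF this, of x] show ?thesis
        using jump[OF h e, of x] hx unfolding not_less by blast
    qed
    have "\<forall>\<^sub>F y in at_right x. g y < g x + e" using ev[OF g] x by blast
    moreover have "\<forall>\<^sub>F y in at_right x. - g y < - g x + e" using ev[OF term_uminus[OF g]] x by blast
    ultimately show "\<forall>\<^sub>F y in at_right x. dist (g y) (g x) < e"
      by eventually_elim (auto simp: dist_real_def)
  qed
  fix a b :: real assume "a < b"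
  then have "\<not> {a<..<b} \<subseteq> ?U"
    using \<open>countable ?U\<close> countable_subset uncountable_open_interval by blast
  then show "\<exists>x. a < x \<and> x < b \<and> (g \<longlongrightarrow> g x) (at_right x)" using sub by (auto 0 4)
qed

text \<open>Left limits are rewritten as right limits of the reflected function, so that right germs
  suffice for two-sided continuity.\<close>

lemma isCont_split:
  fixes g :: "real \<Rightarrow> real"
  shows "isCont g x \<longleftrightarrow> (g \<longlongrightarrow> g x) (at_right x) \<and> ((\<lambda>y. g (- y)) \<longlongrightarrow> g x) (at_right (- x))"
proof -
  have "isCont g x \<longleftrightarrow> continuous (at_left x) g \<and> continuous (at_right x) g"
    by (rule continuous_at_split)
  moreover have "continuous (at_right x) g \<longleftrightarrow> (g \<longlongrightarrow> g x) (at_right x)"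
    by (simp add: continuous_within)
  moreover have "continuous (at_left x) g \<longleftrightarrow> (g \<longlongrightarrow> g x) (at_left x)"
    by (simp add: continuous_within)
  moreover have "(g \<longlongrightarrow> g x) (at_left x) \<longleftrightarrow> ((\<lambda>y. g (- y)) \<longlongrightarrow> g x) (at_right (- x))"
    by (subst at_left_minus) (simp add: filterlim_filtermap)
  ultimately show ?thesis by blast
qed

lemma definable_isCont:
  assumes g: "definable_term real_coords g"
  shows "definable real_coords (isCont g)"
proof -
  have "definable_term real_coords (\<lambda>y. g (- y))"
    by (intro term_real_subst[OF g] term_uminus term_real)
  from definable_real_subst[OF definable_isCont_right[OF this] term_uminus[OF term_real]]
  have "definable real_coords (\<lambda>x. ((\<lambda>y. g (- y)) \<longlongrightarrow> g x) (at_right (- x)))" by simp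
  then show ?thesis unfolding isCont_split[abs_def]
    by (intro definable_conj definable_isCont_right[OF g])
qed

theorem finite_not_isCont:
  assumes g: "definable_term real_coords g"
  shows "finite {x. \<not> isCont g x}"
proof -
  let ?L = "{x. \<not> ((\<lambda>y. g (- y)) \<longlongrightarrow> g (- x)) (at_right x)}"
  have "definable_term real_coords (\<lambda>y. g (- y))"
    by (intro term_real_subst[OF g] term_uminus term_real)
  then have "finite ?L" by (rule finite_not_isCont_right)
  then have "finite (uminus ` ?L \<union> {x. \<not> (g \<longlongrightarrow> g x) (at_right x)})"
    using finite_not_isCont_right[OF g] by simp
  then show ?thesis
  proof (rule finite_subset[rotated])
    show "{x. \<not> isCont g x} \<subseteq> uminus ` ?L \<union> {x. \<not> (g \<longlongrightarrow> g x) (at_right x)}"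
    proof
      fix x assume "x \<in> {x. \<not> isCont g x}"
      then have "x \<in> {x. \<not> (g \<longlongrightarrow> g x) (at_right x)} \<or> - x \<in> ?L" by (auto simp: isCont_split)
      then show "x \<in> uminus ` ?L \<union> {x. \<not> (g \<longlongrightarrow> g x) (at_right x)}"
        by (auto simp: image_iff) (metis add.inverse_inverse)
    qed
  qed
qed

text \<open>On an interval of such points where g is also continuous, \<open>g x - N * x\<close>
  would be nondecreasing for every N, which makes \<open>g d - g c\<close> larger than every
  multiple of \<open>d - c\<close>.\<close>

lemma finite_right_slope_infinite:
  assumes g: "definable_term real_coords g"
  shows "finite {x. \<forall>N. \<forall>\<^sub>F y in at_right x. g x + N * (y - x) < g y}" (is "finite {x. ?up x}")
proof (rule ccontr)
  assume "infinite {x. ?up x}"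
  then have "infinite ({x. ?up x} - {x. \<not> isCont g x})"
    using finite_not_isCont[OF g] by simp
  also have "{x. ?up x} - {x. \<not> isCont g x} = {x. ?up x \<and> isCont g x}" by auto
  finally have "infinite {x. ?up x \<and> isCont g x}" .
  define U where "U x \<longleftrightarrow> ?up x \<and> isCont g x" for x
  have inf: "infinite {x. U x}" unfolding U_def by fact
  have "definable real_coords U" unfolding U_def
    by (intro definable_conj definable_isCont[OF g] definable_all definable_eventually_right definable_less
        term_const term_diff term_mult term_add term_real_subst[OF g] term_fst term_snd term_real)
  from definable_finite_or_interval[OF this] inf
  obtain a b where ab: "a < b" "\<And>x. a < x \<Longrightarrow> x < b \<Longrightarrow> U x"
    by blast
  obtain c where c: "a < c" "c < b" using dense ab(1) by blast
  obtain d where d: "c < d" "d < b" using dense c by blast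
  have le: "g c - N * c \<le> g d - N * d" for N
  proof (rule nondecreasing_if_right_nondecreasing[where k = "\<lambda>x. g x - N * x"])
    show "continuous_on {c..d} (\<lambda>x. g x - N * x)"
      using ab(2) c d unfolding U_def by (intro continuous_intros continuous_at_imp_continuous_on) auto
    show "\<forall>\<^sub>F y in at_right x. g x - N * x \<le> g y - N * y" if "c \<le> x" "x < d" for x
    proof -
      have "\<forall>\<^sub>F y in at_right x. g x + N * (y - x) < g y" using ab(2)[of x] that c d unfolding U_def by auto
      then show ?thesis by eventually_elim (simp add: algebra_simps)
    qed
  qed (use d in auto)
  have bound: "N * (d - c) \<le> g d - g c" for N
    using le[of N] by (simp add: algebra_simps)
  \<comment> \<open>N is taken one above the difference quotient of g over [c, d].\<close>
  have "((g d - g c) / (d - c) + 1) * (d - c) = g d - g c + (d - c)"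
    using d by (simp add: distrib_right)
  then show False using d bound[of "(g d - g c) / (d - c) + 1"] by linarith
qed

text \<open>By \<open>germ_right\<close> every line through the point of the graph at x is
  eventually strictly below g, or eventually not. The slopes of the first kind form a set U;
  \<open>up\<close> bounds it above, \<open>dn\<close> makes it nonempty, and its supremum is the
  derivative.\<close>

lemma right_derivative_exists:
  assumes g: "definable_term real_coords g"
    and up: "\<not> (\<forall>N. \<forall>\<^sub>F y in at_right x. g x + N * (y - x) < g y)"
    and dn: "\<not> (\<forall>N. \<forall>\<^sub>F y in at_right x. - g x + N * (y - x) < - g y)"
  shows "\<exists>q. (g has_real_derivative q) (at_right x)"
proof -
  have germ: "(\<forall>\<^sub>F y in at_right x. g x + N * (y - x) < g y) \<or> (\<forall>\<^sub>F y in at_right x. g y \<le> g x + N * (y - x))" for N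
  proof -
    have "definable real_coords (\<lambda>y. g x + N * (y - x) < g y)"
      by (intro definable_less term_const term_diff term_mult term_add term_real g)
    from germ_right[OF this, of x] show ?thesis by (simp add: not_less)
  qed
  define U where "U = {N. \<forall>\<^sub>F y in at_right x. g x + N * (y - x) < g y}"
  obtain M where M: "\<forall>\<^sub>F y in at_right x. g y \<le> g x + M * (y - x)" using up germ by blast
  have bdd: "N \<le> M" if "N \<in> U" for N
  proof (rule ccontr)
    assume "\<not> N \<le> M"
    have "\<forall>\<^sub>F y in at_right x. False"
      using M that[unfolded U_def mem_Collect_eq] eventually_at_right_less[of x]
    proof eventually_elim
      case (elim y)
      then have "N * (y - x) < M * (y - x)" by linarith
      then show False using elim \<open>\<not> N \<le> M\<close> by (simp add: mult_less_cancel_right)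
    qed
    then show False by simp
  qed
  obtain N where N: "\<not> (\<forall>\<^sub>F y in at_right x. - g x + N * (y - x) < - g y)" using dn by blast
  have "definable real_coords (\<lambda>y. - g x + N * (y - x) < - g y)"
    by (intro definable_less term_const term_diff term_mult term_add term_real term_uminus g)
  from germ_right[OF this, of x] N have "\<forall>\<^sub>F y in at_right x. \<not> - g x + N * (y - x) < - g y" by blast
  then have "\<forall>\<^sub>F y in at_right x. g x + (- N - 1) * (y - x) < g y"
    using eventually_at_right_less[of x] by eventually_elim (simp add: algebra_simps)
  then have ne: "U \<noteq> {}" unfolding U_def by blast
  have bddU: "bdd_above U" using bdd by (auto simp: bdd_above_def)
  have "((\<lambda>y. (g y - g x) / (y - x)) \<longlongrightarrow> Sup U) (at_right x)"
  proof (rule order_tendstoI)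
    fix a assume "a < Sup U"
    then obtain N where "N \<in> U" "a < N" using less_cSup_iff[OF ne bddU] by blast
    then have "\<forall>\<^sub>F y in at_right x. g x + N * (y - x) < g y" by (simp add: U_def)
    then show "\<forall>\<^sub>F y in at_right x. a < (g y - g x) / (y - x)"
      using eventually_at_right_less[of x]
    proof eventually_elim
      case (elim y)
      have "a * (y - x) \<le> N * (y - x)" using elim \<open>a < N\<close> by (intro mult_right_mono) auto
      then have "a * (y - x) < g y - g x" using elim by linarith
      then show ?case using elim by (simp add: pos_less_divide_eq)
    qed
  next
    fix a assume "Sup U < a"
    then obtain N where N: "Sup U < N" "N < a" using dense by blast
    then have "N \<notin> U" using cSup_upper[OF _ bddU] by force
    then have "\<forall>\<^sub>F y in at_right x. g y \<le> g x + N * (y - x)" using germ unfolding U_def by blast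
    then show "\<forall>\<^sub>F y in at_right x. (g y - g x) / (y - x) < a"
      using eventually_at_right_less[of x]
    proof eventually_elim
      case (elim y)
      have "N * (y - x) < a * (y - x)" using elim \<open>N < a\<close> by (intro mult_strict_right_mono) auto
      then have "g y - g x < a * (y - x)" using elim by linarith
      then show ?case using elim by (simp add: pos_divide_less_eq)
    qed
  qed
  then show ?thesis by (auto simp: has_field_derivative_iff)
qed

text \<open>With the difference quotient multiplied out and the absolute value split, the right
  derivative becomes a formula in definable terms.\<close>

lemma right_derivative_iff:
  fixes g :: "real \<Rightarrow> real"
  shows "(g has_real_derivative q) (at_right x) \<longleftrightarrow>
    (\<forall>e>0. \<forall>\<^sub>F y in at_right x. g y - g x - q * (y - x) \<le> e * (y - x) \<and> - (g y - g x - q * (y - x)) \<le> e * (y - x))"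
    (is "_ \<longleftrightarrow> ?R")
proof
  assume "(g has_real_derivative q) (at_right x)"
  from right_derivative_bound[OF this] show ?R by (simp add: abs_le_iff)
next
  assume R: ?R
  have "((\<lambda>y. (g y - g x) / (y - x)) \<longlongrightarrow> q) (at_right x)"
  proof (rule tendstoI)
    fix e :: real assume "e > 0"
    then have "e / 2 > 0" by simp
    with R have "\<forall>\<^sub>F y in at_right x. g y - g x - q * (y - x) \<le> e / 2 * (y - x) \<and> - (g y - g x - q * (y - x)) \<le> e / 2 * (y - x)"
      by blast
    then show "\<forall>\<^sub>F y in at_right x. dist ((g y - g x) / (y - x)) q < e"
      using eventually_at_right_less[of x]
    proof eventually_elim
      case (elim y)
      have "g y - g x \<le> (q + e / 2) * (y - x)" "(q - e / 2) * (y - x) \<le> g y - g x"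
        using elim unfolding distrib_right left_diff_distrib by linarith+
      then have "(g y - g x) / (y - x) \<le> q + e / 2" "q - e / 2 \<le> (g y - g x) / (y - x)"
        using elim by (simp_all only: pos_divide_le_eq pos_le_divide_eq diff_gt_0_iff_gt)
      then show ?case using \<open>e > 0\<close> by (auto simp: dist_real_def abs_less_iff)
    qed
  qed
  then show "(g has_real_derivative q) (at_right x)" by (simp add: has_field_derivative_iff)
qed

text \<open>The right derivative is again a definable function, hence continuous off a finite set;
  there \<open>derivative_if_right_derivative\<close> turns it into a two-sided derivative.\<close>

theorem definable_piecewise_C1:
  assumes g: "definable_term real_coords g"
  obtains g' Q where "definable_term real_coords g'" "finite Q"
    "\<And>x. x \<notin> Q \<Longrightarrow> (g has_real_derivative g' x) (at x)" "\<And>x. x \<notin> Q \<Longrightarrow> isCont g' x"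
proof -
  \<comment> \<open>The value 0 where no right derivative exists makes G functional at every x, as
    \<open>term_The\<close> demands.\<close>
  define G where "G x q \<longleftrightarrow> (g has_real_derivative q) (at_right x)
     \<or> \<not> (\<exists>q. (g has_real_derivative q) (at_right x)) \<and> q = 0" for x q
  define g' where "g' x = (THE q. G x q)" for x
  have ex1: "\<exists>!q. G x q" for x
    unfolding G_def
    using has_field_derivative_unique[of g _ x "{x<..}"] trivial_limit_at_right_real[of x] by blast
  have der: "definable (real_coords \<otimes> real_coords) (\<lambda>p. (g has_real_derivative snd p) (at_right (fst p)))"
    unfolding right_derivative_iff
    by (intro definable_all definable_imp definable_eventually_right definable_conj definable_less definable_le
      term_const term_diff term_mult term_uminus term_real_subst[OF g] term_fst term_snd term_real)
  have "definable (real_coords \<otimes> real_coords) (\<lambda>p. G (fst p) (snd p))" unfolding G_def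
    by (intro definable_disj der definable_conj definable_not definable_fst[of real_coords "\<lambda>x. \<exists>q. (g has_real_derivative q) (at_right x)"]
        definable_ex definable_eq term_snd term_real term_const)
  from term_The[OF this ex1] have g': "definable_term real_coords g'" by (simp add: g'_def[abs_def])
  define Q where "Q = {x. \<not> isCont g x} \<union> {x. \<not> isCont g' x}
    \<union> {x. \<forall>N. \<forall>\<^sub>F y in at_right x. g x + N * (y - x) < g y}
    \<union> {x. \<forall>N. \<forall>\<^sub>F y in at_right x. - g x + N * (y - x) < - g y}"
  have "finite Q"
    unfolding Q_def using finite_right_slope_infinite[OF g] finite_right_slope_infinite[OF term_uminus[OF g]]
      finite_not_isCont[OF g] finite_not_isCont[OF g'] by simp
  have right: "(g has_real_derivative g' x) (at_right x)" if "x \<notin> Q" for x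
  proof -
    have "\<exists>q. (g has_real_derivative q) (at_right x)"
      using right_derivative_exists[OF g, of x] that unfolding Q_def by blast
    then show ?thesis using theI'[OF ex1, of x] unfolding g'_def G_def by blast
  qed
  have "(g has_real_derivative g' x) (at x)" if x: "x \<notin> Q" for x
  proof -
    have "open (- Q)" using \<open>finite Q\<close> finite_imp_closed by blast
    then obtain e where e: "e > 0" "\<And>y. dist y x < e \<Longrightarrow> y \<notin> Q" using x
      unfolding open_dist by auto
    have nQ: "y \<notin> Q" if "x - e < y" "y < x + e" for y
      using that e(2)[of y] by (auto simp: dist_real_def)
    show ?thesis
    proof (rule derivative_if_right_derivative[of "x - e" "x + e"])
      show "continuous_on {x - e<..<x + e} g" "continuous_on {x - e<..<x + e} g'"
        using nQ by (auto intro!: continuous_at_imp_continuous_on simp: Q_def)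
    qed (use nQ right e(1) in auto)
  qed
  moreover have "isCont g' x" if "x \<notin> Q" for x using that by (auto simp: Q_def)
  ultimately show ?thesis using that g' \<open>finite Q\<close> by blast
qed

text \<open>Frontier points are discontinuities of the indicator function, which is a definable
  term.\<close>

lemma finite_frontier_definable:
  assumes P: "definable real_coords P"
  shows "finite (frontier {x. P x})"
proof -
  have "definable_term real_coords (\<lambda>x. if P x then 1 else 0)"
    by (intro term_if P term_const)
  then have fin: "finite {x. \<not> isCont (\<lambda>x. if P x then 1 else 0 :: real) x}" by (rule finite_not_isCont)
  have "isCont (\<lambda>x. if P x then 1 else 0 :: real) x \<Longrightarrow> x \<notin> frontier {x. P x}" for x
  proof
    assume c: "isCont (\<lambda>x. if P x then 1 else 0 :: real) x" and f: "x \<in> frontier {x. P x}"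
    from c obtain e where e: "e > 0"
      "\<And>y. dist y x < e \<Longrightarrow> dist (if P y then 1 else 0 :: real) (if P x then 1 else 0) < 1"
      unfolding continuous_at_eps_delta using zero_less_one by (metis dist_real_def)
    have "P y \<longleftrightarrow> P x" if "dist y x < e" for y
      using e(2)[OF that] by (auto simp: dist_real_def split: if_splits)
    moreover obtain y z where "P y" "dist y x < e" "\<not> P z" "dist z x < e"
      using f e(1) unfolding frontier_straddle by (auto simp: dist_commute)
    ultimately show False by blast
  qed
  then show ?thesis by (intro finite_subset[OF _ fin]) blast
qed

end

section \<open>Definable choice\<close>

context ominimal begin

text \<open>The selector picks the least element of the fibre if there is one, and otherwise the midpoint
  of the maximal interval of the fibre that starts at its infimum.\<close>

lemma definable_choice:
  assumes P: "definable (cs \<otimes> real_coords) (\<lambda>p. P (fst p) (snd p))"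
    and bdd: "\<And>e y. P e y \<Longrightarrow> \<bar>y\<bar> \<le> C"
  obtains t where "definable_term cs t" "\<And>e y. P e y \<Longrightarrow> P e (t e)"
proof -
  define lb where "lb e a \<longleftrightarrow> (\<forall>y. P e y \<longrightarrow> a \<le> y)" for e a
  define inf where "inf e a \<longleftrightarrow> lb e a \<and> (\<forall>a'. lb e a' \<longrightarrow> a' \<le> a)" for e a
  define run where "run e a b \<longleftrightarrow> a < b \<and> (\<forall>y. a < y \<and> y < b \<longrightarrow> P e y)" for e a b
  define maxrun where "maxrun e a b \<longleftrightarrow> run e a b \<and> (\<forall>b'. run e a b' \<longrightarrow> b' \<le> b)" for e a b
  \<comment> \<open>Functional for every e, with value 0 over an empty fibre. The equation
    \<open>q + q = a + b\<close> states the midpoint without division.\<close>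
  define G where "G e q \<longleftrightarrow> (\<exists>y. P e y) \<and>
      (\<exists>a. inf e a \<and> (P e a \<and> q = a \<or> \<not> P e a \<and> (\<exists>b. maxrun e a b \<and> q + q = a + b)))
    \<or> \<not> (\<exists>y. P e y) \<and> q = 0" for e q
  have G: "(\<exists>!q. G e q) \<and> (\<forall>q. (\<exists>y. P e y) \<and> G e q \<longrightarrow> P e q)" for e
  proof (cases "\<exists>y. P e y")
    case False
    then show ?thesis by (auto simp: G_def)
  next
    case True
    define X where "X = {y. P e y}"
    have ne: "X \<noteq> {}" and bX: "bdd_below X"
      using True bdd by (auto simp: X_def abs_le_iff bdd_below_def intro!: exI[of _ "- C"]) (smt (verit) bdd)
    have lb: "lb e a \<longleftrightarrow> a \<le> Inf X" for a
      using le_cInf_iff[OF ne bX, of a] by (auto simp: lb_def X_def)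
    then have inf: "inf e a \<longleftrightarrow> a = Inf X" for a by (auto simp: inf_def intro: antisym)
    define m where "m = Inf X"
    show ?thesis
    proof (cases "P e m")
      case True
      then show ?thesis using \<open>\<exists>y. P e y\<close> inf by (auto simp: G_def m_def)
    next
      case nm: False
      \<comment> \<open>As m itself is missing from the fibre, a gap to the right of m would make
        the far end of the gap a lower bound greater than the infimum.\<close>
      have "\<not> (\<forall>\<^sub>F y in at_right m. \<not> P e y)"
      proof
        assume "\<forall>\<^sub>F y in at_right m. \<not> P e y"
        then obtain b where b: "b > m" "\<And>y. m < y \<Longrightarrow> y < b \<Longrightarrow> \<not> P e y"
          by (auto simp: eventually_at_right_field)
        have "b \<le> y" if "y \<in> X" for y
        proof (rule ccontr)
          assume "\<not> b \<le> y"
          moreover have "m \<le> y" unfolding m_def using that bX by (rule cInf_lower)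
          moreover have "m \<noteq> y" using that nm by (auto simp: X_def)
          ultimately show False using b(2)[of y] that by (auto simp: X_def)
        qed
        then have "b \<le> m" unfolding m_def using ne by (intro cInf_greatest) auto
        with b(1) show False by simp
      qed
      with germ_right[OF definable_section[OF P, of e], of m]
      have "\<forall>\<^sub>F y in at_right m. P e y" by blast
      then obtain b0 where b0: "run e m b0" by (auto simp: run_def eventually_at_right_field)
      define Y where "Y = {b. run e m b}"
      \<comment> \<open>A run reaching past C would contain fibre points above C. The ends of runs
        are therefore bounded, and a maximal run exists.\<close>
      have "b \<le> C" if "b \<in> Y" for b
      proof (rule dense_le_bounded)
        show "m < b" using that by (simp add: Y_def run_def)
        show "w \<le> C" if "m < w" "w < b" for w
          using \<open>b \<in> Y\<close> that bdd[of e w] by (auto simp: Y_def run_def abs_le_iff)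
      qed
      then have bY: "bdd_above Y" by (auto simp: bdd_above_def)
      have "b0 \<in> Y" using b0 by (simp add: Y_def)
      have b0s: "b0 \<le> Sup Y" using \<open>b0 \<in> Y\<close> bY by (rule cSup_upper)
      have "m < b0" using b0 by (simp add: run_def)
  have inY: "P e y" if y: "m < y" "y < Sup Y" for y
      proof -
        obtain b where "b \<in> Y" "y < b" using y less_cSup_iff[OF _ bY, of y] \<open>b0 \<in> Y\<close> by blast
        then show ?thesis using y by (auto simp: Y_def run_def)
      qed
      have "maxrun e m (Sup Y)"
        using \<open>m < b0\<close> b0s inY cSup_upper[OF _ bY] by (auto simp: maxrun_def run_def Y_def)
      then have mr: "maxrun e m b \<longleftrightarrow> b = Sup Y" for b
        by (auto simp: maxrun_def intro: antisym)
      have "G e q \<longleftrightarrow> q + q = m + Sup Y" for q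
        unfolding G_def using True inf nm mr by (auto simp: m_def)
      moreover define c where "c = (m + Sup Y) / 2"
      moreover have "q + q = m + Sup Y \<longleftrightarrow> q = c" for q unfolding c_def by argo
      ultimately have Gq: "G e q \<longleftrightarrow> q = c" for q by simp
      have "P e c" using \<open>m < b0\<close> b0s unfolding c_def by (intro inY) auto
      then show ?thesis unfolding Gq by simp
    qed
  qed
  have "definable (cs \<otimes> real_coords) (\<lambda>p. G (fst p) (snd p))"
    unfolding G_def inf_def maxrun_def run_def lb_def
    by (intro definable_disj definable_conj definable_not definable_ex definable_all definable_imp
        definable_prod_subst[OF P] definable_eq definable_le definable_less term_add term_const
        term_snd term_real term_fst | assumption | erule term_var | erule real_coords_terms[rotated])+
  then have "definable_term cs (\<lambda>e. THE q. G e q)" using G by (intro term_The) auto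
  moreover have "P e (THE q. G e q)" if "P e y" for e y
    using G[of e] that theI'[of "G e"] by blast
  ultimately show ?thesis using that by blast
qed

text \<open>Coordinates are fixed one at a time: B' is a subrelation of B with the same nonempty
  fibres on which the coordinates in I are already definable functions of e. For I = UNIV each fibre
  has at most one point.\<close>

lemma definable_choice_vec:
  fixes B :: "'e \<Rightarrow> real^'p::finite \<Rightarrow> bool"
  assumes B: "definable (cs \<otimes> vec_coords) (\<lambda>p. B (fst p) (snd p))"
    and bdd: "\<And>e u i. B e u \<Longrightarrow> \<bar>u $ i\<bar> \<le> C"
  obtains t where "\<And>i. definable_term cs (\<lambda>e. t e $ i)" "\<And>e u. B e u \<Longrightarrow> B e (t e)"
proof -
  have "\<exists>B'. definable (cs \<otimes> vec_coords) (\<lambda>p. B' (fst p) (snd p)) \<and> (\<forall>e u. B' e u \<longrightarrow> B e u)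
      \<and> (\<forall>e. (\<exists>u. B e u) \<longrightarrow> (\<exists>u. B' e u))
      \<and> (\<forall>i\<in>I. \<exists>t. definable_term cs t \<and> (\<forall>e u. B' e u \<longrightarrow> u $ i = t e))" for I :: "'p set"
    using finite[of I]
  proof (induction I rule: finite_induct)
    case empty
    show ?case using B by blast
  next
    case (insert i I)
    then obtain B' where B': "definable (cs \<otimes> vec_coords) (\<lambda>p. B' (fst p) (snd p))"
      and sub: "\<And>e u. B' e u \<Longrightarrow> B e u" and ex: "\<And>e u. B e u \<Longrightarrow> \<exists>u. B' e u"
      and det: "\<And>i. i \<in> I \<Longrightarrow> \<exists>t. definable_term cs t \<and> (\<forall>e u. B' e u \<longrightarrow> u $ i = t e)"
      by blast
    define P where "P e y \<longleftrightarrow> (\<exists>u. B' e u \<and> u $ i = y)" for e y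
    have "definable (cs \<otimes> real_coords) (\<lambda>p. P (fst p) (snd p))" unfolding P_def
      by (intro definable_ex_vec definable_conj definable_prod_subst[OF B'] definable_eq
          term_snd term_real term_vec term_fst | assumption | erule term_var | erule vec_coords_terms[rotated])+
    moreover have "\<bar>y\<bar> \<le> C" if "P e y" for e y using that sub bdd unfolding P_def by blast
    ultimately obtain t where t: "definable_term cs t" "\<And>e y. P e y \<Longrightarrow> P e (t e)"
      using definable_choice[of cs P C] by metis
    have "definable (cs \<otimes> vec_coords) (\<lambda>p. B' (fst p) (snd p) \<and> snd p $ i = t (fst p))"
      by (intro definable_conj B' definable_eq term_snd term_vec term_fst t(1))
    moreover have "\<exists>u. B' e u \<and> u $ i = t e" if be: "B e u" for e u
    proof -
      obtain v where "B' e v" using ex be by blast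
      then have "P e (v $ i)" by (auto simp: P_def)
      from t(2)[OF this] show ?thesis by (simp add: P_def)
    qed
    moreover have "\<exists>s. definable_term cs s \<and> (\<forall>e u. B' e u \<and> u $ i = t e \<longrightarrow> u $ j = s e)" if "j \<in> insert i I" for j
    proof (cases "j = i")
      case True
      then show ?thesis using t(1) by blast
    next
      case False
      with that have "j \<in> I" by blast
      then show ?thesis using det[of j] by blast
    qed
    ultimately show ?case using sub
      by (intro exI[of _ "\<lambda>e u. B' e u \<and> u $ i = t e"] conjI allI impI ballI) (assumption | elim exE | blast)+
  qed
  from this[of UNIV] obtain B' where sub: "\<And>e u. B' e u \<Longrightarrow> B e u"
    and ex: "\<And>e u. B e u \<Longrightarrow> \<exists>u. B' e u"
    and det: "\<And>i. \<exists>t. definable_term cs t \<and> (\<forall>e u. B' e u \<longrightarrow> u $ i = t e)"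
    by blast
  from det obtain t where t: "\<And>i. definable_term cs (t i)" "\<And>i e u. B' e u \<Longrightarrow> u $ i = t i e"
    by metis
  have "B e (\<chi> i. t i e)" if be: "B e u" for e u
  proof -
    obtain v where v: "B' e v" using ex be by blast
    then have "v = (\<chi> i. t i e)" using t(2) by (simp add: vec_eq_iff)
    with v sub show ?thesis by simp
  qed
  then show ?thesis using that[of "\<lambda>e. \<chi> i. t i e"] t(1) by simp
qed

end

section \<open>Absolutely continuous paths\<close>

text \<open>The premise of absolute continuity over an arbitrary finite index set, so that a set of
  tagged intervals from a division can serve as the index set as it stands.\<close>

definition small_family :: "real set \<Rightarrow> real \<Rightarrow> 'i set \<Rightarrow> ('i \<Rightarrow> real) \<Rightarrow> ('i \<Rightarrow> real) \<Rightarrow> bool" where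
  "small_family I d F lo hi \<longleftrightarrow> finite F \<and> (\<forall>k\<in>F. lo k \<le> hi k \<and> {lo k..hi k} \<subseteq> I)
     \<and> (\<forall>j\<in>F. \<forall>k\<in>F. j \<noteq> k \<longrightarrow> {lo j<..<hi j} \<inter> {lo k<..<hi k} = {})
     \<and> (\<Sum>k\<in>F. hi k - lo k) < d"

lemma abs_continuous_on_iff:
  "abs_continuous_on I g \<longleftrightarrow> (\<forall>e>0. \<exists>d>0. \<forall>n lo hi. small_family I d {..<n::nat} lo hi \<longrightarrow>
     (\<Sum>k<n. norm (g (hi k) - g (lo k))) < e)"
  unfolding abs_continuous_on_def small_family_def by (simp add: Ball_def)

lemma abs_continuous_onI:
  assumes "\<And>e. e > 0 \<Longrightarrow> \<exists>d>0. \<forall>n lo hi. small_family I d {..<n::nat} lo hi \<longrightarrow>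
     (\<Sum>k<n. norm (g (hi k) - g (lo k))) < e"
  shows "abs_continuous_on I g"
  unfolding abs_continuous_on_iff using assms by (intro allI impI)

lemma small_familyD:
  assumes "small_family I d F lo hi"
  shows "finite F" "k \<in> F \<Longrightarrow> lo k \<le> hi k" "k \<in> F \<Longrightarrow> {lo k..hi k} \<subseteq> I"
    "k \<in> F \<Longrightarrow> lo k \<in> I" "k \<in> F \<Longrightarrow> hi k \<in> I"
    "j \<in> F \<Longrightarrow> k \<in> F \<Longrightarrow> j \<noteq> k \<Longrightarrow> {lo j<..<hi j} \<inter> {lo k<..<hi k} = {}"
    "(\<Sum>k\<in>F. hi k - lo k) < d"
  using assms unfolding small_family_def by (auto dest!: bspec)

lemma abs_continuous_onD:
  assumes g: "abs_continuous_on I g" and "e > 0"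
  obtains d where "d > 0"
    "\<And>(F :: 'i set) lo hi. small_family I d F lo hi \<Longrightarrow> (\<Sum>k\<in>F. norm (g (hi k) - g (lo k))) < e"
proof -
  obtain d where "d > 0"
    and d: "\<forall>n lo hi. small_family I d {..<n::nat} lo hi \<longrightarrow> (\<Sum>k<n. norm (g (hi k) - g (lo k))) < e"
    using g[unfolded abs_continuous_on_iff, THEN spec[of _ e], THEN mp, OF \<open>e > 0\<close>] by blast
  show ?thesis
  proof (rule that[OF \<open>d > 0\<close>])
    fix F :: "'i set" and lo hi :: "'i \<Rightarrow> real"
    assume H: "small_family I d F lo hi"
    obtain h where h: "bij_betw h {..<card F} F"
      using ex_bij_betw_nat_finite[OF small_familyD(1)[OF H]] by (auto simp: atLeast0LessThan)
    have reidx: "(\<Sum>k<card F. f (h k)) = (\<Sum>k\<in>F. f k)" for f :: "'i \<Rightarrow> real"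
      using sum.reindex_bij_betw[OF h] .
    have hF: "h k \<in> F" if "k < card F" for k using h that by (auto simp: bij_betw_def)
    have hinj: "h j \<noteq> h k" if "j < card F" "k < card F" "j \<noteq> k" for j k
      using h that by (auto simp: bij_betw_def inj_on_def)
    have "small_family I d {..<card F} (\<lambda>k. lo (h k)) (\<lambda>k. hi (h k))"
      unfolding small_family_def
      using hF hinj small_familyD[OF H] by (simp add: reidx[of "\<lambda>k. hi k - lo k"])
    from d[THEN spec, THEN spec, THEN spec, THEN mp, OF this]
    show "(\<Sum>k\<in>F. norm (g (hi k) - g (lo k))) < e"
      by (simp add: reidx[of "\<lambda>k. norm (g (hi k) - g (lo k))"])
  qed
qed

lemma abs_continuous_on_cong:
  assumes "\<And>t. t \<in> I \<Longrightarrow> g t = h t" "abs_continuous_on I g"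
  shows "abs_continuous_on I h"
proof (rule abs_continuous_onI)
  fix e :: real assume "e > 0"
  obtain d where "d > 0" and d: "\<And>(F :: nat set) lo hi. small_family I d F lo hi \<Longrightarrow> (\<Sum>k\<in>F. norm (g (hi k) - g (lo k))) < e"
    using abs_continuous_onD[OF assms(2) \<open>e > 0\<close>] by blast
  have "(\<Sum>k<n. norm (h (hi k) - h (lo k))) < e" if H: "small_family I d {..<n} lo hi" for n :: nat and lo hi
  proof -
    have "(\<Sum>k<n. norm (h (hi k) - h (lo k))) = (\<Sum>k<n. norm (g (hi k) - g (lo k)))"
      using small_familyD(4,5)[OF H] assms(1) by (intro sum.cong refl) auto
    with d[OF H] show ?thesis by simp
  qed
  with \<open>d > 0\<close> show "\<exists>d>0. \<forall>n lo hi. small_family I d {..<n::nat} lo hi \<longrightarrow>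
     (\<Sum>k<n. norm (h (hi k) - h (lo k))) < e" by blast
qed

lemma abs_continuous_on_subset:
  assumes g: "abs_continuous_on I g" and "J \<subseteq> I"
  shows "abs_continuous_on J g"
proof (rule abs_continuous_onI)
  fix e :: real assume "e > 0"
  obtain d where "d > 0" and d: "\<And>(F :: nat set) lo hi. small_family I d F lo hi \<Longrightarrow> (\<Sum>k\<in>F. norm (g (hi k) - g (lo k))) < e"
    using abs_continuous_onD[OF g \<open>e > 0\<close>] by blast
  have "small_family J d F lo hi \<Longrightarrow> small_family I d F lo hi" for F :: "nat set" and lo hi
    using \<open>J \<subseteq> I\<close> unfolding small_family_def by blast
  with \<open>d > 0\<close> d show "\<exists>d>0. \<forall>n lo hi. small_family J d {..<n::nat} lo hi \<longrightarrow>
     (\<Sum>k<n. norm (g (hi k) - g (lo k))) < e" by blast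
qed

lemma abs_continuous_on_lipschitz:
  assumes "\<And>s t. s \<in> I \<Longrightarrow> t \<in> I \<Longrightarrow> norm (g t - g s) \<le> L * \<bar>t - s\<bar>"
  shows "abs_continuous_on I g"
proof (rule abs_continuous_onI)
  fix e :: real assume "e > 0"
  define M where "M = max L 1"
  have "M > 0" "L \<le> M" by (auto simp: M_def)
  have "(\<Sum>k<n. norm (g (hi k) - g (lo k))) < e" if H: "small_family I (e / M) {..<n} lo hi" for n :: nat and lo hi
  proof -
    have "(\<Sum>k<n. norm (g (hi k) - g (lo k))) \<le> (\<Sum>k<n. M * (hi k - lo k))"
    proof (rule sum_mono)
      fix k assume k: "k \<in> {..<n}"
      have "norm (g (hi k) - g (lo k)) \<le> L * (hi k - lo k)"
        using assms[OF small_familyD(4,5)[OF H k]] small_familyD(2)[OF H k] by simp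
      also have "\<dots> \<le> M * (hi k - lo k)" using small_familyD(2)[OF H k] \<open>L \<le> M\<close> by (intro mult_right_mono) auto
      finally show "norm (g (hi k) - g (lo k)) \<le> M * (hi k - lo k)" .
    qed
    also have "\<dots> = M * (\<Sum>k<n. hi k - lo k)" by (simp add: sum_distrib_left)
    also have "\<dots> < M * (e / M)" using small_familyD(7)[OF H] \<open>M > 0\<close> by (intro mult_strict_left_mono) auto
    finally show ?thesis using \<open>M > 0\<close> by simp
  qed
  moreover have "e / M > 0" using \<open>e > 0\<close> \<open>M > 0\<close> by simp
  ultimately show "\<exists>d>0. \<forall>n lo hi. small_family I d {..<n::nat} lo hi \<longrightarrow>
     (\<Sum>k<n. norm (g (hi k) - g (lo k))) < e" by blast
qed

lemma abs_continuous_on_affine: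
  assumes g: "abs_continuous_on {a..b} g" and c: "c > 0" "c * u + w \<ge> a" "c * v + w \<le> b"
  shows "abs_continuous_on {u..v} (\<lambda>t. g (c * t + w))"
proof (rule abs_continuous_onI)
  fix e :: real assume "e > 0"
  obtain d where "d > 0" and d: "\<And>(F :: nat set) lo hi. small_family {a..b} d F lo hi \<Longrightarrow> (\<Sum>k\<in>F. norm (g (hi k) - g (lo k))) < e"
    using abs_continuous_onD[OF g \<open>e > 0\<close>] by blast
  have "(\<Sum>k<n. norm (g (c * hi k + w) - g (c * lo k + w))) < e"
    if H: "small_family {u..v} (d / c) {..<n} lo hi" for n :: nat and lo hi
  proof (rule d, unfold small_family_def, intro conjI ballI impI)
    fix k assume k: "k \<in> {..<n}"
    have pq: "lo k \<le> hi k" "u \<le> lo k" "hi k \<le> v" using small_familyD(2,4,5)[OF H k] by auto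
    then show "c * lo k + w \<le> c * hi k + w" using c by simp
    have "c * u \<le> c * lo k" "c * hi k \<le> c * v" using pq c by auto
    then have "a \<le> c * lo k + w" "c * hi k + w \<le> b" using c by linarith+
    then show "{c * lo k + w..c * hi k + w} \<subseteq> {a..b}" by auto
  next
    fix j k assume jk: "j \<in> {..<n}" "k \<in> {..<n}" "j \<noteq> k"
    show "{c * lo j + w<..<c * hi j + w} \<inter> {c * lo k + w<..<c * hi k + w} = {}"
    proof (rule ccontr)
      assume "\<not> ?thesis"
      then obtain s where "s \<in> {c * lo j + w<..<c * hi j + w} \<inter> {c * lo k + w<..<c * hi k + w}" by blast
      then have "(s - w) / c \<in> {lo j<..<hi j} \<inter> {lo k<..<hi k}"
        using c by (auto simp: field_simps)
      with small_familyD(6)[OF H jk] show False by simp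
    qed
  next
    have "(\<Sum>k<n. (c * hi k + w) - (c * lo k + w)) = c * (\<Sum>k<n. hi k - lo k)"
      by (simp add: sum_distrib_left right_diff_distrib)
    also have "\<dots> < d" using small_familyD(7)[OF H] c by (simp add: field_simps)
    finally show "(\<Sum>k<n. (c * hi k + w) - (c * lo k + w)) < d" .
  qed simp
  moreover have "d / c > 0" using \<open>d > 0\<close> c by simp
  ultimately show "\<exists>d>0. \<forall>n lo hi. small_family {u..v} d {..<n::nat} lo hi \<longrightarrow>
     (\<Sum>k<n. norm (g (c * hi k + w) - g (c * lo k + w))) < e" by blast
qed

lemma abs_continuous_on_reflect:
  assumes g: "abs_continuous_on {a..b} g"
  shows "abs_continuous_on {-b..-a} (\<lambda>t. g (- t))"
proof (rule abs_continuous_onI)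
  fix e :: real assume "e > 0"
  obtain d where "d > 0" and d: "\<And>(F :: nat set) lo hi. small_family {a..b} d F lo hi \<Longrightarrow> (\<Sum>k\<in>F. norm (g (hi k) - g (lo k))) < e"
    using abs_continuous_onD[OF g \<open>e > 0\<close>] by blast
  have "(\<Sum>k<n. norm (g (- hi k) - g (- lo k))) < e"
    if H: "small_family {-b..-a} d {..<n} lo hi" for n :: nat and lo hi
  proof -
    have "(\<Sum>k<n. norm (g (- lo k) - g (- hi k))) < e"
    proof (rule d, unfold small_family_def, intro conjI ballI impI)
      fix k assume k: "k \<in> {..<n}"
      then show "- hi k \<le> - lo k" "{- hi k..- lo k} \<subseteq> {a..b}" using small_familyD(2,4,5)[OF H k] by auto
    next
      fix j k assume jk: "j \<in> {..<n}" "k \<in> {..<n}" "j \<noteq> k"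
      show "{- hi j<..<- lo j} \<inter> {- hi k<..<- lo k} = {}"
      proof (rule ccontr)
        assume "\<not> ?thesis"
        then obtain s where "s \<in> {- hi j<..<- lo j} \<inter> {- hi k<..<- lo k}" by blast
        then have "- s \<in> {lo j<..<hi j} \<inter> {lo k<..<hi k}" by auto
        with small_familyD(6)[OF H jk] show False by simp
      qed
    qed (use small_familyD(7)[OF H] in auto)
    then show ?thesis by (simp add: norm_minus_commute)
  qed
  with \<open>d > 0\<close> show "\<exists>d>0. \<forall>n lo hi. small_family {-b..-a} d {..<n::nat} lo hi \<longrightarrow>
     (\<Sum>k<n. norm (g (- hi k) - g (- lo k))) < e" by blast
qed

text \<open>Every interval is cut at m by clamping its endpoints with \<open>min\<close> and
  \<open>max\<close>; a part on the wrong side of m degenerates to a point and contributes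
  nothing.\<close>

lemma abs_continuous_on_join:
  assumes l: "abs_continuous_on {a..m} g" and r: "abs_continuous_on {m..b} g" and m: "a \<le> m" "m \<le> b"
  shows "abs_continuous_on {a..b} g"
proof (rule abs_continuous_onI)
  fix e :: real assume "e > 0"
  then have "e / 2 > 0" by simp
  obtain d1 where "d1 > 0" and d1: "\<And>(F :: nat set) lo hi. small_family {a..m} d1 F lo hi \<Longrightarrow> (\<Sum>k\<in>F. norm (g (hi k) - g (lo k))) < e / 2"
    using abs_continuous_onD[OF l \<open>e / 2 > 0\<close>] by blast
  obtain d2 where "d2 > 0" and d2: "\<And>(F :: nat set) lo hi. small_family {m..b} d2 F lo hi \<Longrightarrow> (\<Sum>k\<in>F. norm (g (hi k) - g (lo k))) < e / 2"
    using abs_continuous_onD[OF r \<open>e / 2 > 0\<close>] by blast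
  have "(\<Sum>k<n. norm (g (q k) - g (p k))) < e"
    if H: "small_family {a..b} (min d1 d2) {..<n} p q" for n :: nat and p q
  proof -
    have pq: "p k \<le> q k" "a \<le> p k" "q k \<le> b" if "k < n" for k
      using small_familyD(2,4,5)[OF H, of k] that by auto
    note disj = small_familyD(6)[OF H]
    have "(\<Sum>k<n. norm (g (min (q k) m) - g (min (p k) m))) < e / 2"
    proof (rule d1, unfold small_family_def, intro conjI ballI impI)
      fix j k assume jk: "j \<in> {..<n}" "k \<in> {..<n}" "j \<noteq> k"
      have "{min (p i) m<..<min (q i) m} \<subseteq> {p i<..<q i}" for i by auto
      then show "{min (p j) m<..<min (q j) m} \<inter> {min (p k) m<..<min (q k) m} = {}"
        using disj[OF jk] by blast
    next
      have "(\<Sum>k<n. min (q k) m - min (p k) m) \<le> (\<Sum>k<n. q k - p k)"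
      proof (rule sum_mono)
        fix k assume "k \<in> {..<n}"
        then show "min (q k) m - min (p k) m \<le> q k - p k" using pq[of k] by (auto simp: min_def)
      qed
      then show "(\<Sum>k<n. min (q k) m - min (p k) m) < d1" using small_familyD(7)[OF H] by simp
    next
      fix k assume "k \<in> {..<n}"
      then show "min (p k) m \<le> min (q k) m" "{min (p k) m..min (q k) m} \<subseteq> {a..m}"
        using pq[of k] m by auto
    qed simp
    moreover have "(\<Sum>k<n. norm (g (max (q k) m) - g (max (p k) m))) < e / 2"
    proof (rule d2, unfold small_family_def, intro conjI ballI impI)
      fix j k assume jk: "j \<in> {..<n}" "k \<in> {..<n}" "j \<noteq> k"
      have "{max (p i) m<..<max (q i) m} \<subseteq> {p i<..<q i}" for i by auto
      then show "{max (p j) m<..<max (q j) m} \<inter> {max (p k) m<..<max (q k) m} = {}"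
        using disj[OF jk] by blast
    next
      have "(\<Sum>k<n. max (q k) m - max (p k) m) \<le> (\<Sum>k<n. q k - p k)"
      proof (rule sum_mono)
        fix k assume "k \<in> {..<n}"
        then show "max (q k) m - max (p k) m \<le> q k - p k" using pq[of k] by (auto simp: max_def)
      qed
      then show "(\<Sum>k<n. max (q k) m - max (p k) m) < d2" using small_familyD(7)[OF H] by simp
    next
      fix k assume "k \<in> {..<n}"
      then show "max (p k) m \<le> max (q k) m" "{max (p k) m..max (q k) m} \<subseteq> {m..b}"
        using pq[of k] m by auto
    qed simp
    moreover have "(\<Sum>k<n. norm (g (q k) - g (p k)))
      \<le> (\<Sum>k<n. norm (g (min (q k) m) - g (min (p k) m)) + norm (g (max (q k) m) - g (max (p k) m)))"
    proof (rule sum_mono)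
      fix k assume k: "k \<in> {..<n}"
      consider "q k \<le> m" | "m \<le> p k" | "p k \<le> m" "m \<le> q k" by linarith
      then show "norm (g (q k) - g (p k))
        \<le> norm (g (min (q k) m) - g (min (p k) m)) + norm (g (max (q k) m) - g (max (p k) m))"
      proof cases
        case 3
        have "norm (g (q k) - g (p k)) \<le> norm (g m - g (p k)) + norm (g (q k) - g m)"
          using norm_triangle_ineq[of "g m - g (p k)" "g (q k) - g m"] by simp
        with 3 show ?thesis by (simp add: min_absorb1 min_absorb2 max_absorb1 max_absorb2)
      qed (use pq[of k] k in \<open>auto simp: min_def max_def\<close>)
    qed
    ultimately show ?thesis by (simp add: sum.distrib)
  qed
  moreover have "min d1 d2 > 0" using \<open>d1 > 0\<close> \<open>d2 > 0\<close> by simp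
  ultimately show "\<exists>d>0. \<forall>n lo hi. small_family {a..b} d {..<n::nat} lo hi \<longrightarrow>
     (\<Sum>k<n. norm (g (hi k) - g (lo k))) < e" by blast
qed

section \<open>The fundamental theorem for absolutely continuous functions\<close>

lemma negligible_interval_overlap:
  fixes u v u' v' :: real
  assumes "{u<..<v} \<inter> {u'<..<v'} = {}"
  shows "negligible ({u..v} \<inter> {u'..v'})"
proof -
  have "box (max u u') (min v v') = {}" using assms by (auto simp: box_real)
  then have "negligible (cbox (max u u') (min v v'))" by (simp only: negligible_interval)
  then show ?thesis by simp
qed

text \<open>A gauge argument. At tags off N, differentiability makes each Riemann term close to the
  increment of y. Intervals tagged in N are kept inside an open set of small measure, and absolute
  continuity bounds the sum of their increments.\<close>

theorem abs_continuous_has_integral: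
  fixes y :: "real \<Rightarrow> 'a::banach"
  assumes ac: "abs_continuous_on {a..b} y" and "a \<le> b" and N: "negligible N"
    and der: "\<And>t. t \<in> {a..b} - N \<Longrightarrow> (y has_vector_derivative y' t) (at t within {a..b})"
  shows "(y' has_integral y b - y a) {a..b}"
proof -
  \<comment> \<open>With value 0 on N, a cell tagged in N contributes only the increment of
    y.\<close>
  define z where "z t = (if t \<in> N then 0 else y' t)" for t
  have "(z has_integral y b - y a) {a..b}"
    unfolding has_integral_factor_content_real
  \<comment> \<open>The degenerate interval is separate because the tolerance \<open>e1\<close>
    below would vanish.\<close>
  proof (cases "a = b")
    case True
    have "norm ((\<Sum>(x, k)\<in>p. measure lborel k *\<^sub>R z x) - (y b - y a)) \<le> e * measure lborel {a..b}"
      if "p tagged_division_of {a..b}" for p and e :: real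
    proof -
      have "measure lborel k = 0" if "(x, k) \<in> p" for x k
      proof -
        have "k \<subseteq> {a}" using tagged_division_ofD(3)[OF \<open>p tagged_division_of {a..b}\<close> that] True by simp
        then have "k = {} \<or> k = {a}" by blast
        then show ?thesis by auto
      qed
      then have "(\<Sum>(x, k)\<in>p. measure lborel k *\<^sub>R z x) = 0" by (intro sum.neutral) auto
      then show ?thesis using True by simp
    qed
    then show "\<forall>e>0. \<exists>d. gauge d \<and> (\<forall>p. p tagged_division_of {a..b} \<and> d fine p \<longrightarrow>
      norm ((\<Sum>(x, k)\<in>p. measure lborel k *\<^sub>R z x) - (y b - y a)) \<le> e * measure lborel {a..b})"
      by (intro allI impI exI[of _ "\<lambda>x. ball x 1"] conjI gauge_trivial) blast
  next
    case False
    with \<open>a \<le> b\<close> have "a < b" by simp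
    show "\<forall>e>0. \<exists>d. gauge d \<and> (\<forall>p. p tagged_division_of {a..b} \<and> d fine p \<longrightarrow>
      norm ((\<Sum>(x, k)\<in>p. measure lborel k *\<^sub>R z x) - (y b - y a)) \<le> e * measure lborel {a..b})"
    proof (intro allI impI)
      fix e :: real assume "e > 0"
      \<comment> \<open>Half of the allowed error \<open>e * (b - a)\<close>: one half for the tags
        off N, the other for those in N.\<close>
      define e1 where "e1 = e / 2 * (b - a)"
      have "e1 > 0" using \<open>e > 0\<close> \<open>a < b\<close> by (simp add: e1_def)
      obtain d where "d > 0" and d: "\<And>(F :: (real \<times> real set) set) lo hi. small_family {a..b} d F lo hi
          \<Longrightarrow> (\<Sum>k\<in>F. norm (y (hi k) - y (lo k))) < e1"
        using abs_continuous_onD[OF ac \<open>e1 > 0\<close>] by blast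
      have "N \<in> sets lebesgue" using N negligible_imp_sets by blast
      then obtain U where U: "open U" "N \<subseteq> U" "U - N \<in> lmeasurable" "emeasure lebesgue (U - N) < ennreal d"
        using sets_lebesgue_outer_open[of N d] \<open>d > 0\<close> by blast
      have "N \<in> lmeasurable" using N negligible_imp_measurable by blast
      have "U = (U - N) \<union> N" using U(2) by blast
      then have Um: "U \<in> lmeasurable" using U(3) \<open>N \<in> lmeasurable\<close> fmeasurable.Un by metis
      have "measure lebesgue ((U - N) \<union> N) \<le> measure lebesgue (U - N) + measure lebesgue N"
        using U(3) \<open>N \<in> lmeasurable\<close> by (intro measure_Un_le) (auto simp: fmeasurable_def)
      then have "measure lebesgue U \<le> measure lebesgue (U - N)"
        using \<open>U = (U - N) \<union> N\<close> negligible_imp_measure0[OF N] by simp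
      also have "\<dots> < d"
        using U(3,4) \<open>d > 0\<close> by (simp add: emeasure_eq_measure2 ennreal_less_iff)
      finally have Ud: "measure lebesgue U < d" .
      have "\<exists>r>0. (t \<in> N \<longrightarrow> ball t r \<subseteq> U) \<and> (t \<in> {a..b} - N \<longrightarrow>
         (\<forall>s\<in>{a..b}. norm (s - t) < r \<longrightarrow> norm (y s - y t - (s - t) *\<^sub>R z t) \<le> e / 2 * norm (s - t)))" for t
      proof (cases "t \<in> N")
        case True
        then obtain r where "r > 0" "ball t r \<subseteq> U" using U(1,2) unfolding open_contains_ball by blast
        with True show ?thesis by blast
      next
        case nN: False
        show ?thesis
        proof (cases "t \<in> {a..b}")
          case True
          have "(y has_vector_derivative z t) (at t within {a..b})" using der[of t] True nN by (simp add: z_def)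
          then have "\<forall>e>0. \<exists>r>0. \<forall>s\<in>{a..b}. norm (s - t) < r \<longrightarrow> norm (y s - y t - (s - t) *\<^sub>R z t) \<le> e * norm (s - t)"
            unfolding has_vector_derivative_def has_derivative_within_alt by blast
          then obtain r where "r > 0" "\<forall>s\<in>{a..b}. norm (s - t) < r \<longrightarrow> norm (y s - y t - (s - t) *\<^sub>R z t) \<le> e / 2 * norm (s - t)"
            using \<open>e > 0\<close> half_gt_zero by blast
          with nN show ?thesis by blast
        next
          case False
          with nN show ?thesis using zero_less_one by blast
        qed
      qed
      then obtain r where r0: "\<And>t. r t > 0" and rU: "\<And>t. t \<in> N \<Longrightarrow> ball t (r t) \<subseteq> U"
        and rd: "\<And>t s. t \<in> {a..b} - N \<Longrightarrow> s \<in> {a..b} \<Longrightarrow> norm (s - t) < r t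
          \<Longrightarrow> norm (y s - y t - (s - t) *\<^sub>R z t) \<le> e / 2 * norm (s - t)"
        by metis
      show "\<exists>d. gauge d \<and> (\<forall>p. p tagged_division_of {a..b} \<and> d fine p \<longrightarrow>
        norm ((\<Sum>(x, k)\<in>p. measure lborel k *\<^sub>R z x) - (y b - y a)) \<le> e * measure lborel {a..b})"
      proof (intro exI[of _ "\<lambda>t. ball t (r t)"] conjI allI impI)
        show "gauge (\<lambda>t. ball t (r t))" using r0 gauge_ball_dependent by blast
        fix p assume "p tagged_division_of {a..b} \<and> (\<lambda>t. ball t (r t)) fine p"
        then have p: "p tagged_division_of {a..b}" and fine: "(\<lambda>t. ball t (r t)) fine p" by auto
        have fp: "finite p" using p by blast
        have kp: "\<exists>u v. u \<le> v \<and> K = {u..v} \<and> x \<in> K \<and> K \<subseteq> {a..b} \<and> K \<subseteq> ball x (r x)" if xK: "(x, K) \<in> p" for x K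
        proof -
          obtain u v where uv: "K = cbox u v" using tagged_division_ofD(4)[OF p xK] by blast
          have "x \<in> K" "K \<subseteq> {a..b}" using tagged_division_ofD(2,3)[OF p xK] by auto
          moreover have "K \<subseteq> ball x (r x)" using fine xK by (auto simp: fine_def)
          ultimately show ?thesis using uv by (intro exI[of _ u] exI[of _ v]) auto
        qed
        let ?T = "\<lambda>(x, K). measure lborel K *\<^sub>R z x - (y (Sup K) - y (Inf K))"
        define q where "q = {w \<in> p. fst w \<in> N}"
        have "q \<subseteq> p" "finite q" using fp by (auto simp: q_def)
        have kq: "\<exists>u v. u \<le> v \<and> snd w = {u..v} \<and> snd w \<subseteq> {a..b} \<and> snd w \<subseteq> ball (fst w) (r (fst w))" if "w \<in> q" for w
        proof -
          have "(fst w, snd w) \<in> p" using that \<open>q \<subseteq> p\<close> by auto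
          from kp[OF this] show ?thesis by blast
        qed
        have sums: "(\<Sum>(x,K)\<in>p. y (Sup K) - y (Inf K)) = y b - y a" "(\<Sum>(x,K)\<in>p. Sup K - Inf K) = b - a"
          using additive_tagged_division_1[OF \<open>a \<le> b\<close> p, of y]
            additive_tagged_division_1[OF \<open>a \<le> b\<close> p, of "\<lambda>x. x"] by auto
        have "(\<Sum>(x, k)\<in>p. measure lborel k *\<^sub>R z x) - (y b - y a) = (\<Sum>w\<in>p. ?T w)"
          unfolding sums(1)[symmetric] by (simp add: sum_subtractf case_prod_unfold)
        also have "\<dots> = (\<Sum>w\<in>p - q. ?T w) + (\<Sum>w\<in>q. ?T w)"
          using sum.subset_diff[OF \<open>q \<subseteq> p\<close> fp] by simp
        finally have eq: "(\<Sum>(x, k)\<in>p. measure lborel k *\<^sub>R z x) - (y b - y a) = (\<Sum>w\<in>p - q. ?T w) + (\<Sum>w\<in>q. ?T w)" .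
        have "norm (\<Sum>w\<in>p - q. ?T w) \<le> (\<Sum>w\<in>p - q. e / 2 * (case w of (x, K) \<Rightarrow> Sup K - Inf K))"
        proof (rule sum_norm_le)
          fix w assume w: "w \<in> p - q"
          obtain x K where xK: "w = (x, K)" by (cases w)
          then have "x \<notin> N" using w by (auto simp: q_def)
          obtain u v where uv: "u \<le> v" "K = {u..v}" "x \<in> K" "K \<subseteq> {a..b}" "K \<subseteq> ball x (r x)" using kp w xK by blast
          have x: "x \<in> {a..b} - N" using uv \<open>x \<notin> N\<close> by blast
          have mem: "u \<in> K" "v \<in> K" using uv by auto
          then have near: "norm (u - x) < r x" "norm (v - x) < r x" "u \<in> {a..b}" "v \<in> {a..b}"
            using uv(4,5) by (auto simp: dist_norm norm_minus_commute subset_iff)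
          have nu: "norm (y u - y x - (u - x) *\<^sub>R z x) \<le> e / 2 * norm (u - x)"
            using near by (intro rd x)
          have nv: "norm (y v - y x - (v - x) *\<^sub>R z x) \<le> e / 2 * norm (v - x)"
            using near by (intro rd x)
          have split: "(v - u) *\<^sub>R z x - (y v - y u) = (y u - y x - (u - x) *\<^sub>R z x) - (y v - y x - (v - x) *\<^sub>R z x)"
            by (simp add: algebra_simps)
          have "norm ((v - u) *\<^sub>R z x - (y v - y u)) \<le> e / 2 * norm (u - x) + e / 2 * norm (v - x)"
            unfolding split by (rule order_trans[OF norm_triangle_ineq4 add_mono[OF nu nv]])
          also have "\<dots> = e / 2 * (norm (u - x) + norm (v - x))" by (simp only: distrib_left)
          also have "norm (u - x) + norm (v - x) = v - u" using uv by auto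
          finally show "norm (?T w) \<le> e / 2 * (case w of (x, K) \<Rightarrow> Sup K - Inf K)"
            using uv xK by simp
        qed
        also have "\<dots> \<le> (\<Sum>w\<in>p. e / 2 * (case w of (x, K) \<Rightarrow> Sup K - Inf K))"
        proof (rule sum_mono2[OF fp])
          fix w assume "w \<in> p - (p - q)"
          then obtain x K where "w = (x, K)" "(x, K) \<in> p" by (cases w) auto
          with kp[of x K] \<open>e > 0\<close> show "0 \<le> e / 2 * (case w of (x, K) \<Rightarrow> Sup K - Inf K)" by auto
        qed blast
        also have "\<dots> = e1" unfolding sum_distrib_left[symmetric] sums(2) e1_def ..
        finally have good: "norm (\<Sum>w\<in>p - q. ?T w) \<le> e1" .
        have "norm (\<Sum>w\<in>q. ?T w) \<le> (\<Sum>w\<in>q. norm (y (Sup (snd w)) - y (Inf (snd w))))"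
          by (rule sum_norm_le) (auto simp: q_def z_def norm_minus_commute)
        \<comment> \<open>The cells tagged in N have disjoint interiors and lie in U, so their total
          length is below d and they form a small family.\<close>
        also have "\<dots> < e1"
        proof (rule d, unfold small_family_def, intro conjI ballI impI)
          show "finite q" by fact
        next
          fix w assume "w \<in> q"
          then show "Inf (snd w) \<le> Sup (snd w)" "{Inf (snd w)..Sup (snd w)} \<subseteq> {a..b}"
            using kq[of w] \<open>q \<subseteq> p\<close> by auto
        next
          fix w w' assume ww: "w \<in> q" "w' \<in> q" "w \<noteq> w'"
          have "interior (snd w) \<inter> interior (snd w') = {}"
            using tagged_division_ofD(5)[OF p, of "fst w" "snd w" "fst w'" "snd w'"] ww \<open>q \<subseteq> p\<close>
            by (auto simp: prod_eq_iff)
          moreover obtain u v u' v' where "snd w = {u..v}" "snd w' = {u'..v'}" "u \<le> v" "u' \<le> v'"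
            using kq[of w] kq[of w'] ww \<open>q \<subseteq> p\<close> by fastforce
          ultimately show "{Inf (snd w)<..<Sup (snd w)} \<inter> {Inf (snd w')<..<Sup (snd w')} = {}"
            by (simp add: interior_atLeastAtMost_real)
        next
          have "(\<Sum>w\<in>q. Sup (snd w) - Inf (snd w)) = (\<Sum>w\<in>q. measure lebesgue (snd w))"
          proof (intro sum.cong refl)
            fix w assume "w \<in> q"
            then show "Sup (snd w) - Inf (snd w) = measure lebesgue (snd w)"
              using kq[of w] \<open>q \<subseteq> p\<close> by auto
          qed
          also have "\<dots> = measure lebesgue (\<Union>(snd ` q))"
          proof (rule measure_negligible_finite_Union_image[symmetric, OF \<open>finite q\<close>])
            fix w assume "w \<in> q"
            then obtain u v where "snd w = {u..v}" using kq[of w] \<open>q \<subseteq> p\<close> by auto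
            then show "snd w \<in> lmeasurable" by simp
          next
            show "pairwise (\<lambda>w w'. negligible (snd w \<inter> snd w')) q"
              unfolding pairwise_def
            proof (intro ballI impI)
              fix w w' assume ww: "w \<in> q" "w' \<in> q" "w \<noteq> w'"
              have "interior (snd w) \<inter> interior (snd w') = {}"
                using tagged_division_ofD(5)[OF p, of "fst w" "snd w" "fst w'" "snd w'"] ww \<open>q \<subseteq> p\<close>
                by (auto simp: prod_eq_iff)
              moreover obtain u v u' v' where "snd w = {u..v}" "snd w' = {u'..v'}"
                using kq[of w] kq[of w'] ww \<open>q \<subseteq> p\<close> by fastforce
              ultimately show "negligible (snd w \<inter> snd w')"
                using negligible_interval_overlap by (simp add: interior_atLeastAtMost_real)
            qed
          qed
          also have "\<dots> \<le> measure lebesgue U"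
          proof (rule measure_mono_fmeasurable[OF _ _ Um])
            show "\<Union>(snd ` q) \<subseteq> U"
            proof
              fix s assume "s \<in> \<Union>(snd ` q)"
              then obtain w where w: "w \<in> q" "s \<in> snd w" by blast
              then have "snd w \<subseteq> ball (fst w) (r (fst w))" using kq[of w] \<open>q \<subseteq> p\<close> by auto
              moreover have "ball (fst w) (r (fst w)) \<subseteq> U" using w rU by (auto simp: q_def)
              ultimately show "s \<in> U" using w by blast
            qed
            have "snd w \<in> sets lebesgue" if wq: "w \<in> q" for w
            proof -
              obtain u v where "snd w = {u..v}" using kq[of w] \<open>q \<subseteq> p\<close> wq by auto
              then show ?thesis by simp
            qed
            then show "\<Union>(snd ` q) \<in> sets lebesgue" using \<open>finite q\<close> by (intro sets.finite_UN) auto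
          qed
          also have "\<dots> < d" by fact
          finally show "(\<Sum>w\<in>q. Sup (snd w) - Inf (snd w)) < d" .
        qed
        finally have bad: "norm (\<Sum>w\<in>q. ?T w) \<le> e1" by simp
        have "norm ((\<Sum>(x, k)\<in>p. measure lborel k *\<^sub>R z x) - (y b - y a)) \<le> e1 + e1"
          unfolding eq using norm_triangle_ineq good bad add_mono order_trans by blast
        also have "\<dots> = e * measure lborel {a..b}" using \<open>a \<le> b\<close> by (simp add: e1_def field_simps)
        finally show "norm ((\<Sum>(x, k)\<in>p. measure lborel k *\<^sub>R z x) - (y b - y a)) \<le> e * measure lborel {a..b}" .
      qed
    qed
  qed
  then show ?thesis
    by (rule has_integral_spike[OF N, rotated]) (simp add: z_def)
qed

section \<open>Support functions of D and the potential formula on arbitrary intervals\<close>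

lemma SUP_eq_maximum:
  fixes f :: "'a \<Rightarrow> real"
  assumes "v \<in> K" "\<And>w. w \<in> K \<Longrightarrow> f w \<le> f v"
  shows "(SUP w\<in>K. f w) = f v"
  using assms by (intro cSup_eq_maximum) auto

lemma compact_inner_attains:
  fixes K :: "('a::euclidean_space) set"
  assumes "compact K" "K \<noteq> {}"
  obtains v where "v \<in> K" "\<And>w. w \<in> K \<Longrightarrow> u \<bullet> w \<le> u \<bullet> v"
proof -
  have "continuous_on K (\<lambda>w. u \<bullet> w)" by (intro continuous_intros)
  from continuous_attains_sup[OF assms this] show thesis using that by blast
qed

lemma SUP_inner_scale:
  fixes K :: "('a::euclidean_space) set"
  assumes K: "compact K" "K \<noteq> {}" and "c \<ge> 0"
  shows "(SUP w\<in>K. (c *\<^sub>R u) \<bullet> w) = c * (SUP w\<in>K. u \<bullet> w)"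
proof -
  obtain v where v: "v \<in> K" "\<And>w. w \<in> K \<Longrightarrow> u \<bullet> w \<le> u \<bullet> v" using compact_inner_attains[OF K] by blast
  have "(SUP w\<in>K. (c *\<^sub>R u) \<bullet> w) = (c *\<^sub>R u) \<bullet> v"
    using v \<open>c \<ge> 0\<close> by (intro SUP_eq_maximum) (auto intro: mult_left_mono)
  then show ?thesis using SUP_eq_maximum[of v K "\<lambda>w. u \<bullet> w"] v by simp
qed

lemma vector_derivative_local:
  assumes "open U" "t \<in> U" "\<And>s. s \<in> U \<Longrightarrow> g s = h s"
  shows "vector_derivative g (at t) = vector_derivative h (at t)"
proof -
  have "(g has_vector_derivative v) (at t) \<longleftrightarrow> (h has_vector_derivative v) (at t)" for v
    using has_vector_derivative_transform_within_open[of g v t U h]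
      has_vector_derivative_transform_within_open[of h v t U g] assms by auto
  then show ?thesis unfolding vector_derivative_def by simp
qed

lemma support_integrand_eqI:
  assumes "vector_derivative \<gamma> (at t) = vector_derivative \<eta> (at s)" "\<gamma> t = \<eta> s"
  shows "support_integrand D \<gamma> t = support_integrand D \<eta> s"
  using assms by (simp add: support_integrand_def)

locale set_valued_potential =
  fixes D :: "real ^ 'p::finite \<Rightarrow> (real ^ 'p) set" and f :: "real ^ 'p \<Rightarrow> real"
  assumes potential: "potential_of f D"
    and D_ne: "D z \<noteq> {}" and D_compact: "compact (D z)"
begin

text \<open>The path is preceded by the segment from the origin; comparison with the path that stays at its
  starting point afterwards cancels the contribution of that segment.\<close>

lemma potential_along_path:
  assumes ac: "abs_continuous_on {a..b} y" and "a < b" and N: "negligible N"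
    and der: "\<And>t. t \<in> {a<..<b} - N \<Longrightarrow> \<exists>v. (y has_vector_derivative v) (at t)"
  shows "(support_integrand D y has_integral f (y b) - f (y a)) {a..b}"
proof -
  \<comment> \<open>k and w are the coefficients of the affine map from [1/2, 1] onto
    [a, b].\<close>
  define k where "k = 2 * (b - a)"
  have "k > 0" using \<open>a < b\<close> by (simp add: k_def)
  define w where "w = a - (b - a)"
  define \<gamma> where "\<gamma> t = (if t \<le> 1/2 then (2 * t) *\<^sub>R y a else y (k * t + w))" for t
  define \<eta> where "\<eta> t = (if t \<le> 1/2 then (2 * t) *\<^sub>R y a else y a)" for t
  have half: "k * (1/2) + w = a" "k * 1 + w = b" by (auto simp: k_def w_def field_simps)
  have seg: "abs_continuous_on {0..1/2} (\<lambda>t. (2 * t) *\<^sub>R y a)"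
  proof (rule abs_continuous_on_lipschitz[where L = "2 * norm (y a)"])
    fix s t :: real
    have "norm ((2 * t) *\<^sub>R y a - (2 * s) *\<^sub>R y a) = \<bar>2 * t - 2 * s\<bar> * norm (y a)"
      by (simp only: scaleR_left_diff_distrib[symmetric] norm_scaleR)
    also have "\<bar>2 * t - 2 * s\<bar> = 2 * \<bar>t - s\<bar>" by (simp add: abs_if)
    finally show "norm ((2 * t) *\<^sub>R y a - (2 * s) *\<^sub>R y a) \<le> 2 * norm (y a) * \<bar>t - s\<bar>"
      by simp
  qed
  have ac\<gamma>: "abs_continuous_on {0..1} \<gamma>"
  proof (rule abs_continuous_on_join[of 0 "1/2"])
    show "abs_continuous_on {0..1/2} \<gamma>"
      by (rule abs_continuous_on_cong[OF _ seg]) (simp add: \<gamma>_def)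
    have "abs_continuous_on {1/2..1} (\<lambda>t. y (k * t + w))"
      by (rule abs_continuous_on_affine[OF ac \<open>k > 0\<close>]) (use half in auto)
    then show "abs_continuous_on {1/2..1} \<gamma>"
    proof (rule abs_continuous_on_cong[rotated])
      fix t :: real assume t: "t \<in> {1/2..1}"
      show "y (k * t + w) = \<gamma> t"
      proof (cases "t = 1/2")
        case True
        show ?thesis unfolding True \<gamma>_def half(1) by simp
      next
        case False
        with t show ?thesis by (simp add: \<gamma>_def)
      qed
    qed
  qed auto
  have ac\<eta>: "abs_continuous_on {0..1} \<eta>"
  proof (rule abs_continuous_on_join[of 0 "1/2"])
    show "abs_continuous_on {0..1/2} \<eta>"
      by (rule abs_continuous_on_cong[OF _ seg]) (simp add: \<eta>_def)
    show "abs_continuous_on {1/2..1} \<eta>"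
    proof (rule abs_continuous_on_lipschitz[where L = 0])
      fix s t :: real assume "s \<in> {1/2..1}" "t \<in> {1/2..1}"
      moreover have "\<eta> r = y a" if "r \<in> {1/2..1}" for r
      proof (cases "r = 1/2")
        case True
        show ?thesis unfolding True \<eta>_def by simp
      next
        case False
        with that show ?thesis by (simp add: \<eta>_def)
      qed
      ultimately show "norm (\<eta> t - \<eta> s) \<le> 0 * \<bar>t - s\<bar>" by simp
    qed
  qed auto
  have ends: "\<gamma> 0 = 0" "\<gamma> 1 = y b" "\<eta> 0 = 0" "\<eta> 1 = y a"
    using half(2) by (simp_all add: \<gamma>_def \<eta>_def)
  have I\<gamma>: "(support_integrand D \<gamma> has_integral f (y b) - f 0) {0..1}"
    using potential ac\<gamma> ends(1,2) unfolding potential_of_def by blast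
  have I\<eta>: "(support_integrand D \<eta> has_integral f (y a) - f 0) {0..1}"
    using potential ac\<eta> ends(3,4) unfolding potential_of_def by blast
  define J where "J = integral {0..1/2} (support_integrand D \<gamma>)"
  have \<gamma>l: "support_integrand D \<gamma> integrable_on {0..1/2}" and \<gamma>r: "support_integrand D \<gamma> integrable_on {1/2..1}"
    and \<eta>r: "support_integrand D \<eta> integrable_on {1/2..1}"
    by (rule integrable_subinterval_real[OF has_integral_integrable[OF I\<gamma>]]
        integrable_subinterval_real[OF has_integral_integrable[OF I\<eta>]]; simp)+
  have zero: "(support_integrand D \<eta> has_integral 0) {1/2..1}"
  proof (rule has_integral_spike_finite[of "{1/2}"])
    show "((\<lambda>_. 0) has_integral 0) {1/2..1::real}" by simp
    fix t :: real assume t: "t \<in> {1/2..1} - {1/2}"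
    then have "vector_derivative \<eta> (at t) = vector_derivative (\<lambda>_. y a) (at t)"
      by (intro vector_derivative_local[of "{1/2<..}"]) (auto simp: \<eta>_def)
    then show "support_integrand D \<eta> t = 0" using D_ne by (simp add: support_integrand_def)
  qed simp
  \<comment> \<open>On the first half the two paths coincide, except that their derivatives may
    differ at 1/2.\<close>
  have eqJ: "integral {0..1/2} (support_integrand D \<eta>) = J"
    unfolding J_def
  proof (rule integral_spike[of "{1/2}"])
    fix t :: real assume t: "t \<in> {0..1/2} - {1/2}"
    show "support_integrand D \<gamma> t = support_integrand D \<eta> t"
    proof (rule support_integrand_eqI)
      show "vector_derivative \<gamma> (at t) = vector_derivative \<eta> (at t)"
        using t by (intro vector_derivative_local[of "{..<1/2}"]) (auto simp: \<gamma>_def \<eta>_def)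
    qed (use t in \<open>auto simp: \<gamma>_def \<eta>_def\<close>)
  qed simp
  have "J + integral {1/2..1} (support_integrand D \<gamma>) = f (y b) - f 0"
    using Henstock_Kurzweil_Integration.integral_combine[where a = 0 and c = "1/2" and b = 1 and f = "support_integrand D \<gamma>"] I\<gamma> unfolding J_def
    by (auto simp: has_integral_iff)
  moreover have "J + integral {1/2..1} (support_integrand D \<eta>) = f (y a) - f 0"
    using Henstock_Kurzweil_Integration.integral_combine[where a = 0 and c = "1/2" and b = 1 and f = "support_integrand D \<eta>"] I\<eta> unfolding eqJ[symmetric]
    by (auto simp: has_integral_iff)
  ultimately have "integral {1/2..1} (support_integrand D \<gamma>) = f (y b) - f (y a)"
    using zero by (simp add: has_integral_iff)
  with \<gamma>r have right: "(support_integrand D \<gamma> has_integral f (y b) - f (y a)) {1/2..1}"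
    by (simp add: has_integral_iff)
  define m where "m = 1 / k"
  have "m > 0" using \<open>k > 0\<close> by (simp add: m_def)
  have img: "(\<lambda>x. (1 / m) *\<^sub>R x + - ((1 / m) *\<^sub>R (- w / k))) ` cbox (1/2) 1 = {a..b}"
  proof -
    have "(\<lambda>x. (1 / m) *\<^sub>R x + - ((1 / m) *\<^sub>R (- w / k))) = (\<lambda>x. k * x + w)"
      using \<open>k > 0\<close> by (auto simp: m_def)
    moreover have "(\<lambda>x. k * x + w) ` cbox (1/2) 1 = {a..b}"
      using half \<open>k > 0\<close> by (simp add: image_affinity_atLeastAtMost)
    ultimately show ?thesis by (simp only:)
  qed
  have "((\<lambda>s. support_integrand D \<gamma> (m *\<^sub>R s + - w / k)) has_integral (1 / \<bar>m\<bar> ^ DIM(real)) *\<^sub>R (f (y b) - f (y a))) {a..b}"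
    unfolding img[symmetric]
    by (rule has_integral_affinity) (use right \<open>m > 0\<close> in auto)
  then have "((\<lambda>s. (1 / k) * support_integrand D \<gamma> (m *\<^sub>R s + - w / k)) has_integral (1 / k) * (k * (f (y b) - f (y a)))) {a..b}"
    using \<open>k > 0\<close> by (intro has_integral_mult_right) (simp add: m_def)
  then have "((\<lambda>s. (1 / k) * support_integrand D \<gamma> (m *\<^sub>R s + - w / k)) has_integral f (y b) - f (y a)) {a..b}"
    using \<open>k > 0\<close> by simp
  then show ?thesis
  proof (rule has_integral_spike[rotated 2])
    \<comment> \<open>The endpoints count as exceptional because two-sided derivatives are assumed
      only inside the interval.\<close>
    show "negligible (N \<union> {a, b})" using N by (simp add: negligible_Un)
    fix s assume s: "s \<in> {a..b} - (N \<union> {a, b})"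
    define t where "t = m *\<^sub>R s + - w / k"
    have st: "k * t + w = s" using \<open>k > 0\<close> by (simp add: t_def m_def field_simps)
    have "k * t + w > k * (1/2) + w" using s st half by auto
    then have t: "t > 1/2" using \<open>k > 0\<close> by simp
    obtain v where v: "(y has_vector_derivative v) (at s)" using der[of s] s by auto
    have "((\<lambda>t. k * t + w) has_vector_derivative k) (at t)"
      by (auto intro!: derivative_eq_intros)
    from vector_diff_chain_at[OF this, of y v] v st
    have "((\<lambda>t. y (k * t + w)) has_vector_derivative k *\<^sub>R v) (at t)" by (simp add: o_def)
    then have "(\<gamma> has_vector_derivative k *\<^sub>R v) (at t)"
      by (rule has_vector_derivative_transform_within_open[of _ _ _ "{1/2<..}"]) (use t in \<open>auto simp: \<gamma>_def\<close>)
    then have "vector_derivative \<gamma> (at t) = k *\<^sub>R v" by (rule vector_derivative_at)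
    moreover have "\<gamma> t = y s" using t st by (simp add: \<gamma>_def)
    ultimately have "support_integrand D \<gamma> t = k * support_integrand D y s"
      using SUP_inner_scale[OF D_compact D_ne, of k v "y s"] \<open>k > 0\<close> vector_derivative_at[OF v]
      by (simp add: support_integrand_def)
    then show "support_integrand D y s = (1 / k) * support_integrand D \<gamma> (m *\<^sub>R s + - w / k)"
      using \<open>k > 0\<close> by (simp add: t_def)
  qed
qed

text \<open>The integrand is minus the minimum of
  \<open>vector_derivative y (at t) \<bullet> v\<close> over D. Together with
  \<open>potential_along_path\<close>, which sees the maximum, it controls all values of this
  product.\<close>

lemma potential_along_reversed_path:
  assumes ac: "abs_continuous_on {a..b} y" and "a < b" and N: "negligible N"
    and der: "\<And>t. t \<in> {a<..<b} - N \<Longrightarrow> \<exists>v. (y has_vector_derivative v) (at t)"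
  shows "((\<lambda>t. SUP v\<in>D (y t). (- vector_derivative y (at t)) \<bullet> v) has_integral f (y a) - f (y b)) {a..b}"
proof -
  have refl: "((\<lambda>s. y (- s)) has_vector_derivative - v) (at (- t))" if "(y has_vector_derivative v) (at t)" for t v
  proof -
    have "(uminus has_vector_derivative - 1) (at (- t))" for t :: real
      using has_vector_derivative_minus[OF has_vector_derivative_id, of "at (- t)"] by simp
    from vector_diff_chain_at[OF this, of y v] that show ?thesis by (simp add: o_def)
  qed
  have "(support_integrand D (\<lambda>t. y (- t)) has_integral f (y (- (- a))) - f (y (- (- b)))) {-b..-a}"
  proof (rule potential_along_path[where N = "uminus ` N"])
    show "negligible (uminus ` N)"
      by (rule negligible_differentiable_image_negligible[OF _ N])
        (auto intro: differentiable_on_minus differentiable_on_id)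
    fix t assume t: "t \<in> {- b<..<- a} - uminus ` N"
    then have "- t \<in> {a<..<b} - N" by (auto simp: image_iff)
    then obtain v where "(y has_vector_derivative v) (at (- t))" using der by blast
    from refl[OF this] show "\<exists>v. ((\<lambda>t. y (- t)) has_vector_derivative v) (at t)" by auto
  qed (use abs_continuous_on_reflect[OF ac] \<open>a < b\<close> in auto)
  then have "((\<lambda>t. support_integrand D (\<lambda>t. y (- t)) (- t)) has_integral f (y a) - f (y b)) {a..b}"
    using has_integral_reflect_real[of "\<lambda>t. support_integrand D (\<lambda>t. y (- t)) (- t)" _ b a] by simp
  then show ?thesis
  proof (rule has_integral_spike[rotated 2])
    show "negligible (N \<union> {a, b})" using N by (simp add: negligible_Un)
    fix t assume t: "t \<in> {a..b} - (N \<union> {a, b})"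
    then obtain v where v: "(y has_vector_derivative v) (at t)" using der[of t] by auto
    then show "(SUP v\<in>D (y t). (- vector_derivative y (at t)) \<bullet> v) = support_integrand D (\<lambda>t. y (- t)) (- t)"
      using vector_derivative_at[OF v] vector_derivative_at[OF refl[OF v]] by (simp add: support_integrand_def)
  qed
qed

end

section \<open>Slopes and levels\<close>

lemma C1_imp_abs_continuous:
  fixes g :: "real \<Rightarrow> 'a::real_normed_vector"
  assumes der: "\<And>t. t \<in> {a..b} \<Longrightarrow> (g has_vector_derivative g' t) (at t)"
    and cont: "continuous_on {a..b} g'"
  shows "abs_continuous_on {a..b} g"
proof -
  have "bounded (g' ` {a..b})"
    by (intro compact_imp_bounded compact_continuous_image cont) simp
  then obtain M where M: "\<And>t. t \<in> {a..b} \<Longrightarrow> norm (g' t) \<le> M" unfolding bounded_iff by blast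
  show ?thesis
  proof (rule abs_continuous_on_lipschitz[where L = M])
    fix s t assume st: "s \<in> {a..b}" "t \<in> {a..b}"
    have "norm (g t - g s) \<le> M * norm (t - s)"
    proof (rule differentiable_bound[where S = "{a..b}" and f' = "\<lambda>t h. h *\<^sub>R g' t"])
      fix r assume r: "r \<in> {a..b}"
      show "(g has_derivative (\<lambda>h. h *\<^sub>R g' r)) (at r within {a..b})"
        using has_vector_derivative_at_within[OF der[OF r]] by (simp add: has_vector_derivative_def)
      show "onorm (\<lambda>h. h *\<^sub>R g' r) \<le> M"
      proof (rule onorm_le)
        fix k :: real
        have "\<bar>k\<bar> * norm (g' r) \<le> \<bar>k\<bar> * M" by (intro mult_left_mono M r) simp
        then show "norm (k *\<^sub>R g' r) \<le> M * norm k" by (simp add: mult.commute)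
      qed
    qed (use st in auto)
    then show "norm (g t - g s) \<le> M * \<bar>t - s\<bar>" by simp
  qed
qed

lemma integrand_eq_if_integral_linear:
  fixes \<phi> :: "real \<Rightarrow> real"
  assumes cont: "continuous_on {a..b} \<phi>"
    and int: "\<And>s. a < s \<Longrightarrow> s \<le> b \<Longrightarrow> (\<phi> has_integral c * (s - a)) {a..s}"
    and r: "a < r" "r < b"
  shows "\<phi> r = c"
proof -
  have at: "at r within {a..b} = at r" using r by (intro at_within_interior) auto
  have "((\<lambda>s. integral {a..s} \<phi>) has_real_derivative \<phi> r) (at r within {a..b})"
    using r by (intro integral_has_real_derivative cont) auto
  then have "((\<lambda>s. integral {a..s} \<phi>) has_real_derivative \<phi> r) (at r)" by (simp add: at)
  then have "((\<lambda>s. c * (s - a)) has_real_derivative \<phi> r) (at r)"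
    by (rule has_field_derivative_transform_within_open[where S = "{a<..<b}"])
      (use r int in \<open>auto simp: integral_unique\<close>)
  moreover have "((\<lambda>s. c * (s - a)) has_real_derivative c) (at r)"
    by (auto intro!: derivative_eq_intros)
  ultimately show ?thesis by (rule DERIV_unique)
qed

lemma finite_avoiding_interval:
  fixes r :: real
  assumes "finite Q" "r \<notin> Q"
  obtains e where "e > 0" "{r - e..r + e} \<inter> Q = {}"
proof -
  have "open (- Q)" using assms(1) finite_imp_closed by blast
  then obtain e where e: "e > 0" "ball r e \<subseteq> - Q" using assms(2) by (meson ComplI open_contains_ball)
  have "{r - e/2..r + e/2} \<inter> Q = {}"
  proof -
    have "{r - e/2..r + e/2} \<subseteq> ball r e" using e(1) by (auto simp: dist_real_def)
    then show ?thesis using e(2) by blast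
  qed
  then show ?thesis using that[of "e/2"] e(1) by simp
qed

lemma interval_subset_if_frontier:
  fixes a b :: real
  assumes "{a..b} \<inter> frontier A = {}" "a \<in> A" "a \<le> b"
  shows "{a..b} \<subseteq> A"
proof -
  have "{a..b} \<inter> A \<noteq> {}" using assms(2,3) by auto
  then show ?thesis using connected_Int_frontier[OF connected_Icc, of a b A] assms(1) by blast
qed

section \<open>Slopes, level curves and the desingularising function\<close>

locale definable_potential = ominimal S + set_valued_potential D f
  for S :: "nat \<Rightarrow> real list set set"
    and D :: "real ^ 'p::finite \<Rightarrow> (real ^ 'p) set" and f :: "real ^ 'p \<Rightarrow> real" +
  assumes definable_D: "definable_setvalued S D" and definable_f: "definable_fun S f"
begin

lemma definable_mem_D:
  assumes "\<And>i. definable_term cs (\<lambda>e. z e $ i)" "\<And>i. definable_term cs (\<lambda>e. v e $ i)"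
  shows "definable cs (\<lambda>e. v e \<in> D (z e))"
proof (rule definable_prod_subst[where P = "\<lambda>z v. v \<in> D z"])
  show "definable (vec_coords \<otimes> vec_coords) (\<lambda>p. snd p \<in> D (fst p))"
    unfolding definable_def
  proof (rule bexI)
    show "{coords x @ coords v |x v. v \<in> D x} \<in> S (length (vec_coords \<otimes> vec_coords :: ((real^'p) \<times> (real^'p) \<Rightarrow> real) list))"
      using definable_D by (simp add: definable_setvalued_def mult_2)
    show "\<forall>e. (snd e \<in> D (fst e)) = (map (\<lambda>c. c e) (vec_coords \<otimes> vec_coords) \<in> {coords x @ coords v |x v. v \<in> D x})"
      by (auto simp: map_prod_coords split_paired_all coords_inj)
  qed
qed (use assms in \<open>auto intro: vec_coords_terms\<close>)

lemma term_f:
  assumes "\<And>i. definable_term cs (\<lambda>e. z e $ i)"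
  shows "definable_term cs (\<lambda>e. f (z e))"
proof (rule term_subst[where ds = vec_coords])
  show "definable_term vec_coords f"
    unfolding definable_term_def definable_def
  proof (rule bexI)
    show "{coords x @ [f x] |x. True} \<in> S (length (vec_coords \<otimes> real_coords :: ((real^'p) \<times> real \<Rightarrow> real) list))"
      using definable_f by (simp add: definable_fun_def)
    show "\<forall>e. (snd e = f (fst e)) = (map (\<lambda>c. c e) (vec_coords \<otimes> real_coords) \<in> {coords x @ [f x] |x. True})"
      by (auto simp: map_prod_coords split_paired_all coords_inj)
  qed
qed (use assms in \<open>auto intro: vec_coords_terms\<close>)

text \<open>D has compact nonempty values, so the supremum is attained and is the unique value that
  bounds the products and is one of them, which is first-order.\<close>

lemma term_SUP_D:
  assumes z: "\<And>i. definable_term cs (\<lambda>e. z e $ i)" and u: "\<And>i. definable_term cs (\<lambda>e. u e $ i)"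
  shows "definable_term cs (\<lambda>e. SUP v\<in>D (z e). u e \<bullet> v)"
proof -
  have eq: "(\<lambda>p. snd p = (SUP v\<in>D (z (fst p)). u (fst p) \<bullet> v))
    = (\<lambda>p. (\<exists>v. v \<in> D (z (fst p)) \<and> u (fst p) \<bullet> v = snd p) \<and> (\<forall>v. v \<in> D (z (fst p)) \<longrightarrow> u (fst p) \<bullet> v \<le> snd p))"
  proof (intro ext iffI)
    fix p :: "'a \<times> real"
    obtain v where v: "v \<in> D (z (fst p))" "\<And>w. w \<in> D (z (fst p)) \<Longrightarrow> u (fst p) \<bullet> w \<le> u (fst p) \<bullet> v"
      using compact_inner_attains[OF D_compact D_ne] by blast
    have S: "(SUP v\<in>D (z (fst p)). u (fst p) \<bullet> v) = u (fst p) \<bullet> v" using v by (intro SUP_eq_maximum[of v _ "\<lambda>w. u (fst p) \<bullet> w"]) auto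
    show "(\<exists>v. v \<in> D (z (fst p)) \<and> u (fst p) \<bullet> v = snd p) \<and> (\<forall>v. v \<in> D (z (fst p)) \<longrightarrow> u (fst p) \<bullet> v \<le> snd p)"
      if "snd p = (SUP v\<in>D (z (fst p)). u (fst p) \<bullet> v)"
      using that v unfolding S by auto
    show "snd p = (SUP v\<in>D (z (fst p)). u (fst p) \<bullet> v)"
      if "(\<exists>v. v \<in> D (z (fst p)) \<and> u (fst p) \<bullet> v = snd p) \<and> (\<forall>v. v \<in> D (z (fst p)) \<longrightarrow> u (fst p) \<bullet> v \<le> snd p)"
      using that v unfolding S by (metis antisym)
  qed
  show ?thesis unfolding definable_term_def eq
    by (intro definable_conj definable_ex_vec definable_all_vec definable_imp definable_mem_D
        definable_eq definable_le term_inner term_fst term_snd term_vec term_real z u)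
qed

text \<open>For \<^term>\<open>0 \<le> s\<close>, separation shows that \<open>slope_le z s\<close> says that the convex hull of \<^term>\<open>D z\<close>
  meets the ball of radius \<^term>\<open>s\<close>; this form needs no quantification over convex combinations.\<close>

definition slope_le :: "real ^ 'p \<Rightarrow> real \<Rightarrow> bool" where
  "slope_le z s \<longleftrightarrow> 0 \<le> s \<and> (\<forall>u. u \<bullet> u = 1 \<longrightarrow> (\<exists>v. v \<in> D z \<and> u \<bullet> v \<le> s))"

lemma slope_le_mono: "slope_le z s \<Longrightarrow> s \<le> s' \<Longrightarrow> slope_le z s'"
  unfolding slope_le_def by (meson order_trans)

lemma slope_le_exists: "\<exists>s. slope_le z s"
proof -
  obtain v where v: "v \<in> D z" using D_ne by blast
  have "u \<bullet> v \<le> norm v" if "u \<bullet> u = 1" for u :: "real^'p"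
    using norm_cauchy_schwarz[of u v] that by (simp add: norm_eq_sqrt_inner)
  then have "slope_le z (norm v)" using v by (auto simp: slope_le_def)
  then show ?thesis ..
qed

text \<open>If the test failed for a unit vector u, the set \<open>D z\<close>, and with it the
  convex hull, would lie in the open half-space \<open>u \<bullet> v > norm w\<close>, against
  Cauchy-Schwarz for w.\<close>

lemma slope_le_convex_hull:
  assumes "w \<in> convex hull (D z)"
  shows "slope_le z (norm w)"
  unfolding slope_le_def
proof (intro conjI allI impI norm_ge_zero)
  fix u :: "real^'p" assume u: "u \<bullet> u = 1"
  show "\<exists>v. v \<in> D z \<and> u \<bullet> v \<le> norm w"
  proof (rule ccontr)
    assume "\<not> ?thesis"
    then have "D z \<subseteq> {v. u \<bullet> v > norm w}" by (auto simp: not_le)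
    then have "convex hull (D z) \<subseteq> {v. u \<bullet> v > norm w}"
      by (intro hull_minimal convex_halfspace_gt)
    with assms have "norm w < u \<bullet> w" by blast
    moreover have "u \<bullet> w \<le> norm w"
      using norm_cauchy_schwarz[of u w] u by (simp add: norm_eq_sqrt_inner)
    ultimately show False by simp
  qed
qed

lemma definable_slope_le:
  assumes z: "\<And>i. definable_term cs (\<lambda>e. z e $ i)" and s: "definable_term cs s"
  shows "definable cs (\<lambda>e. slope_le (z e) (s e))"
  unfolding slope_le_def
  by (intro definable_conj definable_ex_vec definable_all_vec definable_imp definable_mem_D
      definable_eq definable_le term_inner term_fst term_snd term_vec term_real term_const z s)

text \<open>Definable choice gives a curve \<open>\<theta>\<close> with \<open>f (\<theta> r) = r\<close>, so differentiating along \<open>\<theta>\<close> yields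
  \<open>1 = \<theta>' r \<bullet> v\<close> for all \<open>v \<in> D (\<theta> r)\<close>; below \<open>h\<close> is the sum of the \<open>\<bar>\<theta>'\<^sub>i\<bar>\<close>, which has a bounded
  primitive because \<open>\<theta>\<close> is bounded and piecewise monotone.\<close>

lemma level_curve:
  assumes B: "definable (real_coords \<otimes> vec_coords) (\<lambda>p. B (fst p) (snd p))"
    and bdd: "\<And>r z i. B r z \<Longrightarrow> \<bar>z $ i\<bar> \<le> C"
    and level: "\<And>r z. B r z \<Longrightarrow> f z = r"
  obtains h Q L where "finite Q" "L \<ge> 0" "\<And>r. h r \<ge> 0" "\<And>r. r \<notin> Q \<Longrightarrow> isCont h r"
    "\<And>r z. r \<notin> Q \<Longrightarrow> B r z \<Longrightarrow> \<exists>z. B r z \<and> (\<forall>s. slope_le z s \<longrightarrow> 1 \<le> s * h r)"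
    "\<And>a b z. a \<le> b \<Longrightarrow> {a..b} \<inter> Q = {} \<Longrightarrow> B a z \<Longrightarrow>
       \<exists>H. (\<forall>r\<in>{a..b}. (H has_real_derivative h r) (at r)) \<and> H b - H a \<le> L"
proof -
  obtain \<theta> where \<theta>: "\<And>i. definable_term real_coords (\<lambda>r. \<theta> r $ i)" "\<And>r z. B r z \<Longrightarrow> B r (\<theta> r)"
    using definable_choice_vec[where cs = real_coords and B = B and C = C, OF B] bdd by blast
  have "\<forall>i. \<exists>g' Q. definable_term real_coords g' \<and> finite Q
     \<and> (\<forall>x. x \<notin> Q \<longrightarrow> ((\<lambda>r. \<theta> r $ i) has_real_derivative g' x) (at x) \<and> isCont g' x)"
  proof
    fix i
    obtain g' Q where "definable_term real_coords g'" "finite Q"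
      "\<And>x. x \<notin> Q \<Longrightarrow> ((\<lambda>r. \<theta> r $ i) has_real_derivative g' x) (at x)" "\<And>x. x \<notin> Q \<Longrightarrow> isCont g' x"
      using definable_piecewise_C1[OF \<theta>(1)[of i]] by blast
    then show "\<exists>g' Q. definable_term real_coords g' \<and> finite Q
     \<and> (\<forall>x. x \<notin> Q \<longrightarrow> ((\<lambda>r. \<theta> r $ i) has_real_derivative g' x) (at x) \<and> isCont g' x)" by blast
  qed
  then obtain g' Q1 where g': "\<And>i. definable_term real_coords (g' i)" and Q1: "\<And>i. finite (Q1 i)"
    and der1: "\<And>i x. x \<notin> Q1 i \<Longrightarrow> ((\<lambda>r. \<theta> r $ i) has_real_derivative g' i x) (at x)"
    and cont1: "\<And>i x. x \<notin> Q1 i \<Longrightarrow> isCont (g' i) x"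
    by metis
  define E where "E = {r. \<exists>z. B r z}"
  define \<theta>' where "\<theta>' r = (\<chi> i. g' i r)" for r
  define h where "h r = (\<Sum>i\<in>UNIV. \<bar>g' i r\<bar>)" for r
  define \<phi> where "\<phi> r = (SUP v\<in>D (\<theta> r). \<theta>' r \<bullet> v)" for r
  define \<psi> where "\<psi> r = (SUP v\<in>D (\<theta> r). (- \<theta>' r) \<bullet> v)" for r
  have d\<phi>: "definable_term real_coords \<phi>" unfolding \<phi>_def by (intro term_SUP_D \<theta>(1)) (simp add: \<theta>'_def g')
  have d\<psi>: "definable_term real_coords \<psi>" unfolding \<psi>_def
    by (intro term_SUP_D \<theta>(1)) (simp add: \<theta>'_def g' term_uminus)
  have dE: "definable real_coords (\<lambda>r. \<exists>z. B r z)" by (intro definable_ex_vec B)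
  have dpos: "definable real_coords (\<lambda>r. 0 < g' i r)" and dneg: "definable real_coords (\<lambda>r. g' i r < 0)" for i
    by (intro definable_less g' term_const)+
  \<comment> \<open>Off Q the curve is continuously differentiable, membership in E and the sign of
    each coordinate derivative are locally constant, and \<phi> and \<psi> are continuous.\<close>
  define Q where "Q = (\<Union>i. Q1 i) \<union> frontier E \<union> (\<Union>i. frontier {r. 0 < g' i r})
    \<union> (\<Union>i. frontier {r. g' i r < 0}) \<union> {r. \<not> isCont \<phi> r} \<union> {r. \<not> isCont \<psi> r}"
  have "finite Q"
    unfolding Q_def E_def using Q1 finite_frontier_definable[OF dE] finite_frontier_definable[OF dpos]
      finite_frontier_definable[OF dneg] finite_not_isCont[OF d\<phi>] finite_not_isCont[OF d\<psi>]
    by (intro finite_UnI finite_UN_I) auto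
  have der: "(\<theta> has_vector_derivative \<theta>' r) (at r)" if "r \<notin> Q" for r
  proof -
    have "((\<lambda>r. \<theta> r $ i) has_vector_derivative \<theta>' r $ i) (at r)" for i
      using der1[of r i] that by (auto simp: Q_def \<theta>'_def has_real_derivative_iff_has_vector_derivative)
    then have "((\<lambda>r. \<chi> i. \<theta> r $ i) has_vector_derivative \<theta>' r) (at r)"
      unfolding has_vector_derivative_def
      by (subst has_derivative_componentwise_within)
        (auto simp: Basis_vec_def inner_axis scaleR_vec_def)
    then show ?thesis by simp
  qed
  have cont\<theta>': "isCont \<theta>' r" if "r \<notin> Q" for r
    unfolding \<theta>'_def continuous_within
    using cont1[of r] that by (intro vec_tendstoI) (auto simp: Q_def isCont_def)
  have conth: "isCont h r" if "r \<notin> Q" for r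
    unfolding h_def using cont1[of r] that by (intro continuous_intros) (auto simp: Q_def)
  have inE: "{a..b} \<subseteq> E" if "a \<le> b" "{a..b} \<inter> Q = {}" "a \<in> E" for a b
    using that by (intro interval_subset_if_frontier) (auto simp: Q_def)
  have f\<theta>: "f (\<theta> r) = r" if "r \<in> E" for r using that \<theta>(2) level by (auto simp: E_def)
  \<comment> \<open>Along \<theta> the value of f is the parameter itself, so \<phi> integrates to
    \<open>s - a\<close> and \<psi> to its negative over every [a, s]. By continuity \<phi> = 1 and
    \<psi> = -1 at r: the maximum and the minimum of the product are both 1.\<close>
  have unit: "\<theta>' r \<bullet> v = 1" if r: "r \<in> E" "r \<notin> Q" and v: "v \<in> D (\<theta> r)" for r v
  proof -
    obtain e where e: "e > 0" "{r - e..r + e} \<inter> Q = {}"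
      using finite_avoiding_interval[OF \<open>finite Q\<close> r(2)] by blast
    define a b where "a = r - e" and "b = r + e"
    have ab: "a < r" "r < b" "{a..b} \<inter> Q = {}" using e by (auto simp: a_def b_def)
    have "{a..b} \<inter> frontier E = {}" using ab(3) by (auto simp: Q_def)
    moreover have "r \<in> {a..b} \<inter> E" using r(1) ab by simp
    ultimately have E: "{a..b} \<subseteq> E" using connected_Int_frontier[OF connected_Icc, of a b E] by blast
    have nQ: "t \<notin> Q" if "t \<in> {a..b}" for t using ab(3) that by blast
    have ac: "abs_continuous_on {a..b} \<theta>"
      using nQ der cont\<theta>'
      by (intro C1_imp_abs_continuous[where g' = \<theta>'] continuous_at_imp_continuous_on) auto
    have vd: "vector_derivative \<theta> (at t) = \<theta>' t" if "t \<in> {a..b}" for t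
      by (rule vector_derivative_at[OF der[OF nQ[OF that]]])
    have up: "(\<phi> has_integral 1 * (s - a)) {a..s}" if s: "a < s" "s \<le> b" for s
    proof -
      have "(support_integrand D \<theta> has_integral f (\<theta> s) - f (\<theta> a)) {a..s}"
      proof (rule potential_along_path[OF _ \<open>a < s\<close> negligible_empty])
        show "abs_continuous_on {a..s} \<theta>" using s by (intro abs_continuous_on_subset[OF ac]) auto
        show "\<exists>v. (\<theta> has_vector_derivative v) (at t)" if "t \<in> {a<..<s} - {}" for t
          using der[OF nQ, of t] that s by auto
      qed
      moreover have "f (\<theta> s) - f (\<theta> a) = 1 * (s - a)" using E s ab by (subst (1 2) f\<theta>) auto
      ultimately have "(support_integrand D \<theta> has_integral 1 * (s - a)) {a..s}" by simp
      then show ?thesis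
        by (rule has_integral_eq[rotated]) (use s vd in \<open>auto simp: support_integrand_def \<phi>_def\<close>)
    qed
    have dn: "(\<psi> has_integral (- 1) * (s - a)) {a..s}" if s: "a < s" "s \<le> b" for s
    proof -
      have "((\<lambda>t. SUP v\<in>D (\<theta> t). (- vector_derivative \<theta> (at t)) \<bullet> v) has_integral f (\<theta> a) - f (\<theta> s)) {a..s}"
      proof (rule potential_along_reversed_path[OF _ \<open>a < s\<close> negligible_empty])
        show "abs_continuous_on {a..s} \<theta>" using s by (intro abs_continuous_on_subset[OF ac]) auto
        show "\<exists>v. (\<theta> has_vector_derivative v) (at t)" if "t \<in> {a<..<s} - {}" for t
          using der[OF nQ, of t] that s by auto
      qed
      moreover have "f (\<theta> a) - f (\<theta> s) = (- 1) * (s - a)" using E s ab by (subst (1 2) f\<theta>) auto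
      ultimately have "((\<lambda>t. SUP v\<in>D (\<theta> t). (- vector_derivative \<theta> (at t)) \<bullet> v) has_integral (- 1) * (s - a)) {a..s}" by simp
      then show ?thesis
        by (rule has_integral_eq[rotated]) (use s vd in \<open>auto simp: \<psi>_def\<close>)
    qed
    have "\<phi> r = 1"
      using nQ by (intro integrand_eq_if_integral_linear[OF _ up ab(1,2)] continuous_at_imp_continuous_on) (auto simp: Q_def)
    moreover have "\<psi> r = - 1"
      using nQ by (intro integrand_eq_if_integral_linear[OF _ dn ab(1,2)] continuous_at_imp_continuous_on) (auto simp: Q_def)
    moreover have "u \<bullet> v \<le> (SUP v\<in>D (\<theta> r). u \<bullet> v)" for u
    proof -
      obtain w where w: "w \<in> D (\<theta> r)" "\<And>v. v \<in> D (\<theta> r) \<Longrightarrow> u \<bullet> v \<le> u \<bullet> w"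
        using compact_inner_attains[OF D_compact D_ne] by blast
      then have "(SUP v\<in>D (\<theta> r). u \<bullet> v) = u \<bullet> w" by (intro SUP_eq_maximum[of w _ "\<lambda>v. u \<bullet> v"]) auto
      then show ?thesis using w v by simp
    qed
    note this[of "\<theta>' r"] this[of "- \<theta>' r"]
    ultimately show ?thesis by (simp add: \<phi>_def \<psi>_def)
  qed
  \<comment> \<open>Each coordinate of \<theta> stays in [-C, C] on E, so its monotone pieces vary
    by at most 2 C. The absolute value keeps the bound nonnegative even if B is empty and C
    negative.\<close>
  show ?thesis
  proof (rule that[of Q "real CARD('p) * (2 * \<bar>C\<bar>)" h])
    show "h r \<ge> 0" for r by (simp add: h_def sum_nonneg)
    show "\<exists>z. B r z \<and> (\<forall>s. slope_le z s \<longrightarrow> 1 \<le> s * h r)" if r: "r \<notin> Q" and z: "B r z" for r z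
    proof (intro exI[of _ "\<theta> r"] conjI allI impI)
      show "B r (\<theta> r)" using \<theta>(2)[OF z] .
      fix s assume s: "slope_le (\<theta> r) s"
      have rE: "r \<in> E" using z by (auto simp: E_def)
      obtain v0 where "v0 \<in> D (\<theta> r)" using D_ne by blast
      from unit[OF rE r this] have "\<theta>' r \<noteq> 0" by auto
      \<comment> \<open>The direction in which to test the slope: by \<open>unit\<close> every v in
        \<open>D (\<theta> r)\<close> has the product \<open>1 / norm (\<theta>' r)\<close> with
        it.\<close>
      define u where "u = \<theta>' r /\<^sub>R norm (\<theta>' r)"
      have "u \<bullet> u = 1" using \<open>\<theta>' r \<noteq> 0\<close> by (simp add: u_def dot_square_norm power2_eq_square field_simps)
      then obtain v where v: "v \<in> D (\<theta> r)" "u \<bullet> v \<le> s" using s by (auto simp: slope_le_def)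
      have "u \<bullet> v = 1 / norm (\<theta>' r)" using unit[OF rE r v(1)] by (simp add: u_def divide_inverse)
      with v(2) have "1 \<le> s * norm (\<theta>' r)" using \<open>\<theta>' r \<noteq> 0\<close> by (simp add: field_simps)
      also have "\<dots> \<le> s * h r"
      proof (rule mult_left_mono)
        show "norm (\<theta>' r) \<le> h r" using norm_le_l1_cart[of "\<theta>' r"] by (simp add: h_def \<theta>'_def)
        show "0 \<le> s" using s by (simp add: slope_le_def)
      qed
      finally show "1 \<le> s * h r" .
    qed
    show "\<exists>H. (\<forall>r\<in>{a..b}. (H has_real_derivative h r) (at r)) \<and> H b - H a \<le> real CARD('p) * (2 * \<bar>C\<bar>)"
      if ab: "a \<le> b" "{a..b} \<inter> Q = {}" and z: "B a z" for a b z
    proof -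
      \<comment> \<open>As the derivatives keep their signs on [a, b], the signs at a turn the sum
        of absolute values h into the derivative of a signed sum of coordinates.\<close>
      define \<sigma> where "\<sigma> i = sgn (g' i a)" for i
      have sgn: "\<bar>g' i r\<bar> = \<sigma> i * g' i r" if "r \<in> {a..b}" for i r
      proof -
        have fp: "{a..b} \<inter> frontier {r. 0 < g' i r} = {}" and fn: "{a..b} \<inter> frontier {r. g' i r < 0} = {}"
          using ab(2) unfolding Q_def by blast+
        consider "0 < g' i a" | "g' i a < 0" | "g' i a = 0" by linarith
        then show ?thesis
        proof cases
          case 1
          then show ?thesis using interval_subset_if_frontier[OF fp] ab(1) that by (auto simp: \<sigma>_def)
        next
          case 2
          then show ?thesis using interval_subset_if_frontier[OF fn] ab(1) that by (auto simp: \<sigma>_def)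
        next
          case 3
          have "{a..b} \<subseteq> - {r. 0 < g' i r}" "{a..b} \<subseteq> - {r. g' i r < 0}"
            using fp fn 3 ab(1) by (intro interval_subset_if_frontier; simp add: frontier_complement)+
          then have "g' i r = 0" using that by fastforce
          then show ?thesis by simp
        qed
      qed
      define H where "H r = (\<Sum>i\<in>UNIV. \<sigma> i * \<theta> r $ i)" for r
      have "(H has_real_derivative h r) (at r)" if r: "r \<in> {a..b}" for r
      proof -
        have "r \<notin> Q" using r ab(2) by blast
        then have "((\<lambda>r. \<theta> r $ i) has_real_derivative g' i r) (at r)" for i by (intro der1) (auto simp: Q_def)
        then have "(H has_real_derivative (\<Sum>i\<in>UNIV. \<sigma> i * g' i r)) (at r)"
          unfolding H_def[abs_def] by (intro DERIV_sum DERIV_cmult)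
        then show ?thesis using sgn[OF r] by (simp add: h_def)
      qed
      moreover have "H b - H a \<le> real CARD('p) * (2 * \<bar>C\<bar>)"
      proof -
        have "a \<in> E" using z by (auto simp: E_def)
        then have "b \<in> E" using inE[OF ab] ab(1) by auto
        have C: "\<bar>\<theta> b $ i\<bar> \<le> C" "\<bar>\<theta> a $ i\<bar> \<le> C" for i
          using \<theta>(2) bdd \<open>a \<in> E\<close> \<open>b \<in> E\<close> unfolding E_def by blast+
        have "H b - H a = (\<Sum>i\<in>UNIV. \<sigma> i * (\<theta> b $ i - \<theta> a $ i))"
          by (simp add: H_def sum_subtractf right_diff_distrib)
        also have "\<dots> \<le> (\<Sum>i\<in>(UNIV :: 'p set). 2 * \<bar>C\<bar>)"
        proof (rule sum_mono)
          fix i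
          have "\<sigma> i * (\<theta> b $ i - \<theta> a $ i) \<le> \<bar>\<sigma> i\<bar> * \<bar>\<theta> b $ i - \<theta> a $ i\<bar>"
            by (metis abs_ge_self abs_mult)
          also have "\<dots> \<le> 1 * \<bar>\<theta> b $ i - \<theta> a $ i\<bar>"
            by (intro mult_right_mono) (auto simp: \<sigma>_def sgn_if)
          also have "\<dots> \<le> \<bar>\<theta> b $ i\<bar> + \<bar>\<theta> a $ i\<bar>" using abs_triangle_ineq4 by simp
          also have "\<dots> \<le> C + C" using C by (intro add_mono)
          also have "\<dots> \<le> 2 * \<bar>C\<bar>" by simp
          finally show "\<sigma> i * (\<theta> b $ i - \<theta> a $ i) \<le> 2 * \<bar>C\<bar>" .
        qed
        also have "\<dots> = real CARD('p) * (2 * \<bar>C\<bar>)" by simp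
        finally show ?thesis .
      qed
      ultimately show ?thesis by blast
    qed
  qed (use \<open>finite Q\<close> conth in auto)
qed

text \<open>A level at which the infimal slope is zero but not attained admits points of slope at most
  \<open>r - c\<close>; a whole interval of such levels would force \<open>h r \<ge> 1 / (r - c)\<close>, whose primitive is unbounded.\<close>

lemma finite_levels_without_near_minimiser:
  "finite {r. (\<exists>z. z \<bullet> z \<le> R \<and> f z = r) \<and>
     \<not> (\<exists>z. z \<bullet> z \<le> R \<and> f z = r \<and> (\<exists>s. slope_le z s \<and>
          (\<forall>z' s'. z' \<bullet> z' \<le> R \<and> f z' = r \<and> slope_le z' s' \<longrightarrow> s \<le> s' + s')))}"
  (is "finite {r. ?P r}")
proof (rule ccontr)
  assume inf: "infinite {r. ?P r}"
  have "definable real_coords ?P"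
    by (intro definable_conj definable_not definable_ex definable_all definable_ex_vec definable_all_vec
        definable_imp definable_le definable_eq definable_slope_le term_f term_inner term_add
        term_const term_fst term_snd term_vec term_real)
  moreover define P where "P = ?P"
  ultimately have "definable real_coords P" "infinite {r. P r}" using inf by simp_all
  then obtain c d where cd: "c < d" and P': "\<And>r. c < r \<Longrightarrow> r < d \<Longrightarrow> P r"
    using definable_finite_or_interval[of P] by blast
  have P: "?P r" if "c < r" "r < d" for r using P'[OF that] unfolding P_def .
  define B where "B r z \<longleftrightarrow> z \<bullet> z \<le> R \<and> f z = r \<and> slope_le z (r - c)" for r z
  have B: "definable (real_coords \<otimes> vec_coords) (\<lambda>p. B (fst p) (snd p))"
    unfolding B_def
    by (intro definable_conj definable_le definable_eq definable_slope_le term_f term_inner term_diff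
        term_const term_fst term_snd term_vec term_real)
  have bdd: "\<bar>z $ i\<bar> \<le> sqrt R" if "B r z" for r z i
  proof -
    have "norm z \<le> sqrt R" using that by (simp add: B_def norm_eq_sqrt_inner)
    then show ?thesis using component_le_norm_cart[of z i] by linarith
  qed
  \<comment> \<open>Without such a point all slopes on the level are at least \<open>r - c\<close>.
    The infimum is then positive, hence smaller than its double, and a point within the factor 2
    exists, contrary to the choice of the interval.\<close>
  have ne: "\<exists>z. B r z" if r: "c < r" "r < d" for r
  proof (rule ccontr)
    assume nB: "\<not> (\<exists>z. B r z)"
    define W where "W = {s. \<exists>z. z \<bullet> z \<le> R \<and> f z = r \<and> slope_le z s}"
    have pos: "r - c \<le> s" if "s \<in> W" for s
    proof (rule ccontr)
      assume "\<not> r - c \<le> s"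
      then have "\<exists>z. B r z" using that slope_le_mono[of _ s "r - c"] by (force simp: W_def B_def)
      with nB show False ..
    qed
    obtain z0 where z0: "z0 \<bullet> z0 \<le> R" "f z0 = r" using P[OF r] by blast
    then have "W \<noteq> {}" using slope_le_exists[of z0] by (auto simp: W_def)
    have bW: "bdd_below W" using pos by (auto simp: bdd_below_def)
    have "r - c \<le> Inf W" using \<open>W \<noteq> {}\<close> pos by (rule cInf_greatest)
    then have "Inf W < 2 * Inf W" using r by simp
    then obtain s where s: "s \<in> W" "s < 2 * Inf W" using cInf_less_iff[OF \<open>W \<noteq> {}\<close> bW] by blast
    then obtain z where z: "z \<bullet> z \<le> R" "f z = r" "slope_le z s" by (auto simp: W_def)
    have "s \<le> s' + s'" if "z' \<bullet> z' \<le> R \<and> f z' = r \<and> slope_le z' s'" for z' s'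
    proof -
      have "s' \<in> W" using that by (auto simp: W_def)
      then have "Inf W \<le> s'" using bW by (rule cInf_lower)
      with s(2) show ?thesis by linarith
    qed
    with z P[OF r] show False by blast
  qed
  have level: "\<And>r z. B r z \<Longrightarrow> f z = r" by (simp add: B_def)
  obtain h Q L where Q: "finite Q" "L \<ge> 0"
    and h: "\<And>r z. r \<notin> Q \<Longrightarrow> B r z \<Longrightarrow> \<exists>z. B r z \<and> (\<forall>s. slope_le z s \<longrightarrow> 1 \<le> s * h r)"
    and H: "\<And>a b z. a \<le> b \<Longrightarrow> {a..b} \<inter> Q = {} \<Longrightarrow> B a z \<Longrightarrow>
       \<exists>H. (\<forall>r\<in>{a..b}. (H has_real_derivative h r) (at r)) \<and> H b - H a \<le> L"
    by (rule level_curve[OF B bdd level]) (assumption, assumption, (rule that; assumption))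
  \<comment> \<open>c itself may belong to Q; only levels to the right of c are used.\<close>
  obtain e where e: "e > 0" "{c - e..c + e} \<inter> (Q - {c}) = {}"
    using finite_avoiding_interval[of "Q - {c}" c] Q(1) by auto
  define b where "b = min (c + e) ((c + d) / 2)"
  have b: "c < b" "b < d" "b \<le> c + e" using e(1) cd by (auto simp: b_def min_def)
  \<comment> \<open>Chosen so that \<open>ln (r - c)\<close> grows by \<open>L + 1\<close> from a to
    b, one more than the primitive of h can.\<close>
  define k where "k = exp (- (L + 1))"
  define a where "a = c + (b - c) * k"
  have k: "0 < k" "k < 1" "ln k = - (L + 1)" using Q(2) by (auto simp: k_def)
  have "c < a" using b(1) k by (simp add: a_def)
  moreover have "(b - c) * k < (b - c) * 1"
    using b(1) k by (intro mult_strict_left_mono) auto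
  then have "a < b" by (simp add: a_def)
  ultimately have a: "c < a" "a < b" .
  have nQ: "r \<notin> Q" if "r \<in> {a..b}" for r
  proof -
    have "r \<in> {c - e..c + e}" "r \<noteq> c" using that a b e(1) by auto
    then show ?thesis using e(2) by blast
  qed
  obtain z where "B a z" using ne[of a] a b by auto
  moreover have "{a..b} \<inter> Q = {}" using nQ by blast
  ultimately obtain H0 where H0: "\<And>r. r \<in> {a..b} \<Longrightarrow> (H0 has_real_derivative h r) (at r)" "H0 b - H0 a \<le> L"
    using H[OF less_imp_le[OF a(2)]] by blast
  have "H0 a - ln (a - c) \<le> H0 b - ln (b - c)"
  proof (rule DERIV_nonneg_imp_nondecreasing[where f = "\<lambda>r. H0 r - ln (r - c)"])
    show "a \<le> b" using a by simp
    fix r assume r: "a \<le> r" "r \<le> b"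
    have rpos: "r - c > 0" using r a by simp
    obtain z where z: "B r z" using ne[of r] r a b by auto
    then obtain z where "B r z" "1 \<le> (r - c) * h r" using h[OF nQ z] r by (auto simp: B_def)
    then have "1 / (r - c) \<le> h r" using rpos by (simp add: field_simps)
    moreover have "((\<lambda>r. H0 r - ln (r - c)) has_real_derivative h r - 1 / (r - c)) (at r)"
      using rpos r by (auto intro!: derivative_eq_intros H0(1))
    ultimately show "\<exists>y. ((\<lambda>r. H0 r - ln (r - c)) has_real_derivative y) (at r) \<and> 0 \<le> y" by force
  qed
  moreover have "ln (a - c) = ln (b - c) - (L + 1)"
    using b(1) k by (simp add: a_def ln_mult)
  ultimately show False using H0(2) by linarith
qed

text \<open>The level curve runs through points whose slope is within the factor 2 of every slope on
  the level; this factor reappears in \<open>2 * s * h (f z)\<close> when the estimate is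
  transferred to other z. Levels without such points are added to Q.\<close>

lemma desingularising_function:
  obtains h Q L where "finite Q" "L \<ge> 0" "\<And>r. h r \<ge> 0" "\<And>r. r \<notin> Q \<Longrightarrow> isCont h r"
    "\<And>z s. z \<bullet> z \<le> R \<Longrightarrow> slope_le z s \<Longrightarrow> f z \<notin> Q \<Longrightarrow> 1 \<le> 2 * s * h (f z)"
    "\<And>a b z. a \<le> b \<Longrightarrow> {a..b} \<inter> Q = {} \<Longrightarrow> z \<bullet> z \<le> R \<Longrightarrow> f z = a \<Longrightarrow>
       \<exists>H. (\<forall>r\<in>{a..b}. (H has_real_derivative h r) (at r)) \<and> H b - H a \<le> L"
proof -
  define B where "B r z \<longleftrightarrow> z \<bullet> z \<le> R \<and> f z = r \<and> (\<exists>s. slope_le z s \<and>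
          (\<forall>z' s'. z' \<bullet> z' \<le> R \<and> f z' = r \<and> slope_le z' s' \<longrightarrow> s \<le> s' + s'))" for r z
  have B: "definable (real_coords \<otimes> vec_coords) (\<lambda>p. B (fst p) (snd p))"
    unfolding B_def
    by (intro definable_conj definable_ex definable_all definable_all_vec
        definable_imp definable_le definable_eq definable_slope_le term_f term_inner term_add
        term_const term_fst term_snd term_vec term_real)
  have bdd: "\<bar>z $ i\<bar> \<le> sqrt R" if "B r z" for r z i
  proof -
    have "norm z \<le> sqrt R" using that by (simp add: B_def norm_eq_sqrt_inner)
    then show ?thesis using component_le_norm_cart[of z i] by linarith
  qed
  have level: "\<And>r z. B r z \<Longrightarrow> f z = r" by (simp add: B_def)
  obtain h Q L where Q: "finite Q" "L \<ge> 0" and h0: "\<And>r. h r \<ge> 0" and hc: "\<And>r. r \<notin> Q \<Longrightarrow> isCont h r"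
    and h: "\<And>r z. r \<notin> Q \<Longrightarrow> B r z \<Longrightarrow> \<exists>z. B r z \<and> (\<forall>s. slope_le z s \<longrightarrow> 1 \<le> s * h r)"
    and H: "\<And>a b z. a \<le> b \<Longrightarrow> {a..b} \<inter> Q = {} \<Longrightarrow> B a z \<Longrightarrow>
       \<exists>H. (\<forall>r\<in>{a..b}. (H has_real_derivative h r) (at r)) \<and> H b - H a \<le> L"
    by (rule level_curve[OF B bdd level]) (assumption, assumption, (rule that; assumption))
  define Z where "Z = {r. (\<exists>z. z \<bullet> z \<le> R \<and> f z = r) \<and> \<not> (\<exists>z. B r z)}"
  have "finite Z" using finite_levels_without_near_minimiser[of R] by (simp add: Z_def B_def)
  have ne: "\<exists>z. B (f z0) z" if "z0 \<bullet> z0 \<le> R" "f z0 \<notin> Z" for z0 using that by (auto simp: Z_def)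
  show ?thesis
  proof (rule that[of "Q \<union> Z" L h])
    show "finite (Q \<union> Z)" using Q(1) \<open>finite Z\<close> by simp
    show "1 \<le> 2 * s * h (f z)" if z: "z \<bullet> z \<le> R" "slope_le z s" "f z \<notin> Q \<union> Z" for z s
    proof -
      obtain z1 where "B (f z) z1" using ne z by blast
      then obtain z2 where z2: "B (f z) z2" "\<And>s. slope_le z2 s \<Longrightarrow> 1 \<le> s * h (f z)"
        using h[of "f z" z1] z(3) by blast
      then obtain s2 where "slope_le z2 s2" "s2 \<le> s + s" using z by (auto simp: B_def)
      then have "1 \<le> s2 * h (f z)" "s2 * h (f z) \<le> (s + s) * h (f z)"
        using z2(2) h0 by (auto intro: mult_right_mono)
      then show ?thesis by simp
    qed
    show "\<exists>H. (\<forall>r\<in>{a..b}. (H has_real_derivative h r) (at r)) \<and> H b - H a \<le> L"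
      if ab: "a \<le> b" "{a..b} \<inter> (Q \<union> Z) = {}" and z: "z \<bullet> z \<le> R" "f z = a" for a b z
    proof -
      have "f z \<in> {a..b}" using ab(1) z(2) by simp
      then have "f z \<notin> Z" using ab(2) by blast
      then obtain z1 where "B a z1" using ne[OF z(1)] z(2) by blast
      moreover have "{a..b} \<inter> Q = {}" using ab(2) by blast
      ultimately show ?thesis using H ab(1) by blast
    qed
  qed (use Q h0 hc in auto)
qed

end

section \<open>The trajectory\<close>

lemma nonneg_has_integral_0_imp_negligible:
  fixes g :: "'a::euclidean_space \<Rightarrow> real"
  assumes g: "(g has_integral 0) A" and nn: "\<And>x. x \<in> A \<Longrightarrow> 0 \<le> g x" and A: "A \<in> sets lebesgue"
  shows "negligible {x \<in> A. g x \<noteq> 0}"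
proof -
  have abs: "set_integrable lebesgue A g"
    using nn by (intro nonnegative_absolutely_integrable_1 has_integral_integrable[OF g])
  have "(LINT x:A|lebesgue. g x) = 0"
    using set_lebesgue_integral_eq_integral(2)[OF abs] g by (simp add: integral_unique)
  then have "(LINT x|lebesgue. indicator A x *\<^sub>R g x) = 0" by (simp add: set_lebesgue_integral_def)
  moreover have "AE x in lebesgue. 0 \<le> indicator A x *\<^sub>R g x" using nn by (auto simp: indicator_def)
  ultimately have "AE x in lebesgue. indicator A x *\<^sub>R g x = 0"
    using integral_nonneg_eq_0_iff_AE abs unfolding set_integrable_def by blast
  then obtain N where N: "{x \<in> space lebesgue. \<not> indicator A x *\<^sub>R g x = 0} \<subseteq> N" "N \<in> null_sets lebesgue"
    by (auto elim!: AE_E simp: null_sets_def)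
  have "negligible N" using N(2) by (simp add: negligible_iff_null_sets)
  then show ?thesis by (rule negligible_subset) (use N(1) in \<open>auto simp: indicator_def\<close>)
qed

lemma integral_pieces:
  fixes g :: "real \<Rightarrow> real"
  assumes "g integrable_on {a..b}" "a \<le> u" "u \<le> v" "v \<le> b"
  shows "integral {a..b} g = integral {a..u} g + integral {u..v} g + integral {v..b} g"
proof -
  have "integral {a..u} g + integral {u..b} g = integral {a..b} g"
    using assms by (intro Henstock_Kurzweil_Integration.integral_combine) auto
  moreover have "integral {u..v} g + integral {v..b} g = integral {u..b} g"
    using assms by (intro Henstock_Kurzweil_Integration.integral_combine integrable_subinterval_real[OF assms(1)]) auto
  ultimately show ?thesis by simp
qed

locale subgradient_trajectory = definable_potential S D f
  for S :: "nat \<Rightarrow> real list set set"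
    and D :: "real ^ 'p::finite \<Rightarrow> (real ^ 'p) set" and f :: "real ^ 'p \<Rightarrow> real" +
  fixes x w :: "real \<Rightarrow> real ^ 'p" and N :: "real set" and R :: real
  assumes ac: "T \<ge> 0 \<Longrightarrow> abs_continuous_on {0..T} x"
    and N: "negligible N"
    and velocity: "0 \<le> t \<Longrightarrow> t \<notin> N \<Longrightarrow> (x has_vector_derivative w t) (at t)"
    and inclusion: "0 \<le> t \<Longrightarrow> t \<notin> N \<Longrightarrow> - w t \<in> convex hull (D (x t))"
    and bounded_traj: "0 \<le> t \<Longrightarrow> x t \<bullet> x t \<le> R"
begin

text \<open>\<phi> + \<psi> is the maximum minus the minimum of \<open>w t \<bullet> v\<close> over
  D, for almost every t. It is nonnegative with integral zero, so almost everywhere the product is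
  constant on D, hence on the convex hull, where it can be evaluated at
  \<open>- w t\<close>.\<close>

lemma energy:
  assumes "0 \<le> s" "s \<le> s'"
  shows "((\<lambda>t. w t \<bullet> w t) has_integral f (x s) - f (x s')) {s..s'}"
proof (cases "s = s'")
  case True
  then show ?thesis by (simp add: has_integral_refl)
next
  case False
  with assms have "s < s'" by simp
  let ?\<phi> = "support_integrand D x"
  let ?\<psi> = "\<lambda>t. SUP v\<in>D (x t). (- vector_derivative x (at t)) \<bullet> v"
  have ac': "abs_continuous_on {s..s'} x"
    using assms by (intro abs_continuous_on_subset[OF ac[of s']]) auto
  have diff: "\<exists>v. (x has_vector_derivative v) (at t)" if "t \<in> {s<..<s'} - N" for t
    using velocity[of t] that assms by (intro exI[of _ "w t"]) auto
  have up: "(?\<phi> has_integral f (x s') - f (x s)) {s..s'}"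
    by (rule potential_along_path[OF ac' \<open>s < s'\<close> N diff])
  have dn: "(?\<psi> has_integral f (x s) - f (x s')) {s..s'}"
    by (rule potential_along_reversed_path[OF ac' \<open>s < s'\<close> N diff])
  have SUP_ge: "u \<bullet> v \<le> (SUP v\<in>D z. u \<bullet> v)" if "v \<in> D z" for u v z
  proof -
    obtain v0 where v0: "v0 \<in> D z" "\<And>v. v \<in> D z \<Longrightarrow> u \<bullet> v \<le> u \<bullet> v0"
      using compact_inner_attains[OF D_compact D_ne] by blast
    then have "(SUP v\<in>D z. u \<bullet> v) = u \<bullet> v0" by (intro SUP_eq_maximum[of v0 _ "\<lambda>v. u \<bullet> v"]) auto
    then show ?thesis using v0 that by simp
  qed
  have \<phi>_ge: "vector_derivative x (at t) \<bullet> v \<le> ?\<phi> t" and \<psi>_ge: "- (vector_derivative x (at t) \<bullet> v) \<le> ?\<psi> t"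
    if "v \<in> D (x t)" for v t
    using SUP_ge[OF that, of "vector_derivative x (at t)"] SUP_ge[OF that, of "- vector_derivative x (at t)"]
    by (simp_all add: support_integrand_def)
  define M where "M = {t \<in> {s..s'}. ?\<phi> t + ?\<psi> t \<noteq> 0}"
  have "((\<lambda>t. ?\<phi> t + ?\<psi> t) has_integral (f (x s') - f (x s)) + (f (x s) - f (x s'))) {s..s'}"
    using up dn by (rule has_integral_add)
  then have "((\<lambda>t. ?\<phi> t + ?\<psi> t) has_integral 0) {s..s'}" by simp
  then have M: "negligible M" unfolding M_def
  proof (rule nonneg_has_integral_0_imp_negligible)
    fix t
    obtain v where "v \<in> D (x t)" using D_ne by blast
    from \<phi>_ge[OF this] \<psi>_ge[OF this] show "0 \<le> ?\<phi> t + ?\<psi> t" by linarith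
  qed auto
  show ?thesis
  proof (rule has_integral_spike[OF _ _ dn])
    show "negligible (N \<union> M)" using N M by (simp add: negligible_Un)
    fix t assume t: "t \<in> {s..s'} - (N \<union> M)"
    then have vd: "vector_derivative x (at t) = w t" using velocity[of t] assms by (auto intro: vector_derivative_at)
    have "?\<phi> t + ?\<psi> t = 0" using t by (auto simp: M_def)
    then have "D (x t) \<subseteq> {v. w t \<bullet> v = ?\<phi> t}"
      using \<phi>_ge[of _ t] \<psi>_ge[of _ t] unfolding vd by fastforce
    then have "convex hull (D (x t)) \<subseteq> {v. w t \<bullet> v = ?\<phi> t}"
      by (intro hull_minimal convex_hyperplane)
    moreover have "- w t \<in> convex hull (D (x t))" using inclusion[of t] t assms by auto
    ultimately have "w t \<bullet> (- w t) = ?\<phi> t" by blast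
    with \<open>?\<phi> t + ?\<psi> t = 0\<close> show "w t \<bullet> w t = ?\<psi> t" by simp
  qed
qed

lemma decreasing:
  assumes "0 \<le> s" "s \<le> s'" shows "f (x s') \<le> f (x s)"
  using has_integral_nonneg[OF energy[OF assms]] by simp

text \<open>Continuity along the trajectory comes from the energy identity, which exhibits the value
  as an indefinite integral.\<close>

lemma continuous_value: "continuous_on {0..T} (\<lambda>t. f (x t))"
proof (cases "T \<ge> 0")
  case True
  have "continuous_on {0..T} (\<lambda>t. f (x 0) - integral {0..t} (\<lambda>t. w t \<bullet> w t))"
    using energy[of 0 T] True
    by (intro continuous_intros indefinite_integral_continuous_1) (auto simp: integrable_on_def)
  moreover have "f (x 0) - integral {0..t} (\<lambda>t. w t \<bullet> w t) = f (x t)" if "t \<in> {0..T}" for t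
    using integral_unique[OF energy[of 0 t]] that by simp
  ultimately show ?thesis by (rule continuous_on_eq)
qed simp

text \<open>Measurability is inherited from the integrable square through \<open>sqrt\<close>, and
  the speed is dominated by 1 plus its square.\<close>

lemma speed_integrable:
  assumes "0 \<le> s" shows "(\<lambda>t. norm (w t)) integrable_on {s..s'}"
proof (cases "s \<le> s'")
  case True
  let ?g = "\<lambda>t. w t \<bullet> w t"
  have g: "?g integrable_on {s..s'}" using energy[OF assms True] by blast
  have "sqrt \<in> borel_measurable borel" by (intro borel_measurable_continuous_onI continuous_intros)
  from measurable_compose[OF integrable_imp_measurable[OF g] this]
 have "(\<lambda>t. norm (w t)) \<in> borel_measurable (lebesgue_on {s..s'})"
    by (simp add: norm_eq_sqrt_inner)
  moreover have "(\<lambda>t. 1 + ?g t) integrable_on {s..s'}" using g by (intro integrable_add) auto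
  moreover have "norm (norm (w t)) \<le> 1 + ?g t" for t
  proof -
    have "0 \<le> (norm (w t) - 1)\<^sup>2 + (norm (w t))\<^sup>2 + 1" by simp
    then have "2 * norm (w t) \<le> 2 + 2 * (norm (w t))\<^sup>2" by (simp add: power2_diff)
    then show ?thesis by (simp add: dot_square_norm)
  qed
  ultimately show ?thesis
    by (rule measurable_bounded_by_integrable_imp_integrable) simp
qed (simp add: integrable_on_empty)

lemma displacement_le:
  assumes "0 \<le> s" "s \<le> s'"
  shows "norm (x s' - x s) \<le> integral {s..s'} (\<lambda>t. norm (w t))"
proof -
  have "(w has_integral x s' - x s) {s..s'}"
  proof (rule abs_continuous_has_integral[OF _ \<open>s \<le> s'\<close> N])
    show "abs_continuous_on {s..s'} x"
      using assms by (intro abs_continuous_on_subset[OF ac[of s']]) auto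
    show "(x has_vector_derivative w t) (at t within {s..s'})" if "t \<in> {s..s'} - N" for t
      using velocity[of t] that assms by (auto intro: has_vector_derivative_at_within)
  qed
  then have "x s' - x s = integral {s..s'} w" "w integrable_on {s..s'}" by (auto simp: integral_unique)
  then show ?thesis using integral_norm_bound_integral[OF _ speed_integrable[OF assms(1)], of w] by simp
qed

lemma speed_integral_level:
  assumes "0 \<le> s" "s \<le> s'" "f (x s) = f (x s')"
  shows "integral {s..s'} (\<lambda>t. norm (w t)) = 0"
proof -
  have "negligible {t \<in> {s..s'}. w t \<bullet> w t \<noteq> 0}"
    using energy[OF assms(1,2)] assms(3) by (intro nonneg_has_integral_0_imp_negligible) auto
  then have "integral {s..s'} (\<lambda>t. norm (w t)) = integral {s..s'} (\<lambda>t. 0)"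
    by (rule integral_spike) auto
  then show ?thesis by simp
qed

section \<open>Length of the trajectory, given a desingularising function\<close>

context
  fixes h :: "real \<Rightarrow> real" and Q :: "real set" and L :: real
  assumes Q: "finite Q" and L: "L \<ge> 0" and h0: "\<And>r. h r \<ge> 0" and hc: "\<And>r. r \<notin> Q \<Longrightarrow> isCont h r"
    and h: "\<And>z s. z \<bullet> z \<le> R \<Longrightarrow> slope_le z s \<Longrightarrow> f z \<notin> Q \<Longrightarrow> 1 \<le> 2 * s * h (f z)"
    and H: "\<And>a b z. a \<le> b \<Longrightarrow> {a..b} \<inter> Q = {} \<Longrightarrow> z \<bullet> z \<le> R \<Longrightarrow> f z = a \<Longrightarrow>
       \<exists>H. (\<forall>r\<in>{a..b}. (H has_real_derivative h r) (at r)) \<and> H b - H a \<le> L"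
begin

lemma speed_le:
  assumes "0 \<le> t" "t \<notin> N" "f (x t) \<notin> Q"
  shows "norm (w t) \<le> 2 * h (f (x t)) * (w t \<bullet> w t)"
proof -
  have "slope_le (x t) (norm (w t))"
    using slope_le_convex_hull[OF inclusion[OF assms(1,2)]] by simp
  from h[OF bounded_traj[OF assms(1)] this assms(3)]
  have "norm (w t) * 1 \<le> norm (w t) * (2 * norm (w t) * h (f (x t)))"
    by (intro mult_left_mono) auto
  also have "\<dots> = 2 * h (f (x t)) * (w t \<bullet> w t)"
    by (simp add: dot_square_norm power2_eq_square)
  finally show ?thesis by simp
qed

text \<open>Formally, the integral of \<open>2 * h (f x) * (w \<bullet> w)\<close> is twice the drop
  of a primitive of h along f. Instead of a substitution, the inequality is proved with an error e
  on short intervals, where h is nearly constant, and extended by Bolzano bisection.\<close>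

lemma speed_integral_closed_piece:
  assumes s: "0 \<le> s" "s \<le> s'" and nQ: "{f (x s')..f (x s)} \<inter> Q = {}"
  shows "integral {s..s'} (\<lambda>t. norm (w t)) \<le> 2 * L"
proof -
  let ?F = "\<lambda>t. f (x t)"
  have le: "?F v \<le> ?F u" if "s \<le> u" "u \<le> v" for u v using decreasing[of u v] s that by simp
  have range: "?F s' \<le> ?F t" "?F t \<le> ?F s" if "s \<le> t" "t \<le> s'" for t using le that by auto
  obtain H0 where H0: "\<And>r. r \<in> {?F s'..?F s} \<Longrightarrow> (H0 has_real_derivative h r) (at r)" "H0 (?F s) - H0 (?F s') \<le> L"
    using H[OF le[OF order_refl s(2)] nQ bounded_traj refl] s by (metis order_trans)
  have bound: "integral {s..s'} (\<lambda>t. norm (w t)) \<le> 2 * L + e * (?F s - ?F s')" if e: "e > 0" for e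
  proof -
    \<comment> \<open>Both right-hand terms are additive over adjacent intervals, so P survives
      gluing.\<close>
    define P where "P u v \<longleftrightarrow> (s \<le> u \<longrightarrow> v \<le> s' \<longrightarrow>
      integral {u..v} (\<lambda>t. norm (w t)) \<le> 2 * (H0 (?F u) - H0 (?F v)) + e * (?F u - ?F v))" for u v
    have "P s s'" using s(2)
    proof (induction rule: Bolzano)
      case (trans a b c)
      show ?case unfolding P_def
      proof (intro impI)
        assume "s \<le> a" "c \<le> s'"
        then have "integral {a..b} (\<lambda>t. norm (w t)) + integral {b..c} (\<lambda>t. norm (w t)) = integral {a..c} (\<lambda>t. norm (w t))"
          using trans s by (intro Henstock_Kurzweil_Integration.integral_combine speed_integrable) auto
        then show "integral {a..c} (\<lambda>t. norm (w t)) \<le> 2 * (H0 (?F a) - H0 (?F c)) + e * (?F a - ?F c)"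
          using trans \<open>s \<le> a\<close> \<open>c \<le> s'\<close> unfolding P_def by (simp add: algebra_simps)
      qed
    next
      case (local t)
      define r where "r = ?F t"
      have "r \<in> {?F s'..?F s}" using range local by (simp add: r_def)
      then have "r \<notin> Q" using nQ by blast
      have e4: "e / 4 > 0" using e by simp
      obtain \<delta> where \<delta>: "\<delta> > 0" "\<And>r'. \<bar>r' - r\<bar> < \<delta> \<Longrightarrow> \<bar>h r' - h r\<bar> < e / 4"
        using hc[OF \<open>r \<notin> Q\<close>] e4 unfolding continuous_at_eps_delta dist_real_def by blast
      have "t \<in> {0..s'}" using local s by auto
      then obtain d where d: "d > 0" "\<And>u. u \<in> {0..s'} \<Longrightarrow> \<bar>u - t\<bar> < d \<Longrightarrow> \<bar>?F u - r\<bar> < \<delta>"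
        using continuous_value[of s'] \<delta>(1) unfolding continuous_on_iff dist_real_def r_def by blast
      have "P u v" if uv: "u \<le> t" "t \<le> v" "v - u < d" for u v
        unfolding P_def
      proof (intro impI)
        assume "s \<le> u" "v \<le> s'"
        have near: "\<bar>?F \<tau> - r\<bar> < \<delta>" if "\<tau> \<in> {u..v}" for \<tau>
          using that uv \<open>s \<le> u\<close> \<open>v \<le> s'\<close> s by (intro d) auto
        have avoid: "?F \<tau> \<notin> Q" if "\<tau> \<in> {u..v}" for \<tau>
        proof -
          have "?F \<tau> \<in> {?F s'..?F s}" using range that \<open>s \<le> u\<close> \<open>v \<le> s'\<close> by simp
          then show ?thesis using nQ by blast
        qed
        have en: "((\<lambda>\<tau>. w \<tau> \<bullet> w \<tau>) has_integral ?F u - ?F v) {u..v}"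
          using s \<open>s \<le> u\<close> uv by (intro energy) auto
        \<comment> \<open>Twice the upper bound \<open>h r + e / 4\<close> of h nearby. The mean
          value theorem below uses the lower bound \<open>h r - e / 4\<close>; twice the gap between
          the two is the error rate e.\<close>
        define c where "c = 2 * h r + e / 2"
        have "((\<lambda>\<tau>. if \<tau> \<in> N then 0 else norm (w \<tau>)) has_integral integral {u..v} (\<lambda>\<tau>. norm (w \<tau>))) {u..v}"
          by (rule has_integral_spike[OF N _ integrable_integral[OF speed_integrable]]) (use s \<open>s \<le> u\<close> in auto)
        moreover have "((\<lambda>\<tau>. c * (w \<tau> \<bullet> w \<tau>)) has_integral c * (?F u - ?F v)) {u..v}"
          using en by (rule has_integral_mult_right)
        ultimately have "integral {u..v} (\<lambda>\<tau>. norm (w \<tau>)) \<le> c * (?F u - ?F v)"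
        proof (rule has_integral_le)
          fix \<tau> assume \<tau>: "\<tau> \<in> {u..v}"
          have c0: "0 \<le> c" using h0[of r] e by (simp add: c_def)
          show "(if \<tau> \<in> N then 0 else norm (w \<tau>)) \<le> c * (w \<tau> \<bullet> w \<tau>)"
          proof (cases "\<tau> \<in> N")
            case True
            then show ?thesis using c0 by simp
          next
            case False
            then have "norm (w \<tau>) \<le> 2 * h (?F \<tau>) * (w \<tau> \<bullet> w \<tau>)"
              using \<tau> s \<open>s \<le> u\<close> avoid by (intro speed_le) auto
            also have "\<dots> \<le> c * (w \<tau> \<bullet> w \<tau>)"
            proof (rule mult_right_mono)
              have "h (?F \<tau>) - h r < e / 4" using \<delta>(2)[OF near[OF \<tau>]] by (rule le_less_trans[OF abs_ge_self])
              then show "2 * h (?F \<tau>) \<le> c" unfolding c_def by linarith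
            qed simp
            finally show ?thesis using False by simp
          qed
        qed
        moreover have "(h r - e / 4) * (?F u - ?F v) \<le> H0 (?F u) - H0 (?F v)"
        proof (cases "?F v < ?F u")
          case True
          have sub: "{?F v..?F u} \<subseteq> {?F s'..?F s}" using range uv \<open>s \<le> u\<close> \<open>v \<le> s'\<close> by auto
          have "\<exists>z. ?F v < z \<and> z < ?F u \<and> H0 (?F u) - H0 (?F v) = (?F u - ?F v) * h z"
            using sub by (intro MVT2 True H0(1)) auto
          then obtain z where z: "?F v < z" "z < ?F u" "H0 (?F u) - H0 (?F v) = (?F u - ?F v) * h z" by blast
          have "\<bar>z - r\<bar> < \<delta>" using near[of u] near[of v] z uv by auto
          from \<delta>(2)[OF this] have "- (h z - h r) < e / 4" by (rule le_less_trans[OF abs_ge_minus_self])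
          then have "h r - e / 4 \<le> h z" by linarith
          then have "(h r - e / 4) * (?F u - ?F v) \<le> h z * (?F u - ?F v)"
            using True by (intro mult_right_mono) auto
          then show ?thesis using z(3) by (simp add: mult.commute)
        next
          case False
          then have "?F u = ?F v" using le[of u v] \<open>s \<le> u\<close> uv by simp
          then show ?thesis by simp
        qed
        ultimately show "integral {u..v} (\<lambda>t. norm (w t)) \<le> 2 * (H0 (?F u) - H0 (?F v)) + e * (?F u - ?F v)"
          by (simp add: c_def algebra_simps)
      qed
      then show ?case using d(1) by blast
    qed
    then have "integral {s..s'} (\<lambda>t. norm (w t)) \<le> 2 * (H0 (?F s) - H0 (?F s')) + e * (?F s - ?F s')"
      by (simp add: P_def)
    then show ?thesis using H0(2) by simp
  qed
  have D0: "?F s - ?F s' \<ge> 0" using le[OF order_refl s(2)] by simp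
  show ?thesis
  proof (rule field_le_epsilon)
    fix e :: real assume "e > 0"
    define e' where "e' = e / (?F s - ?F s' + 1)"
    have "e' > 0" using \<open>e > 0\<close> D0 by (simp add: e'_def)
    moreover have "e' * (?F s - ?F s') \<le> e" using \<open>e > 0\<close> D0 by (simp add: e'_def field_simps)
    ultimately show "integral {s..s'} (\<lambda>t. norm (w t)) \<le> 2 * L + e" using bound[of e'] by simp
  qed
qed

text \<open>The two end levels may be exceptional. Let u0 be the last time on the upper level and v0
  the first on the lower: outside [u0, v0] the value is constant and the length zero, while inside,
  closed pieces shrink away from both ends and their bounds pass to the limit.\<close>

lemma speed_integral_open_piece:
  assumes s: "0 \<le> s" "s \<le> s'" and nQ: "{f (x s')<..<f (x s)} \<inter> Q = {}"
  shows "integral {s..s'} (\<lambda>t. norm (w t)) \<le> 2 * L"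
proof (cases "f (x s) = f (x s')")
  case True
  then show ?thesis using speed_integral_level[OF s] L by simp
next
  case False
  let ?F = "\<lambda>t. f (x t)" and ?I = "\<lambda>u v. integral {u..v} (\<lambda>t. norm (w t))"
  have le: "?F v \<le> ?F u" if "s \<le> u" "u \<le> v" for u v using decreasing[of u v] s that by simp
  have cF: "continuous_on {s..s'} ?F" using s by (intro continuous_on_subset[OF continuous_value[of s']]) auto
  define A where "A = {t \<in> {s..s'}. ?F s \<le> ?F t}"
  define B where "B = {t \<in> {s..s'}. ?F t \<le> ?F s'}"
  have "closed A" "closed B" unfolding A_def B_def
    by (intro continuous_on_closed_Collect_le cF continuous_on_const closed_atLeastAtMost)+
  moreover have "A = {s..s'} \<inter> A" "B = {s..s'} \<inter> B" by (auto simp: A_def B_def)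
  ultimately have "compact A" "compact B" by (metis compact_Icc compact_Int_closed)+
  moreover have "s \<in> A" "s' \<in> B" using s by (auto simp: A_def B_def)
  ultimately obtain u0 v0 where u0: "u0 \<in> A" "\<And>t. t \<in> A \<Longrightarrow> t \<le> u0" and v0: "v0 \<in> B" "\<And>t. t \<in> B \<Longrightarrow> v0 \<le> t"
    using compact_attains_sup[of A] compact_attains_inf[of B] by (metis empty_iff)
  have u: "s \<le> u0" "u0 \<le> s'" "?F u0 = ?F s" using u0(1) le[of s u0] by (auto simp: A_def)
  have v: "s \<le> v0" "v0 \<le> s'" "?F v0 = ?F s'" using v0(1) le[of v0 s'] by (auto simp: B_def)
  have "u0 < v0"
  proof (rule ccontr)
    assume "\<not> u0 < v0"
    then have "?F s \<le> ?F s'" using le[of v0 u0] u v by simp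
    then show False using le[of s s'] s False by simp
  qed
  have inner: "?I a b \<le> 2 * L" if ab: "u0 < a" "a \<le> b" "b < v0" for a b
  proof (rule speed_integral_closed_piece)
    have "a \<notin> A" "b \<notin> B" using u0(2)[of a] v0(2)[of b] ab by auto
    then have "?F a < ?F s" "?F s' < ?F b" using ab u v by (auto simp: A_def B_def)
    then have "{?F b..?F a} \<subseteq> {?F s'<..<?F s}" by auto
    then show "{?F b..?F a} \<inter> Q = {}" using nQ by blast
  qed (use ab u s in auto)
  define g where "g t = ?I u0 t" for t
  have int: "(\<lambda>t. norm (w t)) integrable_on {a..b}" if "a \<ge> s" for a b using s that by (intro speed_integrable) auto
  have cg: "continuous_on {u0..v0} g" unfolding g_def
    by (intro indefinite_integral_continuous_1 int u)
  \<comment> \<open>The summand 3 keeps \<open>k n\<close> below half of \<open>v0 - u0\<close>, so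
    that \<open>a n \<le> b n\<close> from n = 0 on.\<close>
  define k where "k n = (v0 - u0) / (real n + 3)" for n
  define a where "a n = u0 + k n" for n
  define b where "b n = v0 - k n" for n
  have k: "0 < k n" "2 * k n \<le> v0 - u0" for n
  proof -
    show "0 < k n" using \<open>u0 < v0\<close> by (simp add: k_def)
    have "k n * 2 \<le> k n * (real n + 3)" using \<open>0 < k n\<close> by (intro mult_left_mono) auto
    also have "\<dots> = v0 - u0" by (simp add: k_def)
    finally show "2 * k n \<le> v0 - u0" by (simp add: mult.commute)
  qed
  have ab: "u0 < a n" "a n \<le> b n" "b n < v0" for n using k[of n] by (auto simp: a_def b_def)
  have "k \<longlonglongrightarrow> 0" unfolding k_def by real_asymp
  then have "a \<longlonglongrightarrow> u0 + 0" "b \<longlonglongrightarrow> v0 - 0" unfolding a_def b_def by (intro tendsto_intros; assumption)+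
  then have lims: "a \<longlonglongrightarrow> u0" "b \<longlonglongrightarrow> v0" by simp_all
  have mem: "a n \<in> {u0..v0}" "b n \<in> {u0..v0}" for n using ab[of n] by auto
  have ga: "(\<lambda>n. g (a n)) \<longlonglongrightarrow> g u0"
    by (rule continuous_on_tendsto_compose[OF cg lims(1)]) (use \<open>u0 < v0\<close> mem in auto)
  have gb: "(\<lambda>n. g (b n)) \<longlonglongrightarrow> g v0"
    by (rule continuous_on_tendsto_compose[OF cg lims(2)]) (use \<open>u0 < v0\<close> mem in auto)
  have "g (b n) - g (a n) \<le> 2 * L" for n
  proof -
    have "?I u0 (a n) + ?I (a n) (b n) = ?I u0 (b n)"
      using ab[of n] u by (intro Henstock_Kurzweil_Integration.integral_combine int) auto
    then show ?thesis using inner[OF ab, of n] by (simp add: g_def)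
  qed
  then have "g v0 - g u0 \<le> 2 * L"
    by (intro LIMSEQ_le_const2[OF tendsto_diff[OF gb ga]]) auto
  then have "?I u0 v0 \<le> 2 * L" by (simp add: g_def)
  moreover have "?I s u0 = 0" using u s by (intro speed_integral_level) auto
  moreover have "?I v0 s' = 0" using v s by (intro speed_integral_level) auto
  moreover have "?I s s' = ?I s u0 + ?I u0 v0 + ?I v0 s'"
    using u v \<open>u0 < v0\<close> by (intro integral_pieces int) auto
  ultimately show ?thesis by simp
qed

text \<open>By continuity the trajectory meets any exceptional level strictly between its end
  values; cutting there leaves two pieces with fewer such levels each.\<close>

lemma speed_integral_le:
  "0 \<le> s \<Longrightarrow> s \<le> s' \<Longrightarrow>
    integral {s..s'} (\<lambda>t. norm (w t)) \<le> 2 * L * (card (Q \<inter> {f (x s')<..<f (x s)}) + 1)"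
proof (induction "card (Q \<inter> {f (x s')<..<f (x s)})" arbitrary: s s' rule: less_induct)
  case less
  let ?F = "\<lambda>t. f (x t)" and ?I = "\<lambda>u v. integral {u..v} (\<lambda>t. norm (w t))"
  let ?n = "\<lambda>u v. card (Q \<inter> {?F v<..<?F u})"
  show ?case
  proof (cases "Q \<inter> {?F s'<..<?F s} = {}")
    case True
    then show ?thesis using speed_integral_open_piece[OF less.prems] by (simp add: Int_commute)
  next
    case False
    then obtain q where q: "q \<in> Q" "?F s' < q" "q < ?F s" by auto
    have "continuous_on {s..s'} ?F" using less.prems by (intro continuous_on_subset[OF continuous_value[of s']]) auto
    then obtain t where t: "s \<le> t" "t \<le> s'" "?F t = q"
      using IVT2'[of ?F s' q s] q less.prems by auto
    let ?A = "Q \<inter> {?F t<..<?F s}" and ?B = "Q \<inter> {?F s'<..<?F t}" and ?C = "Q \<inter> {?F s'<..<?F s}"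
    \<comment> \<open>The cut level q lies in neither part, so it pays for the additional summand 1
      that arises when the two bounds are added.\<close>
    have "card (insert q (?A \<union> ?B)) \<le> card ?C" using q t Q by (intro card_mono) auto
    moreover have "card (insert q (?A \<union> ?B)) = Suc (card ?A + card ?B)"
      using Q t by (subst card_insert_disjoint) (auto intro: card_Un_disjoint)
    ultimately have c: "card ?A + card ?B + 1 \<le> card ?C" by simp
    have "?I s t \<le> 2 * L * (?n s t + 1)" using c less.prems t by (intro less.hyps) auto
    moreover have "?I t s' \<le> 2 * L * (?n t s' + 1)" using c less.prems t by (intro less.hyps) auto
    moreover have "?I s t + ?I t s' = ?I s s'"
      using t less.prems by (intro Henstock_Kurzweil_Integration.integral_combine speed_integrable) auto
    ultimately have "?I s s' \<le> 2 * L * (real (card ?A + card ?B + 1) + 1)" by (simp add: algebra_simps)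
    also have "\<dots> \<le> 2 * L * (real (card ?C) + 1)"
      using c L by (intro mult_left_mono) (auto simp del: of_nat_add)
    finally show ?thesis by (simp add: add.commute)
  qed
qed

end

section \<open>Finite length and convergence\<close>

lemma speed_integral_bounded: "\<exists>M. \<forall>T\<ge>0. integral {0..T} (\<lambda>t. norm (w t)) \<le> M"
proof -
  obtain h Q L where hQ: "finite Q" "L \<ge> 0" "\<And>r. h r \<ge> 0" "\<And>r. r \<notin> Q \<Longrightarrow> isCont h r"
    "\<And>z s. z \<bullet> z \<le> R \<Longrightarrow> slope_le z s \<Longrightarrow> f z \<notin> Q \<Longrightarrow> 1 \<le> 2 * s * h (f z)"
    "\<And>a b z. a \<le> b \<Longrightarrow> {a..b} \<inter> Q = {} \<Longrightarrow> z \<bullet> z \<le> R \<Longrightarrow> f z = a \<Longrightarrow>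
       \<exists>H. (\<forall>r\<in>{a..b}. (H has_real_derivative h r) (at r)) \<and> H b - H a \<le> L"
    by (rule desingularising_function[of R]) (rule that; assumption)
  have "integral {0..T} (\<lambda>t. norm (w t)) \<le> 2 * L * (card Q + 1)" if "T \<ge> 0" for T
  proof -
    have "integral {0..T} (\<lambda>t. norm (w t)) \<le> 2 * L * (card (Q \<inter> {f (x T)<..<f (x 0)}) + 1)"
      using hQ that by (intro speed_integral_le[where h = h]) auto
    also have "\<dots> \<le> 2 * L * (card Q + 1)"
      using hQ(1,2) by (intro mult_left_mono) (auto intro: card_mono)
    finally show ?thesis .
  qed
  then show ?thesis by blast
qed

lemma finite_length: "(\<lambda>t. norm (w t)) integrable_on {0..}"
proof -
  obtain M where M: "\<And>T. T \<ge> 0 \<Longrightarrow> integral {0..T} (\<lambda>t. norm (w t)) \<le> M"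
    using speed_integral_bounded by blast
  let ?g = "\<lambda>k t. if t \<in> {0..real k} then norm (w t) else 0"
  have eq: "{0..real k} \<inter> {0..} = {0..real k}" for k by auto
  have "(\<lambda>t. norm (w t)) integrable_on {0..} \<and>
    ((\<lambda>k. integral {0..} (?g k)) \<longlonglongrightarrow> integral {0..} (\<lambda>t. norm (w t)))"
  proof (rule monotone_convergence_increasing)
    show "?g k integrable_on {0..}" for k
      unfolding integrable_restrict_Int eq by (rule speed_integrable) simp
    show "?g k t \<le> ?g (Suc k) t" for k t by auto
    show "(\<lambda>k. ?g k t) \<longlonglongrightarrow> norm (w t)" if "t \<in> {0..}" for t
    proof (rule tendsto_eventually)
      obtain k0 where "t \<le> real k0" using real_arch_simple by blast
      then show "\<forall>\<^sub>F k in sequentially. ?g k t = norm (w t)"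
        using that by (intro eventually_sequentiallyI[of k0]) auto
    qed
    have "integral {0..} (?g k) = integral {0..real k} (\<lambda>t. norm (w t))" for k
      unfolding integral_restrict_Int eq ..
    moreover have "0 \<le> integral {0..real k} (\<lambda>t. norm (w t))" for k
      by (intro integral_nonneg speed_integrable) auto
    ultimately have "norm (integral {0..} (?g k)) \<le> M" for k using M[of "real k"] by simp
    then show "bounded (range (\<lambda>k. integral {0..} (?g k)))" by (auto simp: bounded_iff)
  qed
  then show ?thesis by blast
qed

text \<open>Displacements are bounded by increments of the length function G, which is nondecreasing
  and bounded. Hence x is Cauchy at infinity; the limit is found along the integers and then shown
  to attract all times.\<close>

lemma trajectory_converges: "\<exists>l. (x \<longlongrightarrow> l) at_top"
proof -
  obtain M where M: "\<And>T. T \<ge> 0 \<Longrightarrow> integral {0..T} (\<lambda>t. norm (w t)) \<le> M"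
    using speed_integral_bounded by blast
  define G where "G T = integral {0..T} (\<lambda>t. norm (w t))" for T
  have bG: "bdd_above (G ` {0..})" using M by (auto simp: bdd_above_def G_def)
  have diff: "norm (x t - x s) \<le> G t - G s" if "0 \<le> s" "s \<le> t" for s t
  proof -
    have "G s + integral {s..t} (\<lambda>t. norm (w t)) = G t"
      unfolding G_def using that by (intro Henstock_Kurzweil_Integration.integral_combine speed_integrable) auto
    then show ?thesis using displacement_le[OF that] by simp
  qed
  define K where "K = (SUP T\<in>{0..}. G T)"
  have tail: "\<exists>T\<ge>0. \<forall>s\<ge>T. \<forall>t\<ge>T. norm (x t - x s) < e" if e: "e > 0" for e
  proof -
    obtain T where T: "T \<ge> 0" "K - e < G T"
      using less_cSUP_iff[OF _ bG, of "K - e"] e unfolding K_def by auto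
    have close: "norm (x t - x s) < e" if "T \<le> s" "s \<le> t" for s t
    proof -
      have "G t \<le> K" unfolding K_def using that T by (intro cSUP_upper bG) auto
      moreover have "G T \<le> G s" using diff[of T s] T that norm_ge_zero[of "x s - x T"] by linarith
      ultimately show ?thesis using diff[of s t] that T by linarith
    qed
    have "norm (x t - x s) < e" if "s \<ge> T" "t \<ge> T" for s t
      using close[of s t] close[of t s] that by (cases "s \<le> t") (auto simp: norm_minus_commute)
    with T(1) show ?thesis by blast
  qed
  have "Cauchy (\<lambda>n. x (real n))"
    unfolding Cauchy_def
  proof (intro allI impI)
    fix e :: real assume "e > 0"
    then obtain T where T: "\<And>s t. s \<ge> T \<Longrightarrow> t \<ge> T \<Longrightarrow> norm (x t - x s) < e" using tail by blast
    obtain n0 where "T \<le> real n0" using real_arch_simple by blast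
    then show "\<exists>n0. \<forall>m\<ge>n0. \<forall>n\<ge>n0. dist (x (real m)) (x (real n)) < e"
      using T by (intro exI[of _ n0]) (auto simp: dist_norm)
  qed
  then obtain l where l: "(\<lambda>n. x (real n)) \<longlonglongrightarrow> l" using Cauchy_convergent_iff convergent_def by blast
  have "(x \<longlongrightarrow> l) at_top"
  proof (rule tendstoI)
    fix e :: real assume "e > 0"
    then have "e / 2 > 0" by simp
    then obtain T where T: "\<And>s t. s \<ge> T \<Longrightarrow> t \<ge> T \<Longrightarrow> norm (x t - x s) < e / 2" using tail by blast
    have "dist (x t) l < e" if "t \<ge> T" for t
    proof -
      have "(\<lambda>n. norm (x t - x (real n))) \<longlonglongrightarrow> norm (x t - l)" by (intro tendsto_intros l)
      moreover obtain n0 where n0: "T \<le> real n0" using real_arch_simple by blast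
      have "norm (x t - x (real n)) \<le> e / 2" if "n \<ge> n0" for n
        using T[of "real n" t] \<open>t \<ge> T\<close> n0 that by (simp add: less_imp_le)
      ultimately have "norm (x t - l) \<le> e / 2" by (intro LIMSEQ_le_const2) auto
      then show ?thesis using \<open>e > 0\<close> by (simp add: dist_norm)
    qed
    then show "\<forall>\<^sub>F t in at_top. dist (x t) l < e" by (auto simp: eventually_at_top_linorder)
  qed
  then show ?thesis ..
qed

end

theorem theorem7:
  fixes S :: "nat \<Rightarrow> real list set set"
    and D :: "real ^ 'p::finite \<Rightarrow> (real ^ 'p) set"
    and f :: "real ^ 'p \<Rightarrow> real"
    and x :: "real \<Rightarrow> real ^ 'p"
  assumes "o_minimal S"
    and "conservative_field D" and "definable_setvalued S D"
    and "potential_of f D" and "definable_fun S f"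
    and "\<forall>T\<ge>0. abs_continuous_on {0..T} x"
    and "AE t in lborel. 0 \<le> t \<longrightarrow>
           (\<exists>v. (x has_vector_derivative v) (at t) \<and> v \<in> uminus ` (convex hull (D (x t))))"
    and "bounded (x ` {0..})"
  shows "(\<lambda>t. norm (vector_derivative x (at t))) integrable_on {0..}
         \<and> (\<exists>l. (x \<longlongrightarrow> l) at_top)"
proof -
  let ?P = "\<lambda>t. \<exists>v. (x has_vector_derivative v) (at t) \<and> v \<in> uminus ` (convex hull (D (x t)))"
  obtain N where N: "N \<in> null_sets lborel" and sub: "{t \<in> space lborel. \<not> (0 \<le> t \<longrightarrow> ?P t)} \<subseteq> N"
    using assms(7) unfolding eventually_ae_filter by blast
  have deriv: "?P t" if t: "0 \<le> t" "t \<notin> N" for t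
  proof (rule ccontr)
    assume "\<not> ?P t"
    with t(1) have "t \<in> {t \<in> space lborel. \<not> (0 \<le> t \<longrightarrow> ?P t)}" by simp
    with sub t(2) show False by blast
  qed
  have negl: "negligible N"
    using N by (simp add: negligible_iff_null_sets null_sets_completionI)
  obtain b where b: "\<And>t. 0 \<le> t \<Longrightarrow> norm (x t) \<le> b" using assms(8) by (auto simp: bounded_iff)
  \<comment> \<open>Off N the derivative is unique, so \<open>vector_derivative\<close> is the
    velocity for which the inclusion is assumed. The ball enters through its squared radius, which
    is a polynomial condition.\<close>
  interpret subgradient_trajectory S D f x "\<lambda>t. vector_derivative x (at t)" N "b\<^sup>2"
  proof
    show "o_minimal S" "potential_of f D" "definable_setvalued S D" "definable_fun S f" by fact+
    show "D z \<noteq> {}" "compact (D z)" for z using assms(2) by (auto simp: conservative_field_def)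
    show "abs_continuous_on {0..T} x" if "T \<ge> 0" for T using assms(6) that by blast
    show "negligible N" by fact
    show "(x has_vector_derivative vector_derivative x (at t)) (at t)" if "0 \<le> t" "t \<notin> N" for t
      using deriv[OF that] by (auto simp: vector_derivative_works[symmetric] intro: differentiableI_vector)
    show "- vector_derivative x (at t) \<in> convex hull (D (x t))" if "0 \<le> t" "t \<notin> N" for t
      using deriv[OF that] by (auto dest: vector_derivative_at)
    show "x t \<bullet> x t \<le> b\<^sup>2" if "0 \<le> t" for t
      using b[OF that] by (simp add: dot_square_norm power_mono)
  qed
  show ?thesis using finite_length trajectory_converges by blast
qed

end
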